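(* Let $X$ be the controlled diffusion $$dX_t = f(t,X_t)\,dt + g(t)\,(U_t\,dt + dW_t),\qquad X_0\sim q_0,\qquad 0\le t\le T,$$ where the diffusion matrix $g(t,x)=g(t)$ does not depend on the state, and put $A_t := \frac{\partial f}{\partial x}(t,X_t)$. Let $(Y_t,Z_t)$ be the adapted adjoint process, i.e. the $\mathcal F_t$-adapted solution of the backward SDE $$-dY_t = \frac{\partial H}{\partial x}(t,X_t,Y_t,Z_t,U_t)\,dt - Z_t\,dW_t,\qquad Y_T=\nabla \ell_f(X_T),$$ and let $\mathsf Y_t$ be the non-adapted adjoint process, i.e. the pathwise solution of $$\frac{d\mathsf Y_t}{dt} = -A_t^\top \mathsf Y_t,\qquad \mathsf Y_T=\nabla \ell_f(X_T).$$ Let $\Phi_t,\Psi_t$ be the matrix processes defined by $d\Phi_t=-A_t^\top\Phi_t\,dt$, $d\Psi_t=\Psi_tA_t^\top\,dt$, $\Phi_0=\Psi_0=I$. Then for every $t\in[0,T]$, $$Y_t=\mathbb E[\mathsf Y_t\mid\mathcal F_t],\qquad\text{and}\qquad \mathsf Y_t-Y_t=\int_t^T\Phi_t\Psi_sZ_s\,dW_s .$$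
   Context: $(\Omega,\mathcal F,\{\mathcal F_t\}_{t\ge0},\mathbb P)$ is a filtered probability space, $W=\{W_t;\,0\le t\le T\}$ is an $n$-dimensional standard Wiener process adapted to $\{\mathcal F_t\}$, where $\mathcal F_t$ is the filtration generated by the initial condition $X_0$ and the Wiener process. The functions $f:[0,T]\times\mathbb R^n\to\mathbb R^n$ (differentiable in $x$, with Jacobian $\frac{\partial f}{\partial x}$) and $g:[0,T]\to\mathbb R^{n\times n}$ satisfy the usual regularity conditions (global Lipschitz continuity and linear growth in $x$) ensuring existence of a strong solution. The control $U$ is an $\mathcal F_t$-adapted process with $\mathbb E\int_0^T\|U_t\|^2dt<\infty$. The function $\ell_f:\mathbb R^n\to\mathbb R$ is a differentiable terminal loss function, with $\nabla\ell_f(X_T)$ square integrable; $(Y,Z)$ is the square-integrable adapted solution of the backward SDE, $Y_t\in\mathbb R^n$, $Z_t\in\mathbb R^{n\times n}$. The Hamiltonian is $$H(t,x,y,z,u):=\tfrac12\|u\|^2+y^\top\big(f(t,x)+g(t,x)u\big)+\mathrm{Tr}\big(z\,g(t,x)\big),$$ for $(t,x,y,z,u)\in[0,T]\times\mathbb R^n\times\mathbb R^n\times\mathbb R^{n\times n}\times\mathbb R^n$, and $\frac{\partial H}{\partial x}$ is its partial gradient in $x$ with the other arguments fixed; here $g(t,x)=g(t)$. *)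

theory Defs
  imports "HOL-Probability.Probability"
begin

definition gradient :: "('a::real_inner \<Rightarrow> real) \<Rightarrow> 'a \<Rightarrow> 'a" where
  "gradient \<phi> x = (THE D. GDERIV \<phi> x :> D)"

definition hamiltonian ::
  "(real \<Rightarrow> real ^ 'n \<Rightarrow> real ^ 'n) \<Rightarrow> (real \<Rightarrow> real ^ 'n \<Rightarrow> real ^ 'n ^ 'n) \<Rightarrow>
   real \<Rightarrow> real ^ 'n \<Rightarrow> real ^ 'n \<Rightarrow> real ^ 'n ^ 'n \<Rightarrow> real ^ 'n \<Rightarrow> real" where
  "hamiltonian f g t x y z u =
     (norm u)\<^sup>2 / 2 + y \<bullet> (f t x + g t x *v u) + trace (z ** g t x)"

text \<open>
  A process is a function of time and outcome; only its values at times in the horizon from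
  \<open>0\<close> to \<open>T\<close> are ever constrained.
\<close>

definition filtered_prob_space ::
  "'w measure \<Rightarrow> (real \<Rightarrow> 'w measure) \<Rightarrow> real \<Rightarrow> bool" where
  "filtered_prob_space M F T \<longleftrightarrow> prob_space M \<and>
     (\<forall>t\<in>{0..T}. subalgebra M (F t)) \<and>
     (\<forall>s t. 0 \<le> s \<longrightarrow> s \<le> t \<longrightarrow> t \<le> T \<longrightarrow> sets (F s) \<subseteq> sets (F t))"

definition generated_sigma ::
  "'w measure \<Rightarrow> ('w \<Rightarrow> real ^ 'n) \<Rightarrow> (real \<Rightarrow> 'w \<Rightarrow> real ^ 'n) \<Rightarrow> real \<Rightarrow> 'w measure" where
  "generated_sigma M X0 W t = sigma (space M)
     ({X0 -` B \<inter> space M | B. B \<in> sets borel} \<union>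
      {W s -` B \<inter> space M | s B. s \<in> {0..t} \<and> B \<in> sets borel})"

definition null_augmented :: "'w measure \<Rightarrow> 'w measure \<Rightarrow> 'w measure" where
  "null_augmented M G = sigma (space M) (sets G \<union> null_sets M)"

text \<open>
  The generated filtration may be taken as it is or, as is customary for backward equations,
  augmented by the null events; both conventions are admitted.
\<close>

definition generated_filtration ::
  "'w measure \<Rightarrow> (real \<Rightarrow> 'w measure) \<Rightarrow> real \<Rightarrow> ('w \<Rightarrow> real ^ 'n) \<Rightarrow>
   (real \<Rightarrow> 'w \<Rightarrow> real ^ 'n) \<Rightarrow> bool" where
  "generated_filtration M F T X0 W \<longleftrightarrow>
     (\<forall>t\<in>{0..T}. sets (F t) = sets (generated_sigma M X0 W t)) \<or>
     (\<forall>t\<in>{0..T}. sets (F t) = sets (null_augmented M (generated_sigma M X0 W t)))"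

definition adapted_process ::
  "'w measure \<Rightarrow> (real \<Rightarrow> 'w measure) \<Rightarrow> real \<Rightarrow> (real \<Rightarrow> 'w \<Rightarrow> 'b::topological_space) \<Rightarrow> bool" where
  "adapted_process M F T V \<longleftrightarrow>
     (\<forall>t\<in>{0..T}. V t \<in> borel_measurable (F t)) \<and>
     (\<lambda>(t, \<omega>). V t \<omega>) \<in> borel_measurable (restrict_space borel {0..T} \<Otimes>\<^sub>M M)"

text \<open>
  Path continuity is only required almost surely.  Progressive measurability, which is automatic
  for an adapted process all of whose paths are continuous, is therefore stated separately.
\<close>

definition continuous_adapted_process ::
  "'w measure \<Rightarrow> (real \<Rightarrow> 'w measure) \<Rightarrow> real \<Rightarrow> (real \<Rightarrow> 'w \<Rightarrow> 'b::topological_space) \<Rightarrow> bool" where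
  "continuous_adapted_process M F T V \<longleftrightarrow>
     (\<forall>t\<in>{0..T}. (\<lambda>(s, \<omega>). V s \<omega>) \<in> borel_measurable (restrict_space borel {0..t} \<Otimes>\<^sub>M F t)) \<and>
     (AE \<omega> in M. continuous_on {0..T} (\<lambda>t. V t \<omega>))"

definition mean_square_energy ::
  "'w measure \<Rightarrow> real \<Rightarrow> real \<Rightarrow> (real \<Rightarrow> 'w \<Rightarrow> 'b::real_normed_vector) \<Rightarrow> ennreal" where
  "mean_square_energy M a b V =
     (\<integral>\<^sup>+\<omega>. (\<integral>\<^sup>+s\<in>{a..b}. ennreal ((norm (V s \<omega>))\<^sup>2) \<partial>lborel) \<partial>M)"

definition wiener_process ::
  "'w measure \<Rightarrow> (real \<Rightarrow> 'w measure) \<Rightarrow> real \<Rightarrow> (real \<Rightarrow> 'w \<Rightarrow> real ^ 'n) \<Rightarrow> bool" where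
  "wiener_process M F T W \<longleftrightarrow>
     (\<forall>t\<in>{0..T}. W t \<in> borel_measurable (F t)) \<and>
     (AE \<omega> in M. W 0 \<omega> = 0) \<and>
     (AE \<omega> in M. continuous_on {0..T} (\<lambda>t. W t \<omega>)) \<and>
     (\<forall>s t. 0 \<le> s \<longrightarrow> s < t \<longrightarrow> t \<le> T \<longrightarrow>
        distributed M lborel (\<lambda>\<omega>. W t \<omega> - W s \<omega>)
          (\<lambda>x. \<Prod>i\<in>UNIV. ennreal (normal_density 0 (sqrt (t - s)) (x $ i))) \<and>
        prob_space.indep_set M (sets (F s))
          {(\<lambda>\<omega>. W t \<omega> - W s \<omega>) -` B \<inter> space M | B. B \<in> sets borel})"

text \<open>
  A simple integrand over the interval from \<open>a\<close> to \<open>b\<close> is given by the number \<open>m\<close> of pieces, the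
  partition points \<open>p 0, \<dots>, p m\<close> and the bounded matrix coefficients \<open>\<xi> 0, \<dots>, \<xi> (m - 1)\<close>.
  The integral is the mean-square limit of the integrals of simple integrands, hence a relation:
  its value is determined up to a null event only.
\<close>

definition simple_integrand ::
  "'w measure \<Rightarrow> (real \<Rightarrow> 'w measure) \<Rightarrow> real \<Rightarrow> real \<Rightarrow>
   nat \<Rightarrow> (nat \<Rightarrow> real) \<Rightarrow> (nat \<Rightarrow> 'w \<Rightarrow> real ^ 'n ^ 'm) \<Rightarrow> bool" where
  "simple_integrand M F a b m p \<xi> \<longleftrightarrow>
     p 0 = a \<and> p m = b \<and>
     (\<forall>j<m. p j \<le> p (Suc j) \<and> \<xi> j \<in> borel_measurable (F (p j)) \<and> bounded (\<xi> j ` space M))"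

definition simple_process ::
  "nat \<Rightarrow> (nat \<Rightarrow> real) \<Rightarrow> (nat \<Rightarrow> 'w \<Rightarrow> real ^ 'n ^ 'm) \<Rightarrow> real \<Rightarrow> 'w \<Rightarrow> real ^ 'n ^ 'm" where
  "simple_process m p \<xi> s \<omega> = (\<Sum>j<m. indicator {p j<..p (Suc j)} s *\<^sub>R \<xi> j \<omega>)"

definition simple_ito_integral ::
  "(real \<Rightarrow> 'w \<Rightarrow> real ^ 'n) \<Rightarrow> nat \<Rightarrow> (nat \<Rightarrow> real) \<Rightarrow> (nat \<Rightarrow> 'w \<Rightarrow> real ^ 'n ^ 'm) \<Rightarrow>
   'w \<Rightarrow> real ^ 'm" where
  "simple_ito_integral W m p \<xi> \<omega> = (\<Sum>j<m. \<xi> j \<omega> *v (W (p (Suc j)) \<omega> - W (p j) \<omega>))"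

definition has_ito_integral ::
  "'w measure \<Rightarrow> (real \<Rightarrow> 'w measure) \<Rightarrow> (real \<Rightarrow> 'w \<Rightarrow> real ^ 'n) \<Rightarrow> real \<Rightarrow> real \<Rightarrow>
   (real \<Rightarrow> 'w \<Rightarrow> real ^ 'n ^ 'm) \<Rightarrow> ('w \<Rightarrow> real ^ 'm) \<Rightarrow> bool" where
  "has_ito_integral M F W a b H J \<longleftrightarrow>
     (\<lambda>(s, \<omega>). H s \<omega>) \<in> borel_measurable (restrict_space borel {a..b} \<Otimes>\<^sub>M M) \<and>
     J \<in> borel_measurable M \<and>
     (\<exists>m p \<xi>. (\<forall>k. simple_integrand M F a b (m k) (p k) (\<xi> k)) \<and>
        (\<lambda>k. mean_square_energy M a b (\<lambda>s \<omega>. simple_process (m k) (p k) (\<xi> k) s \<omega> - H s \<omega>))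
          \<longlonglongrightarrow> 0 \<and>
        (\<lambda>k. \<integral>\<^sup>+\<omega>. ennreal ((norm (simple_ito_integral W (m k) (p k) (\<xi> k) \<omega> - J \<omega>))\<^sup>2) \<partial>M)
          \<longlonglongrightarrow> 0)"

text \<open>
  Solutions are understood in the integral (Caratheodory) sense, since the coefficients are only
  assumed measurable in time; for continuous coefficients this is the classical notion.
\<close>

definition ode_solution ::
  "real \<Rightarrow> (real \<Rightarrow> 'b::euclidean_space \<Rightarrow> 'b) \<Rightarrow> (real \<Rightarrow> 'b) \<Rightarrow> bool" where
  "ode_solution T v y \<longleftrightarrow>
     set_integrable lborel {0..T} (\<lambda>s. v s (y s)) \<and>
     (\<forall>t\<in>{0..T}. y t = y 0 + (LINT s:{0..t}|lborel. v s (y s)))"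

definition vec_cond_exp ::
  "'w measure \<Rightarrow> 'w measure \<Rightarrow> ('w \<Rightarrow> real ^ 'n) \<Rightarrow> 'w \<Rightarrow> real ^ 'n" where
  "vec_cond_exp M G V \<omega> = (\<chi> i. real_cond_exp M G (\<lambda>\<omega>'. V \<omega>' $ i) \<omega>)"

end

(*
  With a = A^T, the matrices Phi and Psi are bounded, adapted and inverse to each other, and
  Psi_t Ya_t is constant in t, so Ya_t = Phi_t Psi_T grad l(X_T).  The drift of the backward equation
  cancels the derivative of Psi, hence d(Psi Y) = Psi Z dW.  Integrating from t to T and multiplying
  by the F_t-measurable Phi_t gives Ya_t - Y_t as the Ito integral of Phi_t Psi_s Z_s; this integral
  is centred given F_t, so Y_t is the conditional expectation of Ya_t.

  No Ito formula is needed for the product Psi Y: the integrand is approximated by Phi_t Psi_{r_i} Z_s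
  on the cells of a uniform partition (r_i) of mesh h.  These integrands have explicit integrals,
  sums of increments of the backward equation, and summation by parts leaves an error whose mean
  square is O(h).
*)

theory Submission
  imports Defs
begin

section \<open>Mean squares and energies\<close>

text \<open>The Ito integral is a relation built from simple integrands, so every integral needed
  must be assembled from those supplied by the backward equation, and these all run up to
  \<open>T\<close>. The integral over a cell is the difference of two of them; a bounded factor
  known at the left end of the cell may be multiplied in; sums and mean-square limits stay inside
  the relation. Besides these closure rules, only an isometry estimate and centring are asked of
  stochastic integration.

  The bound on \<open>A\<close> comes from the Lipschitz constant of \<open>f\<close>. It bounds
  \<open>\<Phi>\<close> and \<open>\<Psi>\<close> by one constant for all outcomes and makes
  \<open>\<Psi>\<close> Lipschitz in time, so frozen values of \<open>\<Psi>\<close> are admissible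
  coefficients.

  Why the error is O(h): the drift cancels to first order on a cell, so the cell error has mean
  square of order h^2 times (energy of \<open>Z\<close> on the cell plus a multiple of h). Adding
  the cells by the crude Cauchy-Schwarz inequality costs their number, (T - t) / h, while the
  energies of \<open>Z\<close> add up to a fixed total; one power of h survives.\<close>

lemma norm_matrix_vector_mult_le:
  fixes A :: "real ^ 'n ^ 'm"
  shows "norm (A *v x) \<le> norm A * norm x"
proof -
  have "norm (A *v x) = L2_set (\<lambda>i. \<bar>(A $ i) \<bullet> x\<bar>) UNIV"
    by (simp add: norm_vec_def matrix_vector_mult_def inner_vec_def)
  also have "\<dots> \<le> L2_set (\<lambda>i. norm (A $ i) * norm x) UNIV"
    by (intro L2_set_mono Cauchy_Schwarz_ineq2) auto
  also have "\<dots> = norm A * norm x"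
    by (simp add: norm_vec_def[of A] L2_set_left_distrib)
  finally show ?thesis .
qed

lemma norm_transpose:
  fixes A :: "real ^ 'n ^ 'm"
  shows "norm (transpose A) = norm A"
proof -
  have "(\<Sum>i\<in>UNIV. \<Sum>j\<in>UNIV. (A $ j $ i)\<^sup>2) = (\<Sum>j\<in>UNIV. \<Sum>i\<in>UNIV. (A $ j $ i)\<^sup>2)"
    by (rule sum.swap)
  then show ?thesis
    by (simp add: norm_vec_def L2_set_def transpose_def sum_nonneg)
qed

text \<open>Row \<open>i\<close> of \<open>A ** B\<close> is \<open>transpose B\<close> applied to
  row \<open>i\<close> of \<open>A\<close>. The norm of a matrix is the Euclidean norm of its
  entries (Frobenius), so the vector estimate on the rows gives submultiplicativity with constant
  1.\<close>

lemma norm_matrix_matrix_mult_le: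
  fixes A :: "real ^ 'n ^ 'm" and B :: "real ^ 'k ^ 'n"
  shows "norm (A ** B) \<le> norm A * norm B"
proof -
  have row: "(A ** B) $ i = transpose B *v (A $ i)" for i
    by (simp add: vec_eq_iff matrix_matrix_mult_def matrix_vector_mult_def transpose_def mult.commute)
  have "norm (A ** B) = L2_set (\<lambda>i. norm (transpose B *v (A $ i))) UNIV"
    by (simp add: norm_vec_def[of "A ** B"] row)
  also have "\<dots> \<le> L2_set (\<lambda>i. norm (A $ i) * norm B) UNIV"
    by (intro L2_set_mono order.trans[OF norm_matrix_vector_mult_le]) (auto simp: norm_transpose)
  also have "\<dots> = norm A * norm B"
    by (simp add: norm_vec_def[of A] L2_set_left_distrib)
  finally show ?thesis .
qed

section \<open>Matrix products as bounded bilinear maps, and their measurability\<close>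

lemma bounded_bilinear_matrix_vector_mult:
  "bounded_bilinear ((*v) :: real ^ 'n ^ 'm \<Rightarrow> _)"
  by standard
    (auto simp: matrix_vector_right_distrib matrix_vector_mult_add_rdistrib scaleR_matrix_vector_assoc
       matrix_vector_mult_scaleR intro!: exI[of _ 1] norm_matrix_vector_mult_le)

lemma bounded_bilinear_matrix_matrix_mult:
  "bounded_bilinear ((**) :: real ^ 'n ^ 'm \<Rightarrow> real ^ 'k ^ 'n \<Rightarrow> _)"
proof
  show "\<exists>K. \<forall>a b. norm ((a :: real ^ 'n ^ 'm) ** (b :: real ^ 'k ^ 'n)) \<le> norm a * norm b * K"
    by (intro exI[of _ 1]) (simp add: norm_matrix_matrix_mult_le)
qed (simp_all add: vec_eq_iff matrix_matrix_mult_def sum.distrib algebra_simps sum_distrib_left)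

lemma bounded_linear_transpose:
  "bounded_linear (transpose :: real ^ 'n ^ 'm \<Rightarrow> _)"
proof (rule bounded_linear_intro[of _ 1])
  show "norm (transpose A) \<le> norm A * 1" for A :: "real ^ 'n ^ 'm"
    by (simp add: norm_transpose)
qed (auto simp: vec_eq_iff transpose_def)

lemma borel_measurable_matrix_vector_mult [measurable (raw)]:
  fixes A :: "'a \<Rightarrow> real ^ 'n ^ 'm"
  assumes "A \<in> borel_measurable N" "x \<in> borel_measurable N"
  shows "(\<lambda>w. A w *v x w) \<in> borel_measurable N"
  by (rule borel_measurable_continuous_Pair[OF assms(1,2)])
    (intro bounded_bilinear.continuous_on[OF bounded_bilinear_matrix_vector_mult] continuous_intros)

lemma borel_measurable_matrix_matrix_mult [measurable (raw)]:
  fixes A :: "'a \<Rightarrow> real ^ 'n ^ 'm" and B :: "'a \<Rightarrow> real ^ 'k ^ 'n"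
  assumes "A \<in> borel_measurable N" "B \<in> borel_measurable N"
  shows "(\<lambda>w. A w ** B w) \<in> borel_measurable N"
  by (rule borel_measurable_continuous_Pair[OF assms(1,2)])
    (intro bounded_bilinear.continuous_on[OF bounded_bilinear_matrix_matrix_mult] continuous_intros)

lemma borel_measurable_transpose [measurable (raw)]:
  fixes A :: "'a \<Rightarrow> real ^ 'n ^ 'm"
  assumes "A \<in> borel_measurable N"
  shows "(\<lambda>w. transpose (A w)) \<in> borel_measurable N"
  using borel_measurable_continuous_onI[OF linear_continuous_on[OF bounded_linear_transpose]]
    measurable_compose[OF assms] by blast

lemma borel_measurable_vec_component [measurable (raw)]:
  fixes x :: "'a \<Rightarrow> 'b::real_normed_vector ^ 'n"
  assumes "x \<in> borel_measurable N"
  shows "(\<lambda>w. x w $ i) \<in> borel_measurable N"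
  using measurable_compose[OF assms borel_measurable_continuous_onI[of "\<lambda>y. y $ i"]]
  by (simp add: continuous_on_component)

lemma borel_measurable_vecI:
  fixes x :: "'a \<Rightarrow> 'b::euclidean_space ^ 'n"
  assumes [measurable]: "\<And>i. (\<lambda>w. x w $ i) \<in> borel_measurable N"
  shows "x \<in> borel_measurable N"
  unfolding borel_measurable_euclidean_space[of x]
  by (auto simp: Basis_vec_def inner_axis)

text \<open>An \<open>ennreal\<close> value lets estimates be chained before square integrability is
  known. Over a product with time the same functional is the energy, so each inequality for
  \<open>msq\<close> serves twice.\<close>

definition msq :: "'a measure \<Rightarrow> ('a \<Rightarrow> 'b::real_normed_vector) \<Rightarrow> ennreal" where
  "msq N V = (\<integral>\<^sup>+x. ennreal ((norm (V x))\<^sup>2) \<partial>N)"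

lemma norm_add_sq_le:
  fixes x y :: "'a::real_normed_vector"
  shows "(norm (x + y))\<^sup>2 \<le> 2 * (norm x)\<^sup>2 + 2 * (norm y)\<^sup>2"
proof -
  have "(norm (x + y))\<^sup>2 \<le> (norm x + norm y)\<^sup>2"
    by (intro power_mono norm_triangle_ineq) auto
  also have "\<dots> \<le> 2 * (norm x)\<^sup>2 + 2 * (norm y)\<^sup>2"
    using sum_squares_bound[of "norm x" "norm y"] by (simp add: power2_sum)
  finally show ?thesis .
qed

lemma msq_mono_AE:
  assumes "AE x in N. norm (V x) \<le> norm (V' x)"
  shows "msq N V \<le> msq N V'"
  unfolding msq_def using assms
  by (intro nn_integral_mono_AE) (auto elim!: eventually_mono intro!: ennreal_leI power_mono)

lemma msq_mono_scaled:
  assumes [measurable]: "V' \<in> borel_measurable N" and "0 \<le> C"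
    and "AE x in N. norm (V x) \<le> C * norm (V' x)"
  shows "msq N V \<le> ennreal (C\<^sup>2) * msq N V'"
proof -
  have "msq N V \<le> msq N (\<lambda>x. C *\<^sub>R V' x)"
    using assms by (intro msq_mono_AE) auto
  also have "\<dots> = ennreal (C\<^sup>2) * msq N V'"
    unfolding msq_def by (subst nn_integral_cmult[symmetric])
      (auto simp: power_mult_distrib ennreal_mult)
  finally show ?thesis .
qed

lemma msq_add_le:
  fixes V V' :: "'a \<Rightarrow> 'b::{second_countable_topology, real_normed_vector}"
  assumes [measurable]: "V \<in> borel_measurable N" "V' \<in> borel_measurable N"
  shows "msq N (\<lambda>x. V x + V' x) \<le> 2 * msq N V + 2 * msq N V'"
proof -
  have "msq N (\<lambda>x. V x + V' x) \<le>
      (\<integral>\<^sup>+x. 2 * ennreal ((norm (V x))\<^sup>2) + 2 * ennreal ((norm (V' x))\<^sup>2) \<partial>N)"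
    unfolding msq_def
  proof (rule nn_integral_mono)
    fix x
    have "ennreal ((norm (V x + V' x))\<^sup>2) \<le> ennreal (2 * (norm (V x))\<^sup>2 + 2 * (norm (V' x))\<^sup>2)"
      by (intro ennreal_leI norm_add_sq_le)
    then show "ennreal ((norm (V x + V' x))\<^sup>2) \<le> 2 * ennreal ((norm (V x))\<^sup>2) + 2 * ennreal ((norm (V' x))\<^sup>2)"
      by (simp add: ennreal_mult)
  qed
  also have "\<dots> = 2 * msq N V + 2 * msq N V'"
    unfolding msq_def by (subst nn_integral_add) (auto simp: nn_integral_cmult)
  finally show ?thesis .
qed

lemma msq_diff_le:
  fixes V V' :: "'a \<Rightarrow> 'b::{second_countable_topology, real_normed_vector}"
  assumes "V \<in> borel_measurable N" "V' \<in> borel_measurable N"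
  shows "msq N (\<lambda>x. V x - V' x) \<le> 2 * msq N V + 2 * msq N V'"
  using msq_add_le[of V N "\<lambda>x. - V' x"] assms by (simp add: msq_def)

lemma msq_cong_AE: "AE x in N. V x = V' x \<Longrightarrow> msq N V = msq N V'"
  by (intro antisym msq_mono_AE) (auto elim!: eventually_mono)

text \<open>Measurability of processes is stated with \<open>borel\<close> in the time variable,
  integration uses \<open>lborel\<close>; this equation moves facts between the two.\<close>

lemma sets_restrict_lborel_pair [measurable_cong]:
  "sets (restrict_space lborel S \<Otimes>\<^sub>M M) = sets (restrict_space borel S \<Otimes>\<^sub>M M)"
  by (intro sets_pair_measure_cong sets_restrict_space_cong) auto

lemma sigma_finite_restrict_lborel: "sigma_finite_measure (restrict_space lborel {a..b::real})"
  by (rule sigma_finite_measure_restrict_space) (auto simp: lborel.sigma_finite_measure_axioms)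

text \<open>By Tonelli. It turns inequalities for \<open>msq\<close> into inequalities for energies;
  time is restricted to the interval because joint measurability is assumed there only.\<close>

lemma mean_square_energy_eq_msq:
  assumes "sigma_finite_measure M"
    and "(\<lambda>(s, w). V s w) \<in> borel_measurable (restrict_space borel {a..b} \<Otimes>\<^sub>M M)"
  shows "mean_square_energy M a b V = msq (restrict_space lborel {a..b} \<Otimes>\<^sub>M M) (\<lambda>(s, w). V s w)"
proof -
  interpret L: sigma_finite_measure "restrict_space lborel {a..b}" by (rule sigma_finite_restrict_lborel)
  interpret M: sigma_finite_measure M by fact
  interpret pair_sigma_finite "restrict_space lborel {a..b}" M ..
  have [measurable]: "(\<lambda>(s, w). V s w) \<in> borel_measurable (restrict_space lborel {a..b} \<Otimes>\<^sub>M M)"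
    using assms(2) by (simp cong: measurable_cong_sets)
  have "msq (restrict_space lborel {a..b} \<Otimes>\<^sub>M M) (\<lambda>(s, w). V s w) =
      (\<integral>\<^sup>+w. \<integral>\<^sup>+s. ennreal ((norm (V s w))\<^sup>2) \<partial>restrict_space lborel {a..b} \<partial>M)"
    unfolding msq_def by (subst nn_integral_snd[symmetric]) auto
  then show ?thesis
    by (simp add: mean_square_energy_def nn_integral_restrict_space)
qed

lemma tendsto_ennreal_sandwich:
  fixes h :: "nat \<Rightarrow> ennreal"
  assumes "\<And>k. h k \<le> l k" "l \<longlonglongrightarrow> 0"
  shows "h \<longlonglongrightarrow> 0"
  by (rule tendsto_sandwich[OF _ _ tendsto_const assms(2)]) (auto simp: assms(1))

lemma tendsto_zero_sandwich_sum:
  fixes h :: "nat \<Rightarrow> ennreal"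
  assumes "\<And>k. h k \<le> 2 * l k + 2 * l' k" "l \<longlonglongrightarrow> 0" "l' \<longlonglongrightarrow> 0"
  shows "h \<longlonglongrightarrow> 0"
proof (rule tendsto_ennreal_sandwich[OF assms(1)])
  have "(\<lambda>k. 2 * l k + 2 * l' k) \<longlonglongrightarrow> 2 * 0 + 2 * 0"
    using assms(2,3) by (intro tendsto_add ennreal_tendsto_cmult) auto
  then show "(\<lambda>k. 2 * l k + 2 * l' k) \<longlonglongrightarrow> 0" by simp
qed


section \<open>Increments of the Wiener process\<close>

text \<open>Fubini in coordinates. \<open>lborel_eq\<close> presents \<open>lborel\<close> as the
  image of a product measure indexed by \<open>Basis\<close>, whereas the factors here are indexed
  by coordinates; the injection sending \<open>i\<close> to \<open>axis i 1\<close> translates the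
  index sets, and \<open>k\<close> is \<open>h\<close> re-indexed.\<close>

lemma
  fixes h :: "'n::finite \<Rightarrow> real \<Rightarrow> real"
  assumes h: "\<And>i. integrable lborel (h i)"
  shows integrable_lborel_vec_prod: "integrable lborel (\<lambda>x :: real ^ 'n. \<Prod>i\<in>UNIV. h i (x $ i))" (is ?int)
    and integral_lborel_vec_prod:
      "integral\<^sup>L lborel (\<lambda>x :: real ^ 'n. \<Prod>i\<in>UNIV. h i (x $ i)) = (\<Prod>i\<in>UNIV. integral\<^sup>L lborel (h i))" (is ?eq)
proof -
  interpret product_sigma_finite "\<lambda>b :: real ^ 'n. lborel :: real measure" ..
  have inj: "inj (\<lambda>i :: 'n. axis i (1 :: real))"
    by (auto simp: inj_on_def axis_eq_axis)
  have Basis: "(Basis :: (real ^ 'n) set) = range (\<lambda>i. axis i 1)"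
    by (auto simp: Basis_vec_def)
  define k where "k b = h (inv (\<lambda>i. axis i 1) b)" for b :: "real ^ 'n"
  have k [simp]: "k (axis i 1) = h i" for i
    by (simp add: k_def inv_f_f[OF inj])
  have [measurable]: "h i \<in> borel_measurable borel" for i
    using h[of i] by (auto dest: borel_measurable_integrable)
  have kint: "b \<in> Basis \<Longrightarrow> integrable lborel (k b)" for b
    unfolding Basis using h by auto
  have sum_eq: "(\<Prod>i\<in>UNIV. h i (\<Sum>b\<in>Basis. x b * b $ i)) = (\<Prod>b\<in>Basis. k b (x b))" for x :: "real ^ 'n \<Rightarrow> real"
  proof -
    have "(\<Sum>b\<in>Basis. x b * b $ i) = x (axis i 1)" for i
      unfolding Basis by (subst sum.reindex[OF inj]) (simp add: axis_def if_distrib cong: if_cong)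
    then show ?thesis
      unfolding Basis by (subst prod.reindex[OF inj]) simp
  qed
  have meas: "(\<lambda>x :: real ^ 'n. \<Prod>i\<in>UNIV. h i (x $ i)) \<in> borel_measurable borel"
    by measurable
  show ?int
    by (subst lborel_eq, subst integrable_distr_eq)
      (auto simp: sum_eq meas intro!: product_integrable_prod kint)
  show ?eq
    by (subst lborel_eq, subst integral_distr)
      (simp_all add: sum_eq meas product_integral_prod kint prod.reindex[OF inj]
         prod.reindex[OF inj, of "\<lambda>b. integral\<^sup>L lborel (k b)", folded Basis])
qed

text \<open>Coordinates separate the random increment \<open>v\<close> from the coefficients, so
  that expectations can be taken term by term: the linear terms will be centred, and the quadratic
  ones see only the covariance of \<open>v\<close>.\<close>

lemma norm_add_matrix_vector_sq:
  fixes A :: "real ^ 'n ^ 'm"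
  shows "(norm (x + A *v v))\<^sup>2 = (norm x)\<^sup>2 + 2 * (\<Sum>c\<in>UNIV. (transpose A *v x) $ c * v $ c) +
    (\<Sum>c\<in>UNIV. \<Sum>d\<in>UNIV. (transpose A ** A) $ c $ d * (v $ c * v $ d))"
proof -
  have adj: "y \<bullet> (A *v v) = (transpose A *v y) \<bullet> v" for y
    by (simp add: dot_lmul_matrix)
  have "(A *v v) \<bullet> (A *v v) = ((transpose A ** A) *v v) \<bullet> v"
    by (simp add: adj matrix_vector_mul_assoc)
  also have "\<dots> = (\<Sum>c\<in>UNIV. \<Sum>d\<in>UNIV. (transpose A ** A) $ c $ d * (v $ c * v $ d))"
    by (simp add: inner_vec_def matrix_vector_mult_def sum_distrib_right sum_distrib_left mult_ac)
  moreover have "x \<bullet> (A *v v) = (\<Sum>c\<in>UNIV. (transpose A *v x) $ c * v $ c)"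
    by (subst adj) (simp add: inner_vec_def)
  ultimately show ?thesis
    by (simp add: power2_norm_eq_inner inner_add_left inner_add_right inner_commute)
qed

text \<open>The trace of \<open>transpose A ** A\<close> is what survives of the quadratic form
  above once the covariance of the increment is a multiple of the identity.\<close>

lemma norm_matrix_sq_eq_trace:
  fixes A :: "real ^ 'n ^ 'm"
  shows "(norm A)\<^sup>2 = (\<Sum>c\<in>UNIV. (transpose A ** A) $ c $ c)"
proof -
  have "(norm A)\<^sup>2 = (\<Sum>i\<in>UNIV. \<Sum>c\<in>UNIV. (A $ i $ c)\<^sup>2)"
    by (simp add: norm_vec_def L2_set_def sum_nonneg)
  also have "\<dots> = (\<Sum>c\<in>UNIV. \<Sum>i\<in>UNIV. (A $ i $ c)\<^sup>2)"
    by (rule sum.swap)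
  finally show ?thesis
    by (simp add: matrix_matrix_mult_def transpose_def power2_eq_square)
qed

locale wiener_filtration = prob_space M for M :: "'w measure" +
  fixes F :: "real \<Rightarrow> 'w measure" and T :: real and W :: "real \<Rightarrow> 'w \<Rightarrow> real ^ 'n"
  assumes filtered: "filtered_prob_space M F T"
    and wiener: "wiener_process M F T W"
begin

abbreviation energy :: "real \<Rightarrow> real \<Rightarrow> (real \<Rightarrow> 'w \<Rightarrow> 'b::real_normed_vector) \<Rightarrow> ennreal" where
  "energy \<equiv> mean_square_energy M"

abbreviation jointly_measurable :: "real \<Rightarrow> real \<Rightarrow> (real \<Rightarrow> 'w \<Rightarrow> 'b::topological_space) \<Rightarrow> bool" where
  "jointly_measurable a b V \<equiv> case_prod V \<in> borel_measurable (restrict_space borel {a..b} \<Otimes>\<^sub>M M)"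

abbreviation progressive :: "real \<Rightarrow> (real \<Rightarrow> 'w \<Rightarrow> 'b::topological_space) \<Rightarrow> bool" where
  "progressive t V \<equiv> case_prod V \<in> borel_measurable (restrict_space borel {0..t} \<Otimes>\<^sub>M F t)"

lemma subalgebra_F: "t \<in> {0..T} \<Longrightarrow> subalgebra M (F t)"
  using filtered by (auto simp: filtered_prob_space_def)

lemma space_F: "t \<in> {0..T} \<Longrightarrow> space (F t) = space M"
  using subalgebra_F by (auto simp: subalgebra_def)

lemma measurable_F_M: "t \<in> {0..T} \<Longrightarrow> V \<in> measurable (F t) N \<Longrightarrow> V \<in> measurable M N"
  by (rule measurable_from_subalg[OF subalgebra_F])

lemma sets_F_mono: "0 \<le> s \<Longrightarrow> s \<le> t \<Longrightarrow> t \<le> T \<Longrightarrow> sets (F s) \<subseteq> sets (F t)"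
  using filtered by (auto simp: filtered_prob_space_def)

lemma measurable_F_mono:
  "0 \<le> s \<Longrightarrow> s \<le> t \<Longrightarrow> t \<le> T \<Longrightarrow> V \<in> measurable (F s) N \<Longrightarrow> V \<in> measurable (F t) N"
  by (rule measurable_from_subalg) (auto simp: subalgebra_def space_F sets_F_mono[THEN subsetD])

lemma W_measurable_F: "t \<in> {0..T} \<Longrightarrow> W t \<in> borel_measurable (F t)"
  by (rule bspec[OF conjunct1[OF wiener[unfolded wiener_process_def]]])

lemma W_measurable_M: "t \<in> {0..T} \<Longrightarrow> W t \<in> borel_measurable M"
  by (rule measurable_F_M[OF _ W_measurable_F])

text \<open>The law of the increment is a product of one-dimensional normal densities, so its
  moments factor. The Gaussian law is given for \<open>s < t\<close>; at \<open>s = t\<close> the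
  increment is zero and the claims are trivial.\<close>

lemma increment_moments:
  assumes st: "0 \<le> s" "s \<le> t" "t \<le> T"
  shows "integrable M (\<lambda>w. (W t w - W s w) $ c)"
    and "expectation (\<lambda>w. (W t w - W s w) $ c) = 0"
    and "integrable M (\<lambda>w. (W t w - W s w) $ c * (W t w - W s w) $ d)"
    and "expectation (\<lambda>w. (W t w - W s w) $ c * (W t w - W s w) $ d) = (if c = d then t - s else 0)"
proof -
  have *: "integrable M (\<lambda>w. (W t w - W s w) $ c) \<and> expectation (\<lambda>w. (W t w - W s w) $ c) = 0 \<and>
    integrable M (\<lambda>w. (W t w - W s w) $ c * (W t w - W s w) $ d) \<and>
    expectation (\<lambda>w. (W t w - W s w) $ c * (W t w - W s w) $ d) = (if c = d then t - s else 0)"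
  proof (cases "s = t")
    case False
    define \<sigma> where "\<sigma> = sqrt (t - s)"
    have \<sigma>: "0 < \<sigma>" "\<sigma>\<^sup>2 = t - s"
      using st False by (auto simp: \<sigma>_def)
    define D where "D x = (\<Prod>i\<in>UNIV. normal_density 0 \<sigma> (x $ i))" for x :: "real ^ 'n"
    have D0: "0 \<le> D x" for x
      by (simp add: D_def prod_nonneg)
    have dist: "distributed M lborel (\<lambda>w. W t w - W s w) (\<lambda>x. ennreal (D x))"
      using wiener st False by (simp add: wiener_process_def \<sigma>_def D_def prod_ennreal)
    have int0: "integrable lborel (\<lambda>x. normal_density 0 \<sigma> x)" "(\<integral>x. normal_density 0 \<sigma> x \<partial>lborel) = 1"
      using \<sigma> by auto
    have int1: "integrable lborel (\<lambda>x. normal_density 0 \<sigma> x * x)" "(\<integral>x. normal_density 0 \<sigma> x * x \<partial>lborel) = 0"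
      using \<sigma> integrable_normal_moment_nz_1 integral_normal_moment_nz_1 by auto
    have int2: "integrable lborel (\<lambda>x. normal_density 0 \<sigma> x * x\<^sup>2)" "(\<integral>x. normal_density 0 \<sigma> x * x\<^sup>2 \<partial>lborel) = \<sigma>\<^sup>2"
      using normal_moment_even[OF \<sigma>(1), of 0 1]
      by (auto simp: has_bochner_integral_iff)
    \<comment> \<open>The monomials are distributed over the coordinate factors: \<open>h2\<close>
      carries a square in one factor if \<open>c = d\<close>, and otherwise two first moments in
      different factors, which are zero.\<close>
    define h1 where "h1 i x = normal_density 0 \<sigma> x * (if i = c then x else 1)" for i x
    define h2 where "h2 i x = normal_density 0 \<sigma> x * ((if i = c then x else 1) * (if i = d then x else 1))" for i x
    have h1: "integrable lborel (h1 i)" for i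
      using int0 int1 by (cases "i = c") (auto simp: h1_def[abs_def] cong: if_cong)
    have h2: "integrable lborel (h2 i)" for i
      using int0 int1 int2 by (cases "i = c"; cases "i = d") (auto simp: h2_def[abs_def] power2_eq_square cong: if_cong)
    have delta: "(\<Prod>i\<in>UNIV. if i = c then y i else 1) = y c" for y :: "'n \<Rightarrow> real" and c
      by (simp add: prod.delta)
    have p1: "(\<Prod>i\<in>UNIV. h1 i (x $ i)) = D x * x $ c" for x
      by (simp add: h1_def D_def prod.distrib delta)
    have p2: "(\<Prod>i\<in>UNIV. h2 i (x $ i)) = D x * (x $ c * x $ d)" for x
      by (simp add: h2_def D_def prod.distrib delta)
    have "(\<integral>y. h1 c y \<partial>lborel) = 0"
      using int1 by (simp add: h1_def)
    then have i1: "(\<Prod>i\<in>UNIV. \<integral>y. h1 i y \<partial>lborel) = 0"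
      by (intro prod_zero) auto
    have i2: "(\<Prod>i\<in>UNIV. \<integral>y. h2 i y \<partial>lborel) = (if c = d then t - s else 0)"
    proof (cases "c = d")
      case True
      have "(\<integral>y. h2 i y \<partial>lborel) = (if i = c then t - s else 1)" for i
        using int0 int2 \<sigma> True by (simp add: h2_def power2_eq_square cong: if_cong)
      then show ?thesis
        using True delta[of c "\<lambda>_. t - s"] by simp
    next
      case False
      have "(\<integral>y. h2 c y \<partial>lborel) = 0"
        using int1 False by (simp add: h2_def)
      then show ?thesis
        using False by (auto intro!: prod_zero)
    qed
    show ?thesis
      using integrable_lborel_vec_prod[of h1, OF h1] integral_lborel_vec_prod[of h1, OF h1]
        integrable_lborel_vec_prod[of h2, OF h2] integral_lborel_vec_prod[of h2, OF h2]
        distributed_integrable[OF dist, of "\<lambda>x. x $ c"] distributed_integral[OF dist, of "\<lambda>x. x $ c"]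
        distributed_integrable[OF dist, of "\<lambda>x. x $ c * x $ d"] distributed_integral[OF dist, of "\<lambda>x. x $ c * x $ d"]
      by (simp add: D0 p1 p2 i1 i2)
  qed simp
  show "integrable M (\<lambda>w. (W t w - W s w) $ c)"
    and "expectation (\<lambda>w. (W t w - W s w) $ c) = 0"
    and "integrable M (\<lambda>w. (W t w - W s w) $ c * (W t w - W s w) $ d)"
    and "expectation (\<lambda>w. (W t w - W s w) $ c * (W t w - W s w) $ d) = (if c = d then t - s else 0)"
    using * by blast+
qed

text \<open>Independence of the increment from \<open>F s\<close> passes to the smaller
  sigma-algebras generated by \<open>G\<close> and by \<open>h\<close> of the increment, and
  independent integrable variables have product expectation. For \<open>s = t\<close> the second
  factor is the constant \<open>h 0\<close>.\<close>

lemma increment_indep: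
  fixes h :: "real ^ 'n \<Rightarrow> real"
  assumes st: "0 \<le> s" "s \<le> t" "t \<le> T"
    and G: "G \<in> borel_measurable (F s)" "integrable M G"
    and h [measurable]: "h \<in> borel_measurable borel" and hint: "integrable M (\<lambda>w. h (W t w - W s w))"
  shows "integrable M (\<lambda>w. G w * h (W t w - W s w))"
    and "expectation (\<lambda>w. G w * h (W t w - W s w)) = expectation G * expectation (\<lambda>w. h (W t w - W s w))"
proof -
  have [measurable]: "W s \<in> borel_measurable M" "W t \<in> borel_measurable M"
    using st by (auto intro: W_measurable_M)
  have *: "indep_var borel G borel (\<lambda>w. h (W t w - W s w))" if "s \<noteq> t"
  proof -
    let ?I = "{(\<lambda>w. W t w - W s w) -` B \<inter> space M | B. B \<in> sets borel}"
    have ind: "indep_set (sets (F s)) ?I"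
      using wiener st that by (simp add: wiener_process_def)
    have I: "?I = sets (vimage_algebra (space M) (\<lambda>w. W t w - W s w) borel)"
      by (subst sets_vimage_algebra2) auto
    have 1: "sigma_sets (space M) {G -` A \<inter> space M | A. A \<in> sets borel} \<subseteq> sets (F s)"
    proof -
      have "{G -` A \<inter> space M | A. A \<in> sets borel} \<subseteq> sets (F s)"
        using measurable_sets[OF G(1)] space_F[of s] st by auto
      then show ?thesis
        using sets.sigma_sets_subset[of _ "F s"] space_F[of s] st by simp
    qed
    have 2: "sigma_sets (space M) {(\<lambda>w. h (W t w - W s w)) -` A \<inter> space M | A. A \<in> sets borel} \<subseteq> ?I"
    proof -
      have "{(\<lambda>w. h (W t w - W s w)) -` A \<inter> space M | A. A \<in> sets borel} \<subseteq> ?I"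
      proof clarify
        fix A :: "real set" assume "A \<in> sets borel"
        then have "h -` A \<in> sets borel"
          using measurable_sets[OF h, of A] by simp
        then show "\<exists>B. (\<lambda>w. h (W t w - W s w)) -` A \<inter> space M = (\<lambda>w. W t w - W s w) -` B \<inter> space M \<and> B \<in> sets borel"
          by (intro exI[of _ "h -` A"]) auto
      qed
      then show ?thesis
        unfolding I using sets.sigma_sets_subset[of _ "vimage_algebra (space M) (\<lambda>w. W t w - W s w) borel"] by simp
    qed
    have "indep_set (sigma_sets (space M) {G -` A \<inter> space M | A. A \<in> sets borel})
       (sigma_sets (space M) {(\<lambda>w. h (W t w - W s w)) -` A \<inter> space M | A. A \<in> sets borel})"
      unfolding indep_set_def
      by (rule indep_sets_mono_sets[OF ind[unfolded indep_set_def]]) (use 1 2 in \<open>auto split: bool.split\<close>)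
    then show ?thesis
      unfolding indep_var_eq using borel_measurable_integrable[OF G(2)] by simp
  qed
  show "integrable M (\<lambda>w. G w * h (W t w - W s w))"
    using * indep_var_integrable[OF _ G(2) hint] G(2) by (cases "s = t") auto
  show "expectation (\<lambda>w. G w * h (W t w - W s w)) = expectation G * expectation (\<lambda>w. h (W t w - W s w))"
    using * indep_var_lebesgue_integral[OF _ G(2) hint] G(2) by (cases "s = t") (auto simp: prob_space)
qed

lemma increment_centered:
  assumes st: "0 \<le> s" "s \<le> t" "t \<le> T"
    and G: "G \<in> borel_measurable (F s)" "integrable M G"
  shows "integrable M (\<lambda>w. G w * (W t w - W s w) $ c)"
    and "expectation (\<lambda>w. G w * (W t w - W s w) $ c) = 0"
proof -
  note mom = increment_moments[OF st]
  have m: "(\<lambda>x :: real ^ 'n. x $ c) \<in> borel_measurable borel" by simp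
  show "integrable M (\<lambda>w. G w * (W t w - W s w) $ c)"
    by (rule increment_indep(1)[OF st G m mom(1)])
  show "expectation (\<lambda>w. G w * (W t w - W s w) $ c) = 0"
    using increment_indep(2)[OF st G m mom(1)] mom(2) by simp
qed

lemma increment_covariance:
  assumes st: "0 \<le> s" "s \<le> t" "t \<le> T"
    and G: "G \<in> borel_measurable (F s)" "integrable M G"
  shows "integrable M (\<lambda>w. G w * ((W t w - W s w) $ c * (W t w - W s w) $ d))"
    and "expectation (\<lambda>w. G w * ((W t w - W s w) $ c * (W t w - W s w) $ d)) =
      (if c = d then (t - s) * expectation G else 0)"
proof -
  note mom = increment_moments[OF st]
  have m: "(\<lambda>x :: real ^ 'n. x $ c * x $ d) \<in> borel_measurable borel" by simp
  show "integrable M (\<lambda>w. G w * ((W t w - W s w) $ c * (W t w - W s w) $ d))"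
    by (rule increment_indep(1)[OF st G m mom(3)])
  show "expectation (\<lambda>w. G w * ((W t w - W s w) $ c * (W t w - W s w) $ d)) =
      (if c = d then (t - s) * expectation G else 0)"
    using increment_indep(2)[OF st G m mom(3)[of c d]] mom(4)[of c d] by simp
qed

lemma bounded_integrable:
  fixes V :: "'w \<Rightarrow> 'b::{banach, second_countable_topology}"
  assumes "V \<in> borel_measurable M" "bounded (V ` space M)"
  shows "integrable M V"
proof -
  obtain B where "\<And>w. w \<in> space M \<Longrightarrow> norm (V w) \<le> B"
    using assms(2) by (auto simp: bounded_iff)
  then show ?thesis
    using assms(1) by (intro integrable_const_bound[of _ B]) auto
qed

text \<open>Pythagoras for one cell. The increment is independent of \<open>F s\<close>, centred,
  with covariance \<open>t - s\<close> times the identity: the mixed term drops out and the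
  quadratic term leaves a trace, i.e. the Frobenius norm. This is the induction step of the
  isometry.\<close>

lemma increment_step:
  fixes G :: "'w \<Rightarrow> real ^ 'm" and \<xi> :: "'w \<Rightarrow> real ^ 'n ^ 'm"
  assumes st: "0 \<le> s" "s \<le> t" "t \<le> T"
    and G: "G \<in> borel_measurable (F s)" "integrable M (\<lambda>w. (norm (G w))\<^sup>2)"
    and \<xi>: "\<xi> \<in> borel_measurable (F s)" "bounded (\<xi> ` space M)"
  shows "integrable M (\<lambda>w. (norm (G w + \<xi> w *v (W t w - W s w)))\<^sup>2)"
    and "expectation (\<lambda>w. (norm (G w + \<xi> w *v (W t w - W s w)))\<^sup>2) =
      expectation (\<lambda>w. (norm (G w))\<^sup>2) + (t - s) * expectation (\<lambda>w. (norm (\<xi> w))\<^sup>2)"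
proof -
  have s: "s \<in> {0..T}" using st by auto
  have [measurable]: "G \<in> borel_measurable M" "\<xi> \<in> borel_measurable M"
    using measurable_F_M[OF s G(1)] measurable_F_M[OF s \<xi>(1)] by auto
  obtain B where B: "\<And>w. w \<in> space M \<Longrightarrow> norm (\<xi> w) \<le> B"
    using \<xi>(2) by (auto simp: bounded_iff)
  have B0: "0 \<le> B"
    using B not_empty norm_ge_zero order.trans by (metis ex_in_conv)
  let ?g = "\<lambda>c w. (transpose (\<xi> w) *v G w) $ c"
  let ?q = "\<lambda>c d w. (transpose (\<xi> w) ** \<xi> w) $ c $ d"
  have gF: "?g c \<in> borel_measurable (F s)" and qF: "?q c d \<in> borel_measurable (F s)" for c d
    using G(1) \<xi>(1) by measurable
  \<comment> \<open>The elementary bound x \<le> 1 + x^2 turns square integrability of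
    \<open>G\<close> into integrability of this linear coefficient.\<close>
  have gint: "integrable M (?g c)" for c
  proof (rule Bochner_Integration.integrable_bound)
    show "integrable M (\<lambda>w. B * (1 + (norm (G w))\<^sup>2))"
      using G(2) by auto
    have "\<bar>?g c w\<bar> \<le> B * (1 + (norm (G w))\<^sup>2)" if "w \<in> space M" for w
    proof -
      have "\<bar>?g c w\<bar> \<le> norm (\<xi> w) * norm (G w)"
        using component_le_norm_cart[of "transpose (\<xi> w) *v G w" c]
          norm_matrix_vector_mult_le[of "transpose (\<xi> w)" "G w"] by (simp add: norm_transpose)
      also have "norm (G w) \<le> 1 + (norm (G w))\<^sup>2"
        using sum_squares_bound[of 1 "norm (G w)"] norm_ge_zero[of "G w"]
        by (simp del: norm_ge_zero)
      then have "norm (\<xi> w) * norm (G w) \<le> B * (1 + (norm (G w))\<^sup>2)"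
        using B[OF that] B0 by (intro mult_mono) auto
      finally show ?thesis .
    qed
    then show "AE w in M. norm (?g c w) \<le> norm (B * (1 + (norm (G w))\<^sup>2))"
      using B0 by (intro AE_I2) (auto simp: abs_of_nonneg intro!: order.trans[OF _ abs_ge_self])
  qed measurable
  have qbd: "\<bar>?q c d w\<bar> \<le> B * B" if "w \<in> space M" for c d w
  proof -
    have "\<bar>?q c d w\<bar> \<le> norm (transpose (\<xi> w) ** \<xi> w)"
      using component_le_norm_cart[of "(transpose (\<xi> w) ** \<xi> w) $ c" d]
        Finite_Cartesian_Product.norm_nth_le[of "transpose (\<xi> w) ** \<xi> w" c] by simp
    also have "\<dots> \<le> norm (\<xi> w) * norm (\<xi> w)"
      using norm_matrix_matrix_mult_le[of "transpose (\<xi> w)" "\<xi> w"] by (simp add: norm_transpose)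
    also have "\<dots> \<le> B * B"
      using B[OF that] B0 by (intro mult_mono) auto
    finally show ?thesis .
  qed
  have qint: "integrable M (?q c d)" for c d
    by (rule bounded_integrable) (auto simp: bounded_iff intro!: exI[of _ "B * B"] qbd)
  have eq: "(\<lambda>w. (norm (G w + \<xi> w *v (W t w - W s w)))\<^sup>2) =
     (\<lambda>w. (norm (G w))\<^sup>2 + 2 * (\<Sum>c\<in>UNIV. ?g c w * (W t w - W s w) $ c) +
      (\<Sum>c\<in>UNIV. \<Sum>d\<in>UNIV. ?q c d w * ((W t w - W s w) $ c * (W t w - W s w) $ d)))"
    by (rule ext) (rule norm_add_matrix_vector_sq)
  note g = increment_centered[OF st gF gint]
  note q = increment_covariance[OF st qF qint]
  show "integrable M (\<lambda>w. (norm (G w + \<xi> w *v (W t w - W s w)))\<^sup>2)"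
    unfolding eq using G(2) g(1) q(1)
    by (intro Bochner_Integration.integrable_add Bochner_Integration.integrable_sum integrable_mult_right) auto
  have "expectation (\<lambda>w. (norm (G w + \<xi> w *v (W t w - W s w)))\<^sup>2) =
     expectation (\<lambda>w. (norm (G w))\<^sup>2) + (\<Sum>c\<in>UNIV. (t - s) * expectation (?q c c))"
    unfolding eq using G(2) g q
    by (simp add: Bochner_Integration.integral_add Bochner_Integration.integral_sum)
  also have "(\<Sum>c\<in>UNIV. (t - s) * expectation (?q c c)) = (t - s) * expectation (\<lambda>w. (norm (\<xi> w))\<^sup>2)"
    by (simp add: norm_matrix_sq_eq_trace sum_distrib_left qint)
  finally show "expectation (\<lambda>w. (norm (G w + \<xi> w *v (W t w - W s w)))\<^sup>2) =
      expectation (\<lambda>w. (norm (G w))\<^sup>2) + (t - s) * expectation (\<lambda>w. (norm (\<xi> w))\<^sup>2)" .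
qed

end


section \<open>Simple integrands\<close>

lemma partition_mono:
  fixes p :: "nat \<Rightarrow> real"
  assumes "\<And>j. j < m \<Longrightarrow> p j \<le> p (Suc j)" "i \<le> j" "j \<le> m"
  shows "p i \<le> p j"
  using assms(2,3)
proof (induction j)
  case (Suc j)
  then show ?case
    using assms(1)[of j] by (cases "i = Suc j") auto
qed simp

lemma partition_indicator_sum:
  fixes p :: "nat \<Rightarrow> real"
  assumes "\<And>j. j < m \<Longrightarrow> p j \<le> p (Suc j)"
  shows "(\<Sum>j<m. indicator {p j<..p (Suc j)} s) = (indicator {p 0<..p m} s :: real)"
  using assms
proof (induction m)
  case (Suc m)
  have "p 0 \<le> p m" "p m \<le> p (Suc m)"
    using partition_mono[of m p 0 m] Suc.prems by auto
  moreover have "(\<Sum>j<Suc m. indicator {p j<..p (Suc j)} s) =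
      (indicator {p 0<..p m} s + indicator {p m<..p (Suc m)} s :: real)"
    using Suc by simp
  ultimately show ?case
    by (simp only:) (auto simp: indicator_def)
qed simp

text \<open>The half-open cells are disjoint, so at any time at most one summand is nonzero and no
  mixed products appear.\<close>

lemma norm_simple_process_sq:
  assumes "\<And>j. j < m \<Longrightarrow> p j \<le> p (Suc j)"
  shows "(norm (simple_process m p \<xi> s w))\<^sup>2 =
    (\<Sum>j<m. indicator {p j<..p (Suc j)} s * (norm (\<xi> j w))\<^sup>2)"
  using assms
proof (induction m)
  case (Suc m)
  show ?case
  proof (cases "s \<in> {p m<..p (Suc m)}")
    case True
    have "indicator {p j<..p (Suc j)} s = (0 :: real)" if "j < m" for j
      using partition_mono[of m p "Suc j" m] Suc.prems that True by (auto simp: indicator_def)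
    then show ?thesis
      using True by (simp add: simple_process_def)
  next
    case False
    then show ?thesis
      using Suc by (simp add: simple_process_def)
  qed
qed (simp add: simple_process_def)

lemma bounded_imageD:
  assumes "bounded (V ` S)"
  obtains B where "0 \<le> B" "\<And>x. x \<in> S \<Longrightarrow> norm (V x) \<le> B"
proof -
  obtain B where "\<And>x. x \<in> S \<Longrightarrow> norm (V x) \<le> B"
    using assms by (auto simp: bounded_iff)
  then show ?thesis
    using that[of "max 0 B"] by fastforce
qed

lemma bounded_image_sum:
  fixes V :: "'i \<Rightarrow> 'a \<Rightarrow> 'b::real_normed_vector"
  assumes "\<And>i. i \<in> I \<Longrightarrow> bounded (V i ` S)"
  shows "bounded ((\<lambda>x. \<Sum>i\<in>I. V i x) ` S)"
proof -
  have "\<forall>i\<in>I. \<exists>B. \<forall>x\<in>S. norm (V i x) \<le> B"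
    using assms by (auto simp: bounded_iff)
  then obtain B where B: "\<And>i x. i \<in> I \<Longrightarrow> x \<in> S \<Longrightarrow> norm (V i x) \<le> B i"
    by metis
  show ?thesis
    unfolding bounded_iff
    by (rule exI[of _ "\<Sum>i\<in>I. B i"]) (auto intro!: order.trans[OF norm_sum] sum_mono B)
qed

context wiener_filtration
begin

lemma simple_integrandD:
  assumes S: "simple_integrand M F a b m p \<xi>" and ab: "0 \<le> a" "b \<le> T"
  shows "p 0 = a" "p m = b" "\<And>j. j < m \<Longrightarrow> p j \<le> p (Suc j)" "\<And>j. j \<le> m \<Longrightarrow> p j \<in> {0..T}"
    "\<And>j. j < m \<Longrightarrow> \<xi> j \<in> borel_measurable (F (p j))" "\<And>j. j < m \<Longrightarrow> bounded (\<xi> j ` space M)"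
    "\<And>j. j < m \<Longrightarrow> \<xi> j \<in> borel_measurable M"
proof -
  show *: "p 0 = a" "p m = b" "\<And>j. j < m \<Longrightarrow> p j \<le> p (Suc j)"
    "\<And>j. j < m \<Longrightarrow> \<xi> j \<in> borel_measurable (F (p j))" "\<And>j. j < m \<Longrightarrow> bounded (\<xi> j ` space M)"
    using S by (auto simp: simple_integrand_def)
  show **: "p j \<in> {0..T}" if "j \<le> m" for j
    using partition_mono[of m p 0 j] partition_mono[of m p j m] * that ab by auto
  show "\<xi> j \<in> borel_measurable M" if "j < m" for j
    using measurable_F_M[OF ** *(4)] that by auto
qed

text \<open>Induction over the number \<open>k\<close> of cells for a fixed integrand: the sum over
  the first \<open>k\<close> cells is measurable at time \<open>p k\<close>, which is what
  \<open>increment_step\<close> requires of \<open>G\<close>.\<close>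

lemma simple_ito_integral_sq:
  assumes S: "simple_integrand M F a b m p \<xi>" and ab: "0 \<le> a" "b \<le> T" and "k \<le> m"
  shows "simple_ito_integral W k p \<xi> \<in> borel_measurable (F (p k)) \<and>
    integrable M (\<lambda>w. (norm (simple_ito_integral W k p \<xi> w))\<^sup>2) \<and>
    expectation (\<lambda>w. (norm (simple_ito_integral W k p \<xi> w))\<^sup>2) =
      (\<Sum>j<k. (p (Suc j) - p j) * expectation (\<lambda>w. (norm (\<xi> j w))\<^sup>2))"
  using \<open>k \<le> m\<close>
proof (induction k)
  case 0
  then show ?case by (simp add: simple_ito_integral_def)
next
  case (Suc k)
  note D = simple_integrandD[OF S ab]
  have k: "k < m" using Suc by simp
  have pk: "0 \<le> p k" "p k \<le> p (Suc k)" "p (Suc k) \<le> T" "p k \<in> {0..T}" "p (Suc k) \<in> {0..T}"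
    using D(3)[OF k] D(4)[of k] D(4)[of "Suc k"] k by auto
  have IH: "simple_ito_integral W k p \<xi> \<in> borel_measurable (F (p k))"
    "integrable M (\<lambda>w. (norm (simple_ito_integral W k p \<xi> w))\<^sup>2)"
    "expectation (\<lambda>w. (norm (simple_ito_integral W k p \<xi> w))\<^sup>2) =
      (\<Sum>j<k. (p (Suc j) - p j) * expectation (\<lambda>w. (norm (\<xi> j w))\<^sup>2))"
    using Suc by auto
  have eq: "simple_ito_integral W (Suc k) p \<xi> =
      (\<lambda>w. simple_ito_integral W k p \<xi> w + \<xi> k w *v (W (p (Suc k)) w - W (p k) w))"
    by (simp add: simple_ito_integral_def fun_eq_iff)
  have [measurable]: "W (p (Suc k)) \<in> borel_measurable (F (p (Suc k)))"
    "W (p k) \<in> borel_measurable (F (p (Suc k)))" "\<xi> k \<in> borel_measurable (F (p (Suc k)))"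
    "simple_ito_integral W k p \<xi> \<in> borel_measurable (F (p (Suc k)))"
    using measurable_F_mono[OF pk(1-3)] W_measurable_F[OF pk(4)] W_measurable_F[OF pk(5)] D(5)[OF k] IH(1)
    by auto
  show ?case
    using increment_step[OF pk(1-3) IH(1,2) D(5,6)[OF k]] IH(3) unfolding eq by simp
qed

lemma simple_process_measurable:
  assumes "\<And>j. j < m \<Longrightarrow> \<xi> j \<in> borel_measurable M"
  shows "(\<lambda>(s, w). simple_process m p \<xi> s w) \<in> borel_measurable (restrict_space borel {a..b} \<Otimes>\<^sub>M M)"
proof -
  have id: "(\<lambda>x. x) \<in> borel_measurable (restrict_space borel {a..b::real})"
    by (rule measurable_restrict_space1) simp
  have "(\<lambda>x. indicator {p j<..p (Suc j)} (fst x) *\<^sub>R \<xi> j (snd x)) \<in> borel_measurable (restrict_space borel {a..b} \<Otimes>\<^sub>M M)"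
    if "j < m" for j
  proof -
    have [measurable]: "\<xi> j \<in> borel_measurable M" by (rule assms) fact
    have [measurable]: "fst \<in> borel_measurable (restrict_space borel {a..b} \<Otimes>\<^sub>M M)"
      using measurable_compose[OF measurable_fst[of "restrict_space borel {a..b}" M] id] by simp
    show ?thesis by measurable
  qed
  then show ?thesis
    unfolding simple_process_def case_prod_beta by (intro borel_measurable_sum) auto
qed

text \<open>Ito isometry for simple integrands. Cell by cell, the energy is length times mean square
  of the coefficient, the same sum that \<open>simple_ito_integral_sq\<close> produces.\<close>

lemma simple_isometry:
  assumes S: "simple_integrand M F a b m p \<xi>" and ab: "0 \<le> a" "b \<le> T"
  shows "msq M (simple_ito_integral W m p \<xi>) = mean_square_energy M a b (simple_process m p \<xi>)"
proof -
  note D = simple_integrandD[OF S ab]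
  note I = simple_ito_integral_sq[OF S ab order_refl]
  have int\<xi>: "integrable M (\<lambda>w. (norm (\<xi> j w))\<^sup>2)" if j: "j < m" for j
  proof -
    obtain B where "0 \<le> B" "\<And>w. w \<in> space M \<Longrightarrow> norm (\<xi> j w) \<le> B"
      using bounded_imageD[OF D(6)[OF j]] by blast
    moreover have [measurable]: "\<xi> j \<in> borel_measurable M" by (rule D(7)[OF j])
    ultimately show ?thesis
      by (intro integrable_const_bound[of _ "B\<^sup>2"]) (auto intro!: power_mono)
  qed
  have "(\<integral>\<^sup>+s\<in>{a..b}. ennreal ((norm (simple_process m p \<xi> s w))\<^sup>2) \<partial>lborel) =
      (\<Sum>j<m. ennreal (p (Suc j) - p j) * ennreal ((norm (\<xi> j w))\<^sup>2))" for w
  proof -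
    have sub: "{p j<..p (Suc j)} \<subseteq> {a..b}" if "j < m" for j
      using partition_mono[of m p 0 j] partition_mono[of m p "Suc j" m] D that by auto
    have "(\<integral>\<^sup>+s\<in>{a..b}. ennreal ((norm (simple_process m p \<xi> s w))\<^sup>2) \<partial>lborel) =
       (\<integral>\<^sup>+s. (\<Sum>j<m. ennreal ((norm (\<xi> j w))\<^sup>2) * indicator {p j<..p (Suc j)} s) \<partial>lborel)"
    proof (rule nn_integral_cong)
      fix s :: real
      have "ennreal ((norm (simple_process m p \<xi> s w))\<^sup>2) =
          (\<Sum>j<m. ennreal ((norm (\<xi> j w))\<^sup>2) * indicator {p j<..p (Suc j)} s)"
        by (subst norm_simple_process_sq, erule D(3), subst sum_ennreal[symmetric])
          (auto simp: indicator_def intro!: sum.cong)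
      moreover have "(\<Sum>j<m. ennreal ((norm (\<xi> j w))\<^sup>2) * indicator {p j<..p (Suc j)} s) = 0" if "s \<notin> {a..b}"
      proof (rule sum.neutral, rule ballI)
        fix j assume "j \<in> {..<m}"
        then have "s \<notin> {p j<..p (Suc j)}"
          using sub that by blast
        then show "ennreal ((norm (\<xi> j w))\<^sup>2) * indicator {p j<..p (Suc j)} s = 0"
          by (simp add: indicator_def)
      qed
      ultimately show "ennreal ((norm (simple_process m p \<xi> s w))\<^sup>2) * indicator {a..b} s =
          (\<Sum>j<m. ennreal ((norm (\<xi> j w))\<^sup>2) * indicator {p j<..p (Suc j)} s)"
        by (cases "s \<in> {a..b}") auto
    qed
    also have "\<dots> = (\<Sum>j<m. ennreal ((norm (\<xi> j w))\<^sup>2) * ennreal (p (Suc j) - p j))"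
      using D(3) by (subst nn_integral_sum) (auto simp: nn_integral_cmult_indicator intro!: sum.cong)
    finally show ?thesis by (simp add: mult.commute)
  qed
  then have "mean_square_energy M a b (simple_process m p \<xi>) =
      (\<integral>\<^sup>+w. (\<Sum>j<m. ennreal (p (Suc j) - p j) * ennreal ((norm (\<xi> j w))\<^sup>2)) \<partial>M)"
    by (simp add: mean_square_energy_def)
  also have "\<dots> = (\<Sum>j<m. ennreal (p (Suc j) - p j) * ennreal (expectation (\<lambda>w. (norm (\<xi> j w))\<^sup>2)))"
    using D(7) int\<xi> by (subst nn_integral_sum) (auto simp: nn_integral_cmult nn_integral_eq_integral intro!: sum.cong)
  also have "\<dots> = ennreal (\<Sum>j<m. (p (Suc j) - p j) * expectation (\<lambda>w. (norm (\<xi> j w))\<^sup>2))"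
    using D(3) by (subst sum_ennreal[symmetric]) (auto simp: ennreal_mult intro!: sum.cong)
  also have "\<dots> = msq M (simple_ito_integral W m p \<xi>)"
    using I by (simp add: msq_def nn_integral_eq_integral)
  finally show ?thesis ..
qed

text \<open>The cells may overlap here. Cutting them along the common refinement of all their
  endpoints yields one partition; this is how simple integrands with different partitions are
  added.\<close>

lemma elementary_sum_is_simple:
  fixes \<eta> :: "'i \<Rightarrow> 'w \<Rightarrow> real ^ 'n ^ 'm" and c d :: "'i \<Rightarrow> real"
  assumes I: "finite I" and ab: "0 \<le> a" "a \<le> b" "b \<le> T"
    and cd: "\<And>i. i \<in> I \<Longrightarrow> a \<le> c i" "\<And>i. i \<in> I \<Longrightarrow> c i \<le> d i" "\<And>i. i \<in> I \<Longrightarrow> d i \<le> b"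
    and \<eta>: "\<And>i. i \<in> I \<Longrightarrow> \<eta> i \<in> borel_measurable (F (c i))" "\<And>i. i \<in> I \<Longrightarrow> bounded (\<eta> i ` space M)"
  obtains m p \<xi> where "simple_integrand M F a b m p \<xi>"
    "\<And>s w. simple_process m p \<xi> s w = (\<Sum>i\<in>I. indicator {c i<..d i} s *\<^sub>R \<eta> i w)"
    "\<And>w. simple_ito_integral W m p \<xi> w = (\<Sum>i\<in>I. \<eta> i w *v (W (d i) w - W (c i) w))"
proof -
  define P where "P = {a, b} \<union> c ` I \<union> d ` I"
  have P: "finite P" "P \<subseteq> {a..b}"
    using I ab cd order.trans[OF cd(1) cd(2)] order.trans[OF cd(2) cd(3)] by (auto simp: P_def)
  define L where "L = sorted_list_of_set P"
  have L: "sorted L" "set L = P"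
    using P by (auto simp: L_def)
  define m where "m = length L - 1"
  define p where "p k = L ! k" for k
  have len: "length L = Suc m"
    using L(2) by (cases L) (auto simp: m_def P_def)
  have p_in: "p k \<in> P" if "k \<le> m" for k
    using L(2) len that unfolding p_def by (metis nth_mem less_Suc_eq_le)
  have p_mono: "p i \<le> p j" if "i \<le> j" "j \<le> m" for i j
    using sorted_nth_mono[OF L(1)] len that by (auto simp: p_def)
  have p_ex: "\<exists>k\<le>m. x = p k" if "x \<in> P" for x
    using that L(2) len unfolding p_def by (metis in_set_conv_nth less_Suc_eq_le)
  have p0: "p 0 = a"
  proof -
    obtain k where "k \<le> m" "a = p k" using p_ex[of a] by (auto simp: P_def)
    then show ?thesis
      using p_mono[of 0 k] p_in[of 0] P(2) by force
  qed
  have pm: "p m = b"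
  proof -
    obtain k where "k \<le> m" "b = p k" using p_ex[of b] by (auto simp: P_def)
    then show ?thesis
      using p_mono[of k m] p_in[of m] P(2) by force
  qed
  \<comment> \<open>No endpoint lies strictly between neighbouring partition points, so every
    indicator is constant on \<open>{p j<..p (Suc j)}\<close>.\<close>
  have gap: "x \<le> p j \<or> p (Suc j) \<le> x" if xj: "x \<in> P" "j < m" for x j
  proof -
    obtain k where "k \<le> m" "x = p k" using p_ex[OF xj(1)] by auto
    then show ?thesis
      using p_mono[of k j] p_mono[of "Suc j" k] xj(2) by (cases "k \<le> j") auto
  qed
  have pstep: "p j \<le> p (Suc j)" if "j < m" for j
    using p_mono that by auto
  have cP: "c i \<in> P" and dP: "d i \<in> P" if "i \<in> I" for i
    using that by (auto simp: P_def)
  define V where "V s w = (\<Sum>i\<in>I. indicator {c i<..d i} s *\<^sub>R \<eta> i w)" for s w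
  \<comment> \<open>Cells are closed on the right, so the value at the right end is the value on the
    whole cell. It is nevertheless known at \<open>p j\<close>: a summand active there has
    \<open>c i < p (Suc j)\<close>, hence \<open>c i \<le> p j\<close> by
    \<open>gap\<close>.\<close>
  define \<xi> where "\<xi> j = V (p (Suc j))" for j
  have "\<xi> j \<in> borel_measurable (F (p j))" if j: "j < m" for j
  proof -
    have "(\<lambda>w. indicator {c i<..d i} (p (Suc j)) *\<^sub>R \<eta> i w) \<in> borel_measurable (F (p j))" if i: "i \<in> I" for i
    proof (cases "c i < p (Suc j)")
      case True
      then have "c i \<le> p j" using gap[OF cP[OF i] j] by auto
      moreover have "0 \<le> c i" "p j \<le> T"
        using cd(1)[OF i] ab p_in[of j] j P(2) by force+
      ultimately have [measurable]: "\<eta> i \<in> borel_measurable (F (p j))"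
        using measurable_F_mono \<eta>(1)[OF i] by blast
      show ?thesis by measurable
    qed simp
    then show ?thesis
      unfolding \<xi>_def V_def by (intro borel_measurable_sum) auto
  qed
  moreover have "bounded (\<xi> j ` space M)" for j
    unfolding \<xi>_def V_def
  proof (rule bounded_image_sum)
    fix i assume "i \<in> I"
    then show "bounded ((\<lambda>w. indicator {c i<..d i} (p (Suc j)) *\<^sub>R \<eta> i w) ` space M)"
      using bounded_scaling[OF \<eta>(2)] by (simp add: image_image)
  qed
  ultimately have simple: "simple_integrand M F a b m p \<xi>"
    using p0 pm pstep by (auto simp: simple_integrand_def)
  have proc: "simple_process m p \<xi> s w = V s w" for s w
  proof -
    have ind: "(\<Sum>j<m. indicator {p j<..p (Suc j)} s * indicator {c i<..d i} (p (Suc j))) =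
        (indicator {c i<..d i} s :: real)" if i: "i \<in> I" for i
    proof -
      have "(\<Sum>j<m. indicator {p j<..p (Suc j)} s * indicator {c i<..d i} (p (Suc j))) =
         (\<Sum>j<m. indicator {p j<..p (Suc j)} s * (indicator {c i<..d i} s :: real))"
        using gap[OF cP[OF i]] gap[OF dP[OF i]] by (intro sum.cong) (force simp: indicator_def)+
      also have "\<dots> = indicator {a<..b} s * indicator {c i<..d i} s"
        by (simp add: sum_distrib_right[symmetric] partition_indicator_sum[where m = m and p = p, OF pstep] p0 pm)
      also have "\<dots> = indicator {c i<..d i} s"
        using cd(1,3)[OF i] by (auto simp: indicator_def)
      finally show ?thesis .
    qed
    have "simple_process m p \<xi> s w =
        (\<Sum>i\<in>I. (\<Sum>j<m. indicator {p j<..p (Suc j)} s * indicator {c i<..d i} (p (Suc j))) *\<^sub>R \<eta> i w)"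
      unfolding simple_process_def \<xi>_def V_def
      by (simp only: scaleR_sum_right scaleR_sum_left scaleR_scaleR) (rule sum.swap)
    then show ?thesis
      by (simp only: ind V_def cong: sum.cong)
  qed
  have int: "simple_ito_integral W m p \<xi> w = (\<Sum>i\<in>I. \<eta> i w *v (W (d i) w - W (c i) w))" for w
  proof -
    have tel: "(\<Sum>j<m. indicator {c i<..d i} (p (Suc j)) *\<^sub>R (W (p (Suc j)) w - W (p j) w)) = W (d i) w - W (c i) w"
      if i: "i \<in> I" for i
    proof -
      \<comment> \<open>\<open>cl\<close> clamps a time to \<open>{c i..d i}\<close>. For a
        partition cell outside this interval both clamped endpoints coincide, so the sum over the
        selected cells becomes a full telescope.\<close>
      define cl where "cl x = max (c i) (min (d i) x)" for x
      have "(\<Sum>j<m. indicator {c i<..d i} (p (Suc j)) *\<^sub>R (W (p (Suc j)) w - W (p j) w)) =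
          (\<Sum>j<m. W (cl (p (Suc j))) w - W (cl (p j)) w)"
      proof (rule sum.cong)
        fix j assume "j \<in> {..<m}"
        then have j: "j < m" by simp
        note le = pstep[OF j] cd(2)[OF i] gap[OF cP[OF i] j] gap[OF dP[OF i] j]
        show "indicator {c i<..d i} (p (Suc j)) *\<^sub>R (W (p (Suc j)) w - W (p j) w) =
            W (cl (p (Suc j))) w - W (cl (p j)) w"
        proof (cases "p (Suc j) \<in> {c i<..d i}")
          case True
          then have "cl (p (Suc j)) = p (Suc j)" "cl (p j) = p j"
            using le unfolding cl_def by auto
          then show ?thesis using True by simp
        next
          case False
          then have "cl (p (Suc j)) = cl (p j)"
            using le unfolding cl_def by auto
          then show ?thesis using False by simp
        qed
      qed simp
      also have "\<dots> = W (cl (p m)) w - W (cl (p 0)) w"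
        by (rule sum_lessThan_telescope)
      also have "\<dots> = W (d i) w - W (c i) w"
        using cd[OF i] by (simp add: cl_def p0 pm)
      finally show ?thesis .
    qed
    interpret bounded_bilinear "(*v) :: real ^ 'n ^ 'm \<Rightarrow> _"
      by (rule bounded_bilinear_matrix_vector_mult)
    have "simple_ito_integral W m p \<xi> w =
        (\<Sum>i\<in>I. \<Sum>j<m. \<eta> i w *v (indicator {c i<..d i} (p (Suc j)) *\<^sub>R (W (p (Suc j)) w - W (p j) w)))"
      unfolding simple_ito_integral_def \<xi>_def V_def
      by (simp only: sum_left scaleR_left scaleR_right) (rule sum.swap)
    then show ?thesis
      by (simp only: sum_right[symmetric] tel cong: sum.cong)
  qed
  show ?thesis
    using that[OF simple] proc int by (simp add: V_def)
qed

end


section \<open>The Ito integral\<close>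

lemma choice3:
  "\<forall>k. \<exists>x y z. P k x y z \<Longrightarrow> \<exists>x y z. \<forall>k. P k (x k) (y k) (z k)"
  by metis

text \<open>The left endpoint is excluded because simple processes on left-open cells vanish there;
  a single time is a null set.\<close>

lemma mean_square_energy_cong:
  assumes "\<And>s w. s \<in> {a<..b} \<Longrightarrow> w \<in> space M \<Longrightarrow> V s w = V' s w"
  shows "mean_square_energy M a b V = mean_square_energy M a b V'"
  unfolding mean_square_energy_def
proof (rule nn_integral_cong)
  fix w assume w: "w \<in> space M"
  have "V s w = V' s w" if "s \<in> {a..b}" "s \<noteq> a" for s
    using assms[OF _ w, of s] that by auto
  then show "(\<integral>\<^sup>+s\<in>{a..b}. ennreal ((norm (V s w))\<^sup>2) \<partial>lborel) = (\<integral>\<^sup>+s\<in>{a..b}. ennreal ((norm (V' s w))\<^sup>2) \<partial>lborel)"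
    by (intro nn_integral_cong_AE) (use AE_lborel_singleton[of a] in eventually_elim, auto simp: indicator_def)
qed

lemma mean_square_energy_shrink:
  assumes "a0 \<le> a" "\<And>s w. s \<in> {a0<..a} \<Longrightarrow> w \<in> space M \<Longrightarrow> V s w = 0"
  shows "mean_square_energy M a0 b V = mean_square_energy M a b V"
  unfolding mean_square_energy_def
proof (rule nn_integral_cong)
  fix w assume w: "w \<in> space M"
  have "V s w = 0" if "s \<in> {a0..a}" "s \<noteq> a0" for s
    using assms(2)[OF _ w, of s] that by auto
  then show "(\<integral>\<^sup>+s\<in>{a0..b}. ennreal ((norm (V s w))\<^sup>2) \<partial>lborel) = (\<integral>\<^sup>+s\<in>{a..b}. ennreal ((norm (V s w))\<^sup>2) \<partial>lborel)"
    using assms(1)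
    by (intro nn_integral_cong_AE) (use AE_lborel_singleton[of a0] in eventually_elim, auto simp: indicator_def)
qed

lemma mean_square_energy_mono:
  assumes "a \<le> a'" "b' \<le> b"
  shows "mean_square_energy M a' b' V \<le> mean_square_energy M a b V"
  unfolding mean_square_energy_def
  by (intro nn_integral_mono mult_left_mono) (use assms in \<open>auto simp: indicator_def\<close>)

context wiener_filtration
begin

lemma energy_eq:
  assumes "jointly_measurable a b V"
  shows "energy a b V = msq (restrict_space lborel {a..b} \<Otimes>\<^sub>M M) (\<lambda>(s, w). V s w)"
  by (rule mean_square_energy_eq_msq[OF sigma_finite_measure_axioms assms])

lemma energy_add_le:
  fixes V V' :: "real \<Rightarrow> 'w \<Rightarrow> 'b::{second_countable_topology, real_normed_vector}"
  assumes V: "jointly_measurable a b V"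
    and V': "jointly_measurable a b V'"
  shows "energy a b (\<lambda>s w. V s w + V' s w) \<le>
    2 * energy a b V + 2 * energy a b V'"
proof -
  have "jointly_measurable a b (\<lambda>s w. V s w + V' s w)"
    using borel_measurable_add[OF V V'] by (simp add: case_prod_beta)
  moreover have "sets (restrict_space lborel {a..b} \<Otimes>\<^sub>M M) = sets (restrict_space borel {a..b} \<Otimes>\<^sub>M M)"
    by (rule sets_restrict_lborel_pair)
  ultimately show ?thesis
    using V V' msq_add_le[of "\<lambda>(s, w). V s w" "restrict_space lborel {a..b} \<Otimes>\<^sub>M M" "\<lambda>(s, w). V' s w"]
    by (simp add: energy_eq split_beta' cong: measurable_cong_sets)
qed

lemma energy_mono_scaled:
  assumes V: "jointly_measurable a b V"
    and V': "jointly_measurable a b V'"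
    and C: "0 \<le> C"
    and le: "\<And>s w. s \<in> {a..b} \<Longrightarrow> w \<in> space M \<Longrightarrow> norm (V s w) \<le> C * norm (V' s w)"
  shows "energy a b V \<le> ennreal (C\<^sup>2) * energy a b V'"
proof -
  have "sets (restrict_space lborel {a..b} \<Otimes>\<^sub>M M) = sets (restrict_space borel {a..b} \<Otimes>\<^sub>M M)"
    by (rule sets_restrict_lborel_pair)
  then have "(\<lambda>(s, w). V' s w) \<in> borel_measurable (restrict_space lborel {a..b} \<Otimes>\<^sub>M M)"
    using V' by (simp cong: measurable_cong_sets)
  then show ?thesis
    unfolding energy_eq[OF V] energy_eq[OF V'] using C
    by (rule msq_mono_scaled) (auto simp: space_pair_measure intro!: AE_I2 le)
qed

section \<open>Estimates and closure rules for the integral relation\<close>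

lemma has_ito_integralD:
  assumes "has_ito_integral M F W a b H J"
  shows "jointly_measurable a b H"
    and "J \<in> borel_measurable M"
    and "\<exists>m p \<xi>. (\<forall>k :: nat. simple_integrand M F a b (m k) (p k) (\<xi> k)) \<and>
        (\<lambda>k. energy a b (\<lambda>s w. simple_process (m k) (p k) (\<xi> k) s w - H s w)) \<longlonglongrightarrow> 0 \<and>
        (\<lambda>k. msq M (\<lambda>w. simple_ito_integral W (m k) (p k) (\<xi> k) w - J w)) \<longlonglongrightarrow> 0"
  using assms unfolding has_ito_integral_def msq_def by blast+

lemma has_ito_integralI:
  assumes "jointly_measurable a b H"
    and "J \<in> borel_measurable M"
    and "\<And>k :: nat. simple_integrand M F a b (m k) (p k) (\<xi> k)"
    and "(\<lambda>k. energy a b (\<lambda>s w. simple_process (m k) (p k) (\<xi> k) s w - H s w)) \<longlonglongrightarrow> 0"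
    and "(\<lambda>k. msq M (\<lambda>w. simple_ito_integral W (m k) (p k) (\<xi> k) w - J w)) \<longlonglongrightarrow> 0"
  shows "has_ito_integral M F W a b H J"
  using assms unfolding has_ito_integral_def msq_def by blast

lemma simple_ito_integral_measurable:
  assumes "simple_integrand M F a b m p \<xi>" "0 \<le> a" "b \<le> T"
  shows "simple_ito_integral W m p \<xi> \<in> borel_measurable M"
  using simple_ito_integral_sq[OF assms order_refl] simple_integrandD(4)[OF assms, of m] measurable_F_M
  by blast

lemma simple_integrand_range:
  assumes "simple_integrand M F a b m p \<xi>" "j < m"
  shows "a \<le> p j" "p (Suc j) \<le> b"
  using assms partition_mono[of m p 0 j] partition_mono[of m p "Suc j" m]
  by (auto simp: simple_integrand_def)

text \<open>The sharp constant is \<open>1\<close>; the constant \<open>4\<close> comes from \<open>(x + y)\<^sup>2 \<le> 2 x\<^sup>2 + 2 y\<^sup>2\<close> and avoids square roots of \<open>ennreal\<close> values.\<close>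

lemma has_ito_integral_msq_le:
  assumes ito: "has_ito_integral M F W a b H J" and ab: "0 \<le> a" "b \<le> T"
  shows "msq M J \<le> 4 * energy a b H"
proof -
  note D = has_ito_integralD[OF ito]
  obtain m p \<xi> where S: "\<And>k :: nat. simple_integrand M F a b (m k) (p k) (\<xi> k)"
    and E: "(\<lambda>k. energy a b (\<lambda>s w. simple_process (m k) (p k) (\<xi> k) s w - H s w)) \<longlonglongrightarrow> 0"
    and L: "(\<lambda>k. msq M (\<lambda>w. simple_ito_integral W (m k) (p k) (\<xi> k) w - J w)) \<longlonglongrightarrow> 0"
    using D(3) by blast
  let ?S = "\<lambda>k. simple_process (m k) (p k) (\<xi> k)" and ?I = "\<lambda>k. simple_ito_integral W (m k) (p k) (\<xi> k)"
  define e where "e k = energy a b (\<lambda>s w. ?S k s w - H s w)" for k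
  define l where "l k = msq M (\<lambda>w. ?I k w - J w)" for k
  have le: "msq M J \<le> 4 * energy a b H + (4 * e k + 2 * l k)" for k
  proof -
    have Sm: "jointly_measurable a b (\<lambda>s w. ?S k s w)"
      by (rule simple_process_measurable) (rule simple_integrandD(7)[OF S ab])
    have Sd: "jointly_measurable a b (\<lambda>s w. ?S k s w - H s w)"
      using borel_measurable_diff[OF Sm D(1)] by (simp add: case_prod_beta)
    have Im: "?I k \<in> borel_measurable M"
      by (rule simple_ito_integral_measurable[OF S ab])
    have "msq M J = msq M (\<lambda>w. ?I k w - (?I k w - J w))"
      by simp
    also have "\<dots> \<le> 2 * msq M (?I k) + 2 * l k"
      unfolding l_def using Im D(2) by (intro msq_diff_le) auto
    also have "\<dots> \<le> 2 * (2 * e k + 2 * energy a b H) + 2 * l k"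
      unfolding simple_isometry[OF S ab] e_def using energy_add_le[OF Sd D(1)]
      by (intro add_mono mult_left_mono) auto
    finally show ?thesis
      by (simp add: distrib_left mult.assoc[symmetric] add_ac)
  qed
  have "(\<lambda>k. 4 * energy a b H + (4 * e k + 2 * l k)) \<longlonglongrightarrow> 4 * energy a b H + (4 * 0 + 2 * 0)"
    using E L unfolding e_def[symmetric] l_def[symmetric]
    by (intro tendsto_add tendsto_const ennreal_tendsto_cmult) auto
  from LIMSEQ_le_const[OF this] show ?thesis
    using le by auto
qed

text \<open>The two approximating sequences live on unrelated partitions. For each \<open>k\<close>
  the cells of both are collected in one family, which \<open>elementary_sum_is_simple\<close> turns
  into a single simple integrand.\<close>

lemma has_ito_integral_add:
  assumes H: "has_ito_integral M F W a b H J" and H': "has_ito_integral M F W a b H' J'"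
    and ab: "0 \<le> a" "a \<le> b" "b \<le> T"
  shows "has_ito_integral M F W a b (\<lambda>s w. H s w + H' s w) (\<lambda>w. J w + J' w)"
proof -
  note D = has_ito_integralD[OF H] and D' = has_ito_integralD[OF H']
  obtain m p \<xi> where S: "\<And>k :: nat. simple_integrand M F a b (m k) (p k) (\<xi> k)"
    and E: "(\<lambda>k. energy a b (\<lambda>s w. simple_process (m k) (p k) (\<xi> k) s w - H s w)) \<longlonglongrightarrow> 0"
    and L: "(\<lambda>k. msq M (\<lambda>w. simple_ito_integral W (m k) (p k) (\<xi> k) w - J w)) \<longlonglongrightarrow> 0"
    using D(3) by blast
  let ?S = "\<lambda>k. simple_process (m k) (p k) (\<xi> k)" and ?I = "\<lambda>k. simple_ito_integral W (m k) (p k) (\<xi> k)"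
  obtain m' p' \<xi>' where S': "\<And>k :: nat. simple_integrand M F a b (m' k) (p' k) (\<xi>' k)"
    and E': "(\<lambda>k. energy a b (\<lambda>s w. simple_process (m' k) (p' k) (\<xi>' k) s w - H' s w)) \<longlonglongrightarrow> 0"
    and L': "(\<lambda>k. msq M (\<lambda>w. simple_ito_integral W (m' k) (p' k) (\<xi>' k) w - J' w)) \<longlonglongrightarrow> 0"
    using D'(3) by blast
  let ?S' = "\<lambda>k. simple_process (m' k) (p' k) (\<xi>' k)" and ?I' = "\<lambda>k. simple_ito_integral W (m' k) (p' k) (\<xi>' k)"
  have ex: "\<forall>k. \<exists>n q \<eta>. simple_integrand M F a b n q \<eta> \<and>
    (\<forall>s w. simple_process n q \<eta> s w = ?S k s w + ?S' k s w) \<and>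
    (\<forall>w. simple_ito_integral W n q \<eta> w = ?I k w + ?I' k w)" (is "\<forall>k. ?Q k")
  proof
    fix k
    note s = simple_integrandD[OF S[of k] ab(1,3)] and s' = simple_integrandD[OF S'[of k] ab(1,3)]
    \<comment> \<open>The disjoint sum keeps the cells of the two partitions apart even where they
      coincide.\<close>
    define I where "I = {..<m k} <+> {..<m' k}"
    define c where "c = case_sum (p k) (p' k)"
    define d where "d = case_sum (\<lambda>j. p k (Suc j)) (\<lambda>j. p' k (Suc j))"
    define \<zeta> where "\<zeta> = case_sum (\<xi> k) (\<xi>' k)"
    have fin: "finite I" by (simp add: I_def)
    have "a \<le> c i \<and> c i \<le> d i \<and> d i \<le> b \<and> \<zeta> i \<in> borel_measurable (F (c i)) \<and> bounded (\<zeta> i ` space M)"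
      if "i \<in> I" for i
    proof (cases i)
      case (Inl j)
      then have "j < m k" using that by (auto simp: I_def)
      then show ?thesis
        using Inl s(3,5,6) simple_integrand_range[OF S[of k], of j] by (simp add: c_def d_def \<zeta>_def)
    next
      case (Inr j)
      then have "j < m' k" using that by (auto simp: I_def)
      then show ?thesis
        using Inr s'(3,5,6) simple_integrand_range[OF S'[of k], of j] by (simp add: c_def d_def \<zeta>_def)
    qed
    then obtain n q \<eta> where "simple_integrand M F a b n q \<eta>"
      "\<And>s w. simple_process n q \<eta> s w = (\<Sum>i\<in>I. indicator {c i<..d i} s *\<^sub>R \<zeta> i w)"
      "\<And>w. simple_ito_integral W n q \<eta> w = (\<Sum>i\<in>I. \<zeta> i w *v (W (d i) w - W (c i) w))"
      using elementary_sum_is_simple[of I a b c d \<zeta>, OF fin ab] by blast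
    then show "?Q k"
      by (intro exI[of _ n] exI[of _ q] exI[of _ \<eta>])
        (simp only: I_def sum.Plus finite_lessThan simple_process_def simple_ito_integral_def c_def d_def \<zeta>_def
          sum.case o_def simp_thms)
  qed
  from choice3[OF ex] obtain n q \<eta> where N: "\<And>k. simple_integrand M F a b (n k) (q k) (\<eta> k)"
    and P: "\<And>k s w. simple_process (n k) (q k) (\<eta> k) s w = ?S k s w + ?S' k s w"
    and I: "\<And>k w. simple_ito_integral W (n k) (q k) (\<eta> k) w = ?I k w + ?I' k w"
    by blast
  show ?thesis
  proof (rule has_ito_integralI[OF _ _ N])
    show "jointly_measurable a b (\<lambda>s w. H s w + H' s w)"
      using borel_measurable_add[OF D(1) D'(1)] by (simp add: case_prod_beta)
    show "(\<lambda>w. J w + J' w) \<in> borel_measurable M"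
      using D(2) D'(2) by simp
    have Sd: "jointly_measurable a b (\<lambda>s w. ?S k s w - H s w)" for k
      using borel_measurable_diff[OF simple_process_measurable[OF simple_integrandD(7)[OF S ab(1,3)]] D(1)]
      by (simp add: case_prod_beta)
    have Sd': "jointly_measurable a b (\<lambda>s w. ?S' k s w - H' s w)" for k
      using borel_measurable_diff[OF simple_process_measurable[OF simple_integrandD(7)[OF S' ab(1,3)]] D'(1)]
      by (simp add: case_prod_beta)
    show "(\<lambda>k. energy a b (\<lambda>s w. simple_process (n k) (q k) (\<eta> k) s w - (H s w + H' s w))) \<longlonglongrightarrow> 0"
      by (rule tendsto_zero_sandwich_sum[OF _ E E'])
        (use energy_add_le[OF Sd Sd'] in \<open>simp add: P add_diff_add\<close>)
    show "(\<lambda>k. msq M (\<lambda>w. simple_ito_integral W (n k) (q k) (\<eta> k) w - (J w + J' w))) \<longlonglongrightarrow> 0"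
    proof (rule tendsto_zero_sandwich_sum[OF _ L L'])
      fix k
      have "(\<lambda>w. ?I k w - J w) \<in> borel_measurable M" "(\<lambda>w. ?I' k w - J' w) \<in> borel_measurable M"
        using simple_ito_integral_measurable[OF S ab(1,3)] simple_ito_integral_measurable[OF S' ab(1,3)] D(2) D'(2)
        by auto
      from msq_add_le[OF this]
      show "msq M (\<lambda>w. simple_ito_integral W (n k) (q k) (\<eta> k) w - (J w + J' w)) \<le>
         2 * msq M (\<lambda>w. ?I k w - J w) + 2 * msq M (\<lambda>w. ?I' k w - J' w)"
        by (simp add: I add_diff_add)
    qed
  qed
qed

text \<open>A factor known at the left end \<open>a\<close> is known at all partition points, so it
  may multiply the coefficients of the approximants. Its boundedness keeps them bounded and both
  approximation errors small.\<close>

lemma has_ito_integral_left_mult: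
  fixes B :: "'w \<Rightarrow> real ^ 'm ^ 'l" and H :: "real \<Rightarrow> 'w \<Rightarrow> real ^ 'n ^ 'm"
  assumes ito: "has_ito_integral M F W a b H J" and ab: "0 \<le> a" "b \<le> T"
    and B: "B \<in> borel_measurable (F a)" "bounded (B ` space M)"
  shows "has_ito_integral M F W a b (\<lambda>s w. B w ** H s w) (\<lambda>w. B w *v J w)"
proof -
  note D = has_ito_integralD[OF ito]
  obtain m p \<xi> where S: "\<And>k :: nat. simple_integrand M F a b (m k) (p k) (\<xi> k)"
    and E: "(\<lambda>k. energy a b (\<lambda>s w. simple_process (m k) (p k) (\<xi> k) s w - H s w)) \<longlonglongrightarrow> 0"
    and L: "(\<lambda>k. msq M (\<lambda>w. simple_ito_integral W (m k) (p k) (\<xi> k) w - J w)) \<longlonglongrightarrow> 0"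
    using D(3) by blast
  let ?S = "\<lambda>k. simple_process (m k) (p k) (\<xi> k)" and ?I = "\<lambda>k. simple_ito_integral W (m k) (p k) (\<xi> k)"
  obtain C where C: "0 \<le> C" "\<And>w. w \<in> space M \<Longrightarrow> norm (B w) \<le> C"
    using bounded_imageD[OF B(2)] by blast
  interpret mv: bounded_bilinear "(*v) :: real ^ 'm ^ 'l \<Rightarrow> _" by (rule bounded_bilinear_matrix_vector_mult)
  interpret mm: bounded_bilinear "(**) :: real ^ 'm ^ 'l \<Rightarrow> real ^ 'n ^ 'm \<Rightarrow> _" by (rule bounded_bilinear_matrix_matrix_mult)
  define \<eta> where "\<eta> k j w = B w ** \<xi> k j w" for k j w
  have p: "p k j \<in> {a..T}" if "j \<le> m k" for k j
    using simple_integrandD[OF S[of k] ab] partition_mono[of "m k" "p k" 0 j] that by auto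
  have BM: "B \<in> borel_measurable M"
    using measurable_F_M[OF _ B(1)] p[of 0 0] ab simple_integrandD(1)[OF S[of 0] ab] by auto
  have N: "simple_integrand M F a b (m k) (p k) (\<eta> k)" for k
    unfolding simple_integrand_def
  proof (intro conjI allI impI)
    fix j assume j: "j < m k"
    note s = simple_integrandD[OF S[of k] ab]
    show "p k j \<le> p k (Suc j)" using s j by auto
    have [measurable]: "B \<in> borel_measurable (F (p k j))" "\<xi> k j \<in> borel_measurable (F (p k j))"
      using measurable_F_mono[OF ab(1) _ _ B(1), of "p k j"] p[of j k] j s(5)[OF j] by auto
    show "\<eta> k j \<in> borel_measurable (F (p k j))"
      unfolding \<eta>_def[abs_def] by measurable
    obtain C' where C': "0 \<le> C'" "\<And>w. w \<in> space M \<Longrightarrow> norm (\<xi> k j w) \<le> C'"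
      using bounded_imageD[OF s(6)[OF j]] by blast
    show "bounded (\<eta> k j ` space M)"
      unfolding bounded_iff \<eta>_def
      by (rule exI[of _ "C * C'"])
        (auto intro!: order.trans[OF norm_matrix_matrix_mult_le] mult_mono C C')
  qed (use simple_integrandD[OF S[of k] ab] in auto)
  have P: "simple_process (m k) (p k) (\<eta> k) s w = B w ** ?S k s w" for k s w
    by (simp add: simple_process_def \<eta>_def mm.sum_right mm.scaleR_right)
  have I: "simple_ito_integral W (m k) (p k) (\<eta> k) w = B w *v ?I k w" for k w
    by (simp add: simple_ito_integral_def \<eta>_def mv.sum_right matrix_vector_mul_assoc)
  have BM2: "(\<lambda>x. B (snd x)) \<in> borel_measurable (restrict_space borel {a..b} \<Otimes>\<^sub>M M)"
    using measurable_compose[OF measurable_snd BM] .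
  have meas: "jointly_measurable a b (\<lambda>s w. B w ** V s w)"
    if "jointly_measurable a b V" for V :: "real \<Rightarrow> 'w \<Rightarrow> real ^ 'n ^ 'm"
    using borel_measurable_matrix_matrix_mult[OF BM2 that] by (simp add: case_prod_beta)
  show ?thesis
  proof (rule has_ito_integralI[OF meas[OF D(1)] _ N])
    show "(\<lambda>w. B w *v J w) \<in> borel_measurable M"
      using BM D(2) by measurable
    have Sd: "jointly_measurable a b (\<lambda>s w. ?S k s w - H s w)" for k
      using borel_measurable_diff[OF simple_process_measurable[OF simple_integrandD(7)[OF S ab]] D(1)]
      by (simp add: case_prod_beta)
    show "(\<lambda>k. energy a b (\<lambda>s w. simple_process (m k) (p k) (\<eta> k) s w - B w ** H s w)) \<longlonglongrightarrow> 0"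
    proof (rule tendsto_ennreal_sandwich)
      fix k
      show "energy a b (\<lambda>s w. simple_process (m k) (p k) (\<eta> k) s w - B w ** H s w) \<le>
        ennreal (C\<^sup>2) * energy a b (\<lambda>s w. ?S k s w - H s w)"
        unfolding P mm.diff_right[symmetric]
        by (rule energy_mono_scaled[OF meas[OF Sd] Sd C(1)])
          (auto intro!: order.trans[OF norm_matrix_matrix_mult_le] mult_right_mono C)
    next
      show "(\<lambda>k. ennreal (C\<^sup>2) * energy a b (\<lambda>s w. ?S k s w - H s w)) \<longlonglongrightarrow> 0"
        using ennreal_tendsto_cmult[OF _ E, of "ennreal (C\<^sup>2)"] by simp
    qed
    show "(\<lambda>k. msq M (\<lambda>w. simple_ito_integral W (m k) (p k) (\<eta> k) w - B w *v J w)) \<longlonglongrightarrow> 0"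
    proof (rule tendsto_ennreal_sandwich)
      fix k
      have m: "(\<lambda>w. ?I k w - J w) \<in> borel_measurable M"
        using simple_ito_integral_measurable[OF S ab] D(2) by auto
      show "msq M (\<lambda>w. simple_ito_integral W (m k) (p k) (\<eta> k) w - B w *v J w) \<le>
        ennreal (C\<^sup>2) * msq M (\<lambda>w. ?I k w - J w)"
        unfolding I mv.diff_right[symmetric]
        by (rule msq_mono_scaled[OF m C(1)], rule AE_I2)
          (auto intro!: order.trans[OF norm_matrix_vector_mult_le] mult_right_mono C)
    next
      show "(\<lambda>k. ennreal (C\<^sup>2) * msq M (\<lambda>w. ?I k w - J w)) \<longlonglongrightarrow> 0"
        using ennreal_tendsto_cmult[OF _ L, of "ennreal (C\<^sup>2)"] by simp
    qed
  qed
qed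

text \<open>The approximants get one more cell in front, from \<open>a0\<close> to \<open>a\<close>,
  with coefficient zero; \<open>case_nat\<close> shifts the old cells by one. Neither their
  integrals nor the approximation errors change.\<close>

lemma has_ito_integral_extend:
  assumes ito: "has_ito_integral M F W a b H J" and ab: "0 \<le> a0" "a0 \<le> a" "b \<le> T"
    and H': "jointly_measurable a0 b H'"
    and eq: "\<And>s w. s \<in> {a<..b} \<Longrightarrow> w \<in> space M \<Longrightarrow> H' s w = H s w"
    and zero: "\<And>s w. s \<in> {a0<..a} \<Longrightarrow> w \<in> space M \<Longrightarrow> H' s w = 0"
  shows "has_ito_integral M F W a0 b H' J"
proof -
  have a: "0 \<le> a" using ab by simp
  note D = has_ito_integralD[OF ito]
  obtain m p \<xi> where S: "\<And>k :: nat. simple_integrand M F a b (m k) (p k) (\<xi> k)"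
    and E: "(\<lambda>k. energy a b (\<lambda>s w. simple_process (m k) (p k) (\<xi> k) s w - H s w)) \<longlonglongrightarrow> 0"
    and L: "(\<lambda>k. msq M (\<lambda>w. simple_ito_integral W (m k) (p k) (\<xi> k) w - J w)) \<longlonglongrightarrow> 0"
    using D(3) by blast
  let ?S = "\<lambda>k. simple_process (m k) (p k) (\<xi> k)" and ?I = "\<lambda>k. simple_ito_integral W (m k) (p k) (\<xi> k)"
  define q where "q k = case_nat a0 (p k)" for k
  define \<eta> where "\<eta> k = case_nat (\<lambda>_. 0) (\<xi> k)" for k
  have N: "simple_integrand M F a0 b (Suc (m k)) (q k) (\<eta> k)" for k
    using simple_integrandD[OF S[of k] a ab(3)] ab
    by (auto simp: simple_integrand_def q_def \<eta>_def less_Suc_eq_0_disj bounded_iff)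
  have P: "simple_process (Suc (m k)) (q k) (\<eta> k) s w = ?S k s w" for k s w
    unfolding simple_process_def by (subst sum.lessThan_Suc_shift) (simp add: q_def \<eta>_def)
  have I: "simple_ito_integral W (Suc (m k)) (q k) (\<eta> k) w = ?I k w" for k w
    unfolding simple_ito_integral_def by (subst sum.lessThan_Suc_shift) (simp add: q_def \<eta>_def)
  have P0: "?S k s w = 0" if "s \<le> a" for k s w
    unfolding simple_process_def
  proof (rule sum.neutral, rule ballI)
    fix j assume "j \<in> {..<m k}"
    then have "a \<le> p k j"
      using simple_integrandD[OF S[of k] a ab(3)] partition_mono[of "m k" "p k" 0 j] by auto
    then show "indicator {p k j<..p k (Suc j)} s *\<^sub>R \<xi> k j w = 0"
      using that by auto
  qed
  have "energy a0 b (\<lambda>s w. ?S k s w - H' s w) =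
      energy a b (\<lambda>s w. ?S k s w - H s w)" for k
  proof -
    have "energy a0 b (\<lambda>s w. ?S k s w - H' s w) =
       energy a b (\<lambda>s w. ?S k s w - H' s w)"
      by (rule mean_square_energy_shrink) (auto simp: ab P0 zero)
    also have "\<dots> = energy a b (\<lambda>s w. ?S k s w - H s w)"
      by (rule mean_square_energy_cong) (simp add: eq)
    finally show ?thesis .
  qed
  then show ?thesis
    using E L by (intro has_ito_integralI[OF H' D(2) N]) (simp_all add: P I)
qed

text \<open>Diagonal choice: the \<open>k\<close>-th integral is replaced by a simple one within
  \<open>inverse (real (Suc k))\<close>, both in energy of the integrand and in mean square of the
  value.\<close>

lemma has_ito_integral_limit:
  assumes ito: "\<And>k. has_ito_integral M F W a b (H k) (J k)" and ab: "0 \<le> a" "b \<le> T"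
    and H': "jointly_measurable a b H'"
    and J': "J' \<in> borel_measurable M"
    and limH: "(\<lambda>k. energy a b (\<lambda>s w. H k s w - H' s w)) \<longlonglongrightarrow> 0"
    and limJ: "(\<lambda>k. msq M (\<lambda>w. J k w - J' w)) \<longlonglongrightarrow> 0"
  shows "has_ito_integral M F W a b H' J'"
proof -
  note D = has_ito_integralD[OF ito]
  have ex: "\<forall>k. \<exists>m p \<xi>. simple_integrand M F a b m p \<xi> \<and>
      energy a b (\<lambda>s w. simple_process m p \<xi> s w - H k s w) < ennreal (inverse (real (Suc k))) \<and>
      msq M (\<lambda>w. simple_ito_integral W m p \<xi> w - J k w) < ennreal (inverse (real (Suc k)))" (is "\<forall>k. ?Q k")
  proof
    fix k
    obtain m p \<xi> where S: "\<And>l :: nat. simple_integrand M F a b (m l) (p l) (\<xi> l)"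
      and E: "(\<lambda>l. energy a b (\<lambda>s w. simple_process (m l) (p l) (\<xi> l) s w - H k s w)) \<longlonglongrightarrow> 0"
      and L: "(\<lambda>l. msq M (\<lambda>w. simple_ito_integral W (m l) (p l) (\<xi> l) w - J k w)) \<longlonglongrightarrow> 0"
      using D(3)[of k] by blast
    have pos: "0 < ennreal (inverse (real (Suc k)))" by simp
    from eventually_happens'[OF sequentially_bot
      eventually_conj[OF order_tendstoD(2)[OF E pos] order_tendstoD(2)[OF L pos]]]
    show "?Q k" using S by blast
  qed
  from choice3[OF ex] obtain m p \<xi> where S: "\<And>k. simple_integrand M F a b (m k) (p k) (\<xi> k)"
    and E: "\<And>k. energy a b (\<lambda>s w. simple_process (m k) (p k) (\<xi> k) s w - H k s w) < ennreal (inverse (real (Suc k)))"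
    and L: "\<And>k. msq M (\<lambda>w. simple_ito_integral W (m k) (p k) (\<xi> k) w - J k w) < ennreal (inverse (real (Suc k)))"
    by blast
  have inv: "(\<lambda>k. ennreal (inverse (real (Suc k)))) \<longlonglongrightarrow> 0"
    using tendsto_ennrealI[OF LIMSEQ_inverse_real_of_nat] by simp
  let ?S = "\<lambda>k. simple_process (m k) (p k) (\<xi> k)" and ?I = "\<lambda>k. simple_ito_integral W (m k) (p k) (\<xi> k)"
  have E': "(\<lambda>k. energy a b (\<lambda>s w. ?S k s w - H k s w)) \<longlonglongrightarrow> 0"
    and L': "(\<lambda>k. msq M (\<lambda>w. ?I k w - J k w)) \<longlonglongrightarrow> 0"
    by (rule tendsto_ennreal_sandwich[OF less_imp_le[OF E] inv] tendsto_ennreal_sandwich[OF less_imp_le[OF L] inv])+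
  have Sd: "jointly_measurable a b (\<lambda>s w. ?S k s w - H k s w)" for k
    using borel_measurable_diff[OF simple_process_measurable[OF simple_integrandD(7)[OF S ab]] D(1)]
    by (simp add: case_prod_beta)
  have Hd: "jointly_measurable a b (\<lambda>s w. H k s w - H' s w)" for k
    using borel_measurable_diff[OF D(1) H'] by (simp add: case_prod_beta)
  show ?thesis
  proof (rule has_ito_integralI[OF H' J' S])
    show "(\<lambda>k. energy a b (\<lambda>s w. ?S k s w - H' s w)) \<longlonglongrightarrow> 0"
    proof (rule tendsto_zero_sandwich_sum[OF _ E' limH])
      show "energy a b (\<lambda>s w. ?S k s w - H' s w) \<le>
          2 * energy a b (\<lambda>s w. ?S k s w - H k s w) + 2 * energy a b (\<lambda>s w. H k s w - H' s w)" for k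
        using energy_add_le[OF Sd[of k] Hd[of k]] by simp
    qed
    show "(\<lambda>k. msq M (\<lambda>w. ?I k w - J' w)) \<longlonglongrightarrow> 0"
    proof (rule tendsto_zero_sandwich_sum[OF _ L' limJ])
      fix k
      have "(\<lambda>w. ?I k w - J k w) \<in> borel_measurable M" "(\<lambda>w. J k w - J' w) \<in> borel_measurable M"
        using simple_ito_integral_measurable[OF S ab] D(2)[of k] J' by auto
      from msq_add_le[OF this]
      show "msq M (\<lambda>w. ?I k w - J' w) \<le> 2 * msq M (\<lambda>w. ?I k w - J k w) + 2 * msq M (\<lambda>w. J k w - J' w)"
        by simp
    qed
  qed
qed

end


section \<open>Centring of the integral and conditional expectations\<close>

context wiener_filtration
begin

lemma msq_finite_integrable:
  fixes V :: "'w \<Rightarrow> 'b::euclidean_space"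
  assumes V: "V \<in> borel_measurable M" and fin: "msq M V < \<infinity>"
  shows "integrable M (\<lambda>w. (norm (V w))\<^sup>2)" "integrable M V"
proof -
  show *: "integrable M (\<lambda>w. (norm (V w))\<^sup>2)"
    using V fin by (intro integrableI_bounded) (auto simp: msq_def)
  have le: "norm (V w) \<le> 1 + (norm (V w))\<^sup>2" for w
    using sum_squares_bound[of 1 "norm (V w)"] norm_ge_zero[of "V w"] by (simp del: norm_ge_zero)
  show "integrable M V"
    by (rule Bochner_Integration.integrable_bound[of M "\<lambda>w. 1 + (norm (V w))\<^sup>2"])
      (use * V le in auto)
qed

text \<open>An event of \<open>F a\<close> belongs to \<open>F (p j)\<close> for every partition
  point, so its indicator can be absorbed into the coefficient, which is independent of the
  following centred increment.\<close>

lemma simple_ito_integral_centered: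
  fixes \<xi> :: "nat \<Rightarrow> 'w \<Rightarrow> real ^ 'n ^ 'm"
  assumes S: "simple_integrand M F a b m p \<xi>" and ab: "0 \<le> a" "b \<le> T" and B: "B \<in> sets (F a)"
  shows "integrable M (\<lambda>w. indicator B w * simple_ito_integral W m p \<xi> w $ i)"
    and "expectation (\<lambda>w. indicator B w * simple_ito_integral W m p \<xi> w $ i) = 0"
proof -
  note D = simple_integrandD[OF S ab]
  have eq: "(\<lambda>w. indicator B w * simple_ito_integral W m p \<xi> w $ i) =
    (\<lambda>w. \<Sum>j<m. \<Sum>c\<in>UNIV. (indicator B w * \<xi> j w $ i $ c) * (W (p (Suc j)) w - W (p j) w) $ c)"
    by (simp add: simple_ito_integral_def matrix_vector_mult_def sum_distrib_left mult.assoc)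
  have G: "(\<lambda>w. indicator B w * \<xi> j w $ i $ c) \<in> borel_measurable (F (p j))"
    "integrable M (\<lambda>w. indicator B w * \<xi> j w $ i $ c)" if j: "j < m" for j c
  proof -
    have pj: "p j \<in> {0..T}" "a \<le> p j" using D(4) simple_integrand_range[OF S j] j by auto
    have [measurable]: "B \<in> sets (F (p j))" "\<xi> j \<in> borel_measurable (F (p j))"
      using sets_F_mono[of a "p j"] ab pj B D(5)[OF j] by auto
    show m: "(\<lambda>w. indicator B w * \<xi> j w $ i $ c) \<in> borel_measurable (F (p j))"
      by measurable
    obtain C where C: "0 \<le> C" "\<And>w. w \<in> space M \<Longrightarrow> norm (\<xi> j w) \<le> C"
      using bounded_imageD[OF D(6)[OF j]] by blast
    have "norm (indicator B w * \<xi> j w $ i $ c) \<le> C" if "w \<in> space M" for w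
    proof -
      have "\<bar>\<xi> j w $ i $ c\<bar> \<le> norm (\<xi> j w)"
        using component_le_norm_cart[of "\<xi> j w $ i" c] Finite_Cartesian_Product.norm_nth_le[of "\<xi> j w" i]
        by simp
      then show ?thesis
        using C(1) C(2)[OF that] by (auto simp: indicator_def)
    qed
    then show "integrable M (\<lambda>w. indicator B w * \<xi> j w $ i $ c)"
      by (intro integrable_const_bound[of _ C] measurable_F_M[OF pj(1) m]) auto
  qed
  have inc: "0 \<le> p j" "p j \<le> p (Suc j)" "p (Suc j) \<le> T" if "j < m" for j
    using D(3)[OF that] D(4)[of j] D(4)[of "Suc j"] that by auto
  \<comment> \<open>The three facts \<open>inc\<close> and the two facts \<open>G\<close> each carry
    the premise \<open>j < m\<close>; hence the five copies of \<open>that\<close> further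
    down.\<close>
  note * = increment_centered[OF inc G]
  show "integrable M (\<lambda>w. indicator B w * simple_ito_integral W m p \<xi> w $ i)"
    unfolding eq by (intro Bochner_Integration.integrable_sum *(1)) auto
  show "expectation (\<lambda>w. indicator B w * simple_ito_integral W m p \<xi> w $ i) = 0"
  proof -
    let ?g = "\<lambda>j c w. (indicator B w * \<xi> j w $ i $ c) * (W (p (Suc j)) w - W (p j) w) $ c"
    have g: "integrable M (?g j c)" if "j < m" for j c
      by (rule *(1)[OF that that that that that])
    have "expectation (\<lambda>w. \<Sum>c\<in>UNIV. ?g j c w) = 0" if "j < m" for j
    proof -
      have "expectation (\<lambda>w. \<Sum>c\<in>UNIV. ?g j c w) = (\<Sum>c\<in>UNIV. expectation (?g j c))"
        by (rule Bochner_Integration.integral_sum) (rule *(1)[OF that that that that that])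
      also have "\<dots> = 0"
        by (intro sum.neutral ballI) (rule *(2)[OF that that that that that])
      finally show ?thesis .
    qed
    moreover have "expectation (\<lambda>w. \<Sum>j<m. \<Sum>c\<in>UNIV. ?g j c w) = (\<Sum>j<m. expectation (\<lambda>w. \<Sum>c\<in>UNIV. ?g j c w))"
      by (rule Bochner_Integration.integral_sum, rule Bochner_Integration.integrable_sum, rule g) simp
    ultimately show "expectation (\<lambda>w. indicator B w * simple_ito_integral W m p \<xi> w $ i) = 0"
      unfolding eq by simp
  qed
qed

text \<open>Centring on \<open>B\<close> passes from simple integrals to their mean-square limit.
  The first moment of the error is controlled by its square through x \<le> e + x^2 / e, for
  arbitrary positive \<open>e\<close>.\<close>

lemma has_ito_integral_centered:
  fixes H :: "real \<Rightarrow> 'w \<Rightarrow> real ^ 'n ^ 'm"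
  assumes ito: "has_ito_integral M F W a b H J" and ab: "0 \<le> a" "a \<le> b" "b \<le> T"
    and fin: "msq M J < \<infinity>" and B: "B \<in> sets (F a)"
  shows "expectation (\<lambda>w. indicator B w * J w $ i) = 0"
proof -
  note D = has_ito_integralD[OF ito]
  obtain m p \<xi> where S: "\<And>k :: nat. simple_integrand M F a b (m k) (p k) (\<xi> k)"
    and L: "(\<lambda>k. msq M (\<lambda>w. simple_ito_integral W (m k) (p k) (\<xi> k) w - J w)) \<longlonglongrightarrow> 0"
    using D(3) by blast
  have BM: "B \<in> sets M"
    using B subalgebra_F[of a] ab by (auto simp: subalgebra_def)
  have J [measurable]: "J \<in> borel_measurable M" by (rule D(2))
  \<comment> \<open>One \<open>e\<close> is the constant term of that bound; the other is the mean
    square, below \<open>e\<^sup>2\<close>, divided by \<open>e\<close>.\<close>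
  have *: "\<bar>expectation (\<lambda>w. indicator B w * J w $ i)\<bar> \<le> 0 + 2 * e" if e: "0 < e" for e :: real
  proof -
    have "0 < ennreal (e\<^sup>2)" using e by simp
    from eventually_happens'[OF sequentially_bot order_tendstoD(2)[OF L this]]
    obtain k where k: "msq M (\<lambda>w. simple_ito_integral W (m k) (p k) (\<xi> k) w - J w) < ennreal (e\<^sup>2)"
      by blast
    define I where "I = simple_ito_integral W (m k) (p k) (\<xi> k)"
    have Im [measurable]: "I \<in> borel_measurable M"
      unfolding I_def by (rule simple_ito_integral_measurable[OF S ab(1,3)])
    have fin': "msq M (\<lambda>w. I w - J w) < \<infinity>"
      using k unfolding I_def by (rule less_trans) simp
    have sq: "integrable M (\<lambda>w. (norm (I w - J w))\<^sup>2)"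
      by (rule msq_finite_integrable(1)[OF _ fin']) measurable
    have Ji: "integrable M (\<lambda>w. indicator B w * J w $ i)"
    proof (rule Bochner_Integration.integrable_bound[OF msq_finite_integrable(2)[OF J fin]])
      show "AE w in M. norm (indicator B w * J w $ i) \<le> norm (J w)"
        using component_le_norm_cart[of "J _" i] by (auto simp: indicator_def)
    qed (use BM in measurable)
    note Ii = simple_ito_integral_centered[OF S[of k] ab(1,3) B, folded I_def]
    have "expectation (\<lambda>w. (norm (I w - J w))\<^sup>2) < e\<^sup>2"
      using k sq e unfolding I_def[symmetric] msq_def by (simp add: nn_integral_eq_integral ennreal_less_iff)
    then have small: "expectation (\<lambda>w. e + (norm (I w - J w))\<^sup>2 / e) \<le> 2 * e"
      using sq e by (simp add: prob_space power2_eq_square pos_divide_le_eq)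
    have "expectation (\<lambda>w. indicator B w * J w $ i) = expectation (\<lambda>w. indicator B w * J w $ i - indicator B w * I w $ i)"
      using Ji Ii by simp
    also have "\<bar>\<dots>\<bar> \<le> expectation (\<lambda>w. e + (norm (I w - J w))\<^sup>2 / e)"
    proof (rule order.trans[OF integral_abs_bound], rule integral_mono)
      fix w
      have "\<bar>indicator B w * J w $ i - indicator B w * I w $ i\<bar> \<le> norm (I w - J w)"
        using component_le_norm_cart[of "I w - J w" i] by (auto simp: indicator_def)
      also have "\<dots> \<le> e + (norm (I w - J w))\<^sup>2 / e"
      proof -
        have "e * norm (I w - J w) \<le> e\<^sup>2 + (norm (I w - J w))\<^sup>2"
          using sum_squares_bound[of e "norm (I w - J w)"] mult_nonneg_nonneg[OF less_imp_le[OF e] norm_ge_zero[of "I w - J w"]]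
          by linarith
        then show ?thesis
          using e by (simp add: field_simps power2_eq_square)
      qed
      finally show "\<bar>indicator B w * J w $ i - indicator B w * I w $ i\<bar> \<le> e + (norm (I w - J w))\<^sup>2 / e" .
    qed (use Ji Ii sq in auto)
    finally show ?thesis using small by simp
  qed
  have "\<bar>expectation (\<lambda>w. indicator B w * J w $ i)\<bar> \<le> 0"
  proof (rule field_le_epsilon)
    fix e :: real assume "0 < e"
    then show "\<bar>expectation (\<lambda>w. indicator B w * J w $ i)\<bar> \<le> 0 + e"
      using *[of "e / 2"] by simp
  qed
  then show ?thesis by simp
qed

text \<open>Componentwise, a conditional expectation is characterised by its integrals over the
  events of \<open>F t\<close>. On each of them \<open>V - Y\<close>, being a stochastic integral
  from \<open>t\<close> on, has mean zero.\<close>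

lemma vec_cond_exp_eqI:
  fixes V Y :: "'w \<Rightarrow> real ^ 'n"
  assumes t: "t \<in> {0..T}" and Y: "Y \<in> borel_measurable (F t)" and V: "integrable M V"
    and ito: "has_ito_integral M F W t T H (\<lambda>w. V w - Y w)"
    and fin: "msq M (\<lambda>w. V w - Y w) < \<infinity>"
  shows "AE w in M. Y w = vec_cond_exp M (F t) V w"
proof -
  interpret finite_measure_subalgebra M "F t"
    by standard (rule subalgebra_F[OF t])
  have J: "(\<lambda>w. V w - Y w) \<in> borel_measurable M"
    by (rule has_ito_integralD(2)[OF ito])
  have VY: "integrable M (\<lambda>w. V w - Y w)"
    by (rule msq_finite_integrable(2)[OF J fin])
  have Yint: "integrable M Y"
    using Bochner_Integration.integrable_diff[OF V VY] by simp
  have comp: "integrable M (\<lambda>w. X w $ i)" if "integrable M X" for X :: "'w \<Rightarrow> real ^ 'n" and i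
    using integrable_bounded_linear[OF bounded_linear_vec_nth that] .
  have "AE w in M. real_cond_exp M (F t) (\<lambda>w. V w $ i) w = Y w $ i" for i
  proof (rule real_cond_exp_charact)
    fix B assume B: "B \<in> sets (F t)"
    then have BM: "B \<in> sets M"
      using subalg by (auto simp: subalgebra_def)
    have i: "integrable M (\<lambda>w. indicator B w * V w $ i)" "integrable M (\<lambda>w. indicator B w * Y w $ i)"
      using integrable_mult_indicator[OF BM comp[OF V]] integrable_mult_indicator[OF BM comp[OF Yint]] by auto
    have "expectation (\<lambda>w. indicator B w * (V w - Y w) $ i) = 0"
      using has_ito_integral_centered[OF ito _ _ order_refl fin B] t by auto
    then show "(LINT w:B|M. V w $ i) = (LINT w:B|M. Y w $ i)"
      using i by (simp add: set_lebesgue_integral_def right_diff_distrib)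
  qed (use Y comp V Yint in auto)
  then have "AE w in M. \<forall>i\<in>UNIV. real_cond_exp M (F t) (\<lambda>w. V w $ i) w = Y w $ i"
    by (intro AE_finite_allI) auto
  then show ?thesis
    by eventually_elim (simp add: vec_cond_exp_def vec_eq_iff)
qed

end


section \<open>Linear differential equations along a path\<close>

lemma set_integral_Icc_split:
  fixes h :: "real \<Rightarrow> 'b::{banach, second_countable_topology}"
  assumes "set_integrable lborel {a..c} h" "a \<le> b" "b \<le> c"
  shows "(LINT r:{a..c}|lborel. h r) = (LINT r:{a..b}|lborel. h r) + (LINT r:{b..c}|lborel. h r)"
proof -
  have i: "set_integrable lborel {a..b} h" "set_integrable lborel {b<..c} h"
    by (rule set_integrable_subset[OF assms(1)]; use assms in force)+
  have "{a..c} = {a..b} \<union> {b<..c}" using assms by auto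
  moreover have "{a..b} \<inter> {b<..c} = {}" by auto
  ultimately have "(LINT r:{a..c}|lborel. h r) = (LINT r:{a..b}|lborel. h r) + (LINT r:{b<..c}|lborel. h r)"
    using set_integral_Un[OF _ i] by simp
  also have "(LINT r:{b<..c}|lborel. h r) = (LINT r:{b..c}|lborel. h r)"
    unfolding set_lebesgue_integral_def
  proof (rule integral_cong_AE)
    show "(\<lambda>r. indicator {b<..c} r *\<^sub>R h r) \<in> borel_measurable lborel"
      using i(2) unfolding set_integrable_def by (rule borel_measurable_integrable)
    have "set_integrable lborel {b..c} h"
      by (rule set_integrable_subset[OF assms(1)]) (use assms in auto)
    then show "(\<lambda>r. indicator {b..c} r *\<^sub>R h r) \<in> borel_measurable lborel"
      unfolding set_integrable_def by (rule borel_measurable_integrable)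
    show "AE r in lborel. indicator {b<..c} r *\<^sub>R h r = indicator {b..c} r *\<^sub>R h r"
      using AE_lborel_singleton[of b] by eventually_elim (auto simp: indicator_def)
  qed
  finally show ?thesis .
qed

lemma
  fixes h :: "real \<Rightarrow> 'b::{banach, second_countable_topology}"
    and f :: "'b \<Rightarrow> 'c::{banach, second_countable_topology}"
  assumes f: "bounded_linear f" and h: "set_integrable lborel S h"
  shows set_integrable_bounded_linear: "set_integrable lborel S (\<lambda>r. f (h r))"
    and set_integral_bounded_linear: "(LINT r:S|lborel. f (h r)) = f (LINT r:S|lborel. h r)"
proof -
  interpret bounded_linear f by fact
  show "set_integrable lborel S (\<lambda>r. f (h r))"
    using integrable_bounded_linear[OF f] h by (simp add: set_integrable_def scaleR[symmetric])
  show "(LINT r:S|lborel. f (h r)) = f (LINT r:S|lborel. h r)"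
    using integral_bounded_linear[OF f] h
    by (simp add: set_integrable_def set_lebesgue_integral_def scaleR[symmetric])
qed

text \<open>A non-integrable \<open>h\<close> has integral \<open>0\<close> by convention, and
  \<open>g\<close> dominates a norm, hence has nonnegative integral; so the domination alone gives
  the bound.\<close>

lemma norm_set_integral_le:
  fixes h :: "real \<Rightarrow> 'b::{banach, second_countable_topology}"
  assumes g: "set_integrable lborel S g" and S: "S \<in> sets borel"
    and le: "\<And>r. r \<in> S \<Longrightarrow> norm (h r) \<le> g r"
  shows "norm (LINT r:S|lborel. h r) \<le> (LINT r:S|lborel. g r)"
proof (cases "set_integrable lborel S h")
  case True
  then have "norm (LINT r:S|lborel. h r) \<le> (\<integral>r. norm (indicator S r *\<^sub>R h r) \<partial>lborel)"
    unfolding set_lebesgue_integral_def by (intro integral_norm_bound)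
  also have "\<dots> \<le> (LINT r:S|lborel. g r)"
    using True g le unfolding set_lebesgue_integral_def set_integrable_def
    by (intro integral_mono integrable_norm) (auto simp: indicator_def)
  finally show ?thesis .
next
  case False
  have "0 \<le> (LINT r:S|lborel. g r)"
    unfolding set_lebesgue_integral_def using le order.trans[OF norm_ge_zero le]
    by (intro Bochner_Integration.integral_nonneg_AE) (auto simp: indicator_def)
  then show ?thesis
    using False by (simp add: set_integrable_def set_lebesgue_integral_def not_integrable_integral_eq)
qed

lemma norm_set_integral_Icc_le:
  fixes h :: "real \<Rightarrow> 'b::{banach, second_countable_topology}"
  assumes "a \<le> b" "\<And>r. r \<in> {a..b} \<Longrightarrow> norm (h r) \<le> C"
  shows "norm (LINT r:{a..b}|lborel. h r) \<le> C * (b - a)"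
  using norm_set_integral_le[of "{a..b}" "\<lambda>_. C" h] assms
  by (simp add: set_integrable_def set_lebesgue_integral_def mult.commute)

text \<open>The rate of the weight is twice the bound \<open>K\<close> of the linear coefficient, so
  integrating \<open>K\<close> times the weight gains the factor 1/2. This is the contraction behind
  the Picard iteration below.\<close>

lemma norm_set_integral_exp_le:
  fixes h :: "real \<Rightarrow> 'b::{banach, second_countable_topology}"
  assumes "0 \<le> s" "\<And>r. r \<in> {0..s} \<Longrightarrow> norm (h r) \<le> K * (C * exp (2 * K * r))"
  shows "norm (LINT r:{0..s}|lborel. h r) \<le> C / 2 * (exp (2 * K * s) - 1)"
proof -
  have *: "has_bochner_integral lborel (\<lambda>r. indicator {0..s} r *\<^sub>R (K * (C * exp (2 * K * r))))
      (C / 2 * exp (2 * K * s) - C / 2 * exp (2 * K * 0))"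
    using assms(1)
    by (intro has_bochner_integral_FTC_Icc) (auto intro!: derivative_eq_intros continuous_intros
      simp: has_real_derivative_iff_has_vector_derivative[symmetric])
  have "set_integrable lborel {0..s} (\<lambda>r. K * (C * exp (2 * K * r)))"
    unfolding set_integrable_def by (rule integrable.intros[OF *])
  moreover have "(LINT r:{0..s}|lborel. K * (C * exp (2 * K * r))) = C / 2 * (exp (2 * K * s) - 1)"
    unfolding set_lebesgue_integral_def has_bochner_integral_integral_eq[OF *]
    by (simp add: right_diff_distrib)
  moreover note norm_set_integral_le[of "{0..s}" "\<lambda>r. K * (C * exp (2 * K * r))" h, OF _ _ assms(2)]
  ultimately show ?thesis by (simp only: atLeastAtMost_borel)
qed

text \<open>Quadratically small increments force a zero derivative at every point of the interval.
  This replaces the product rule for solutions that need not be differentiable at every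
  time.\<close>

lemma quadratic_increment_constant:
  fixes G :: "real \<Rightarrow> 'b::real_normed_vector"
  assumes le: "\<And>s t. 0 \<le> s \<Longrightarrow> s \<le> t \<Longrightarrow> t \<le> T \<Longrightarrow> norm (G t - G s) \<le> C * (t - s)\<^sup>2"
    and t: "t \<in> {0..T}"
  shows "G t = G 0"
proof -
  have le': "norm (G y - G x) \<le> C * (y - x)\<^sup>2" if "x \<in> {0..T}" "y \<in> {0..T}" for x y
    using le[of x y] le[of y x] that by (cases "x \<le> y") (auto simp: norm_minus_commute power2_commute)
  have "(G has_derivative (\<lambda>h. 0)) (at x within {0..T})" if x: "x \<in> {0..T}" for x
  proof (rule has_derivativeI_sandwich[of 1])
    fix y assume y: "y \<in> {0..T}" "y \<noteq> x"
    have "norm (G y - G x) / norm (y - x) \<le> C * (y - x)\<^sup>2 / norm (y - x)"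
      by (intro divide_right_mono le' x y) auto
    also have "\<dots> = C * \<bar>y - x\<bar>"
    proof -
      have "(y - x)\<^sup>2 = \<bar>y - x\<bar> * \<bar>y - x\<bar>" by (simp add: power2_eq_square)
      then show ?thesis using y by (simp del: abs_mult_self_eq)
    qed
    finally show "norm (G y - G x - 0) / norm (y - x) \<le> C * \<bar>y - x\<bar>" by simp
  next
    show "((\<lambda>y. C * \<bar>y - x\<bar>) \<longlongrightarrow> 0) (at x within {0..T})"
      by (auto intro!: tendsto_eq_intros)
  qed auto
  then show ?thesis
    using has_derivative_zero_constant[of "{0..T}" G] t by (metis atLeastAtMost_iff convex_real_interval(5) order.trans order_refl)
qed

text \<open>Integrability of the velocity is part of the notion of solution, and the integral of its
  norm bounds the distance from \<open>y 0\<close>. The constant depends on the particular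
  path.\<close>

lemma ode_solution_bounded:
  assumes y: "ode_solution T v y"
  obtains D where "0 \<le> D" "\<And>t. t \<in> {0..T} \<Longrightarrow> norm (y t) \<le> D"
proof -
  have i: "set_integrable lborel {0..T} (\<lambda>s. norm (v s (y s)))"
    using y by (auto simp: ode_solution_def set_integrable_def dest: integrable_norm)
  have "norm (y t) \<le> norm (y 0) + (LINT s:{0..T}|lborel. norm (v s (y s)))" if t: "t \<in> {0..T}" for t
  proof -
    have it: "set_integrable lborel {0..t} (\<lambda>s. norm (v s (y s)))"
      by (rule set_integrable_subset[OF i]) (use t in auto)
    have "norm (y t) \<le> norm (y 0) + norm (LINT s:{0..t}|lborel. v s (y s))"
      using y t norm_triangle_ineq by (metis ode_solution_def)
    also have "norm (LINT s:{0..t}|lborel. v s (y s)) \<le> (LINT s:{0..t}|lborel. norm (v s (y s)))"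
      by (rule norm_set_integral_le[OF it]) auto
    also have "\<dots> \<le> (LINT s:{0..T}|lborel. norm (v s (y s)))"
      using i it t unfolding set_integrable_def set_lebesgue_integral_def
      by (intro integral_mono) (auto simp: indicator_def)
    finally show ?thesis by simp
  qed
  then show ?thesis
    using that[of "max 0 (norm (y 0) + (LINT s:{0..T}|lborel. norm (v s (y s))))"] by fastforce
qed

lemma ode_solution_increment:
  assumes y: "ode_solution T v y" and st: "0 \<le> s" "s \<le> t" "t \<le> T"
  shows "set_integrable lborel {s..t} (\<lambda>r. v r (y r))" "y t - y s = (LINT r:{s..t}|lborel. v r (y r))"
proof -
  have i: "set_integrable lborel {0..T} (\<lambda>r. v r (y r))"
    using y by (auto simp: ode_solution_def)
  show "set_integrable lborel {s..t} (\<lambda>r. v r (y r))"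
    by (rule set_integrable_subset[OF i]) (use st in auto)
  have it: "set_integrable lborel {0..t} (\<lambda>r. v r (y r))"
    by (rule set_integrable_subset[OF i]) (use st in auto)
  have *: "y q = y 0 + (LINT r:{0..q}|lborel. v r (y r))" if "q \<in> {0..T}" for q
    using y that unfolding ode_solution_def by blast
  have "y t - y s = (y 0 + (LINT r:{0..t}|lborel. v r (y r))) - (y 0 + (LINT r:{0..s}|lborel. v r (y r)))"
    by (rule arg_cong2[where f = minus]) (rule *, use st in simp)+
  then show "y t - y s = (LINT r:{s..t}|lborel. v r (y r))"
    using set_integral_Icc_split[OF it st(1,2)] by simp
qed

lemma ode_solution_increment_le:
  assumes y: "ode_solution T v y" and st: "0 \<le> s" "s \<le> t" "t \<le> T"
    and le: "\<And>r. r \<in> {s..t} \<Longrightarrow> norm (v r (y r)) \<le> C"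
  shows "norm (y t - y s) \<le> C * (t - s)"
  unfolding ode_solution_increment(2)[OF y st] by (rule norm_set_integral_Icc_le[OF st(2) le])

text \<open>Formally the derivative is \<open>\<Psi> a y - \<Psi> a y = 0\<close>. As
  \<open>a\<close> may be irregular in time, the cancellation is carried out on the increment over
  \<open>{u..v}\<close>, which is of order \<open>(v - u)\<^sup>2\<close>. The abstract
  \<open>mul\<close> covers the action on vectors, for the adjoint, and on matrices, for
  \<open>\<Phi>\<close>.\<close>

lemma adjoint_product_constant:
  fixes a :: "real \<Rightarrow> real ^ 'n ^ 'n" and mul :: "real ^ 'n ^ 'n \<Rightarrow> 'b::euclidean_space \<Rightarrow> 'b"
  assumes mul: "bounded_bilinear mul" and mul_le: "\<And>P y. norm (mul P y) \<le> norm P * norm y"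
    and assoc: "\<And>P A y. mul (P ** A) y = mul P (mul A y)"
    and \<Psi>: "ode_solution T (\<lambda>s P. P ** a s) \<Psi>"
    and y: "ode_solution T (\<lambda>s z. - mul (a s) z) y"
    and a: "\<And>s. s \<in> {0..T} \<Longrightarrow> norm (a s) \<le> K"
    and t: "t \<in> {0..T}"
  shows "mul (\<Psi> t) (y t) = mul (\<Psi> 0) (y 0)"
proof -
  interpret bounded_bilinear mul by fact
  obtain D where D: "0 \<le> D" "\<And>t. t \<in> {0..T} \<Longrightarrow> norm (\<Psi> t) \<le> D"
    using ode_solution_bounded[OF \<Psi>] by blast
  obtain E where E: "0 \<le> E" "\<And>t. t \<in> {0..T} \<Longrightarrow> norm (y t) \<le> E"
    using ode_solution_bounded[OF y] by blast
  have K: "0 \<le> K"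
    using a[OF t] norm_ge_zero order.trans by blast
  have \<Psi>a: "norm (\<Psi> r ** a r) \<le> D * K" if "r \<in> {0..T}" for r
    using order.trans[OF norm_matrix_matrix_mult_le mult_mono[OF D(2) a]] that D(1) by auto
  have ya: "norm (mul (a r) (y r)) \<le> K * E" if "r \<in> {0..T}" for r
    using order.trans[OF mul_le mult_mono[OF a E(2)]] that K by auto
  have "norm (mul (\<Psi> v) (y v) - mul (\<Psi> u) (y u)) \<le> 2 * (D * K * (K * E)) * (v - u)\<^sup>2"
    if uv: "0 \<le> u" "u \<le> v" "v \<le> T" for u v
  proof -
    note i\<Psi> = ode_solution_increment[OF \<Psi> uv] and iy = ode_solution_increment[OF y uv]
    have l1: "bounded_linear (\<lambda>P. mul P (y v))" and l2: "bounded_linear (mul (\<Psi> u))"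
      by (rule bounded_linear_left bounded_linear_right)+
    have "mul (\<Psi> v) (y v) - mul (\<Psi> u) (y u) = mul (\<Psi> v - \<Psi> u) (y v) + mul (\<Psi> u) (y v - y u)"
      by (simp add: diff_left diff_right)
    also have "\<dots> = (LINT r:{u..v}|lborel. mul (\<Psi> r ** a r) (y v)) + (LINT r:{u..v}|lborel. mul (\<Psi> u) (- mul (a r) (y r)))"
      unfolding i\<Psi>(2) iy(2) set_integral_bounded_linear[OF l1 i\<Psi>(1)] set_integral_bounded_linear[OF l2 iy(1)] ..
    also have "\<dots> = (LINT r:{u..v}|lborel. mul (\<Psi> r ** a r) (y v) + mul (\<Psi> u) (- mul (a r) (y r)))"
      by (rule set_integral_add(2)[symmetric])
        (rule set_integrable_bounded_linear[OF l1 i\<Psi>(1)] set_integrable_bounded_linear[OF l2 iy(1)])+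
    also have "norm \<dots> \<le> (2 * (D * K * (K * E)) * (v - u)) * (v - u)"
    proof (rule norm_set_integral_Icc_le[OF uv(2)])
      fix r assume r: "r \<in> {u..v}"
      \<comment> \<open>With all factors taken at time \<open>r\<close> the two terms cancel; what
        remains is one time increment of \<open>y\<close> and one of \<open>\<Psi>\<close>, each at
        most linear in \<open>v - u\<close>.\<close>
      have "mul (\<Psi> r ** a r) (y v) + mul (\<Psi> u) (- mul (a r) (y r)) =
         mul (\<Psi> r ** a r) (y v - y r) + mul (\<Psi> r - \<Psi> u) (mul (a r) (y r))"
        by (simp add: assoc diff_left diff_right minus_right)
      also have "norm \<dots> \<le> norm (mul (\<Psi> r ** a r) (y v - y r)) + norm (mul (\<Psi> r - \<Psi> u) (mul (a r) (y r)))"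
        by (rule norm_triangle_ineq)
      also have "\<dots> \<le> (D * K) * (K * E * (v - u)) + (D * K * (v - u)) * (K * E)"
      proof (rule add_mono; rule order.trans[OF mul_le], rule mult_mono)
        show "norm (\<Psi> r ** a r) \<le> D * K" "norm (mul (a r) (y r)) \<le> K * E"
          using r uv \<Psi>a ya by auto
        have "norm (y v - y r) \<le> K * E * (v - r)"
          using r uv ya by (intro ode_solution_increment_le[OF y]) auto
        also have "\<dots> \<le> K * E * (v - u)"
          using r K E(1) by (intro mult_left_mono) auto
        finally show "norm (y v - y r) \<le> K * E * (v - u)" .
        have "norm (\<Psi> r - \<Psi> u) \<le> D * K * (r - u)"
          using r uv \<Psi>a by (intro ode_solution_increment_le[OF \<Psi>]) auto
        also have "\<dots> \<le> D * K * (v - u)"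
          using r K D(1) by (intro mult_left_mono) auto
        finally show "norm (\<Psi> r - \<Psi> u) \<le> D * K * (v - u)" .
      qed (use K D(1) uv in auto)
      finally show "norm (mul (\<Psi> r ** a r) (y v) + mul (\<Psi> u) (- mul (a r) (y r))) \<le> 2 * (D * K * (K * E)) * (v - u)"
        by (simp add: algebra_simps)
    qed
    finally show ?thesis by (simp add: power2_eq_square mult.assoc)
  qed
  then show ?thesis
    by (rule quadratic_increment_constant[OF _ t])
qed

text \<open>The variable upper limit is moved into an indicator, which makes this a parametric
  integral over the fixed interval \<open>{0..u}\<close>. With \<open>N = F u\<close> it says that
  integrals of progressive processes are progressive.\<close>

lemma set_integral_parametric_measurable:
  fixes h :: "real \<Rightarrow> 'w \<Rightarrow> 'b::euclidean_space"
  assumes h: "(\<lambda>(s, w). h s w) \<in> borel_measurable (restrict_space borel {0..u} \<Otimes>\<^sub>M N)"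
  shows "(\<lambda>(s, w). LINT r:{0..s}|lborel. h r w) \<in> borel_measurable (restrict_space borel {0..u} \<Otimes>\<^sub>M N)"
proof -
  interpret L: sigma_finite_measure "restrict_space lborel {0..u}" by (rule sigma_finite_restrict_lborel)
  let ?R = "restrict_space borel {0..u}"
  let ?Q = "(?R \<Otimes>\<^sub>M N) \<Otimes>\<^sub>M ?R"
  have id: "(\<lambda>x. x) \<in> borel_measurable ?R"
    by (rule measurable_restrict_space1) simp
  have 1: "(\<lambda>x. fst (fst x)) \<in> borel_measurable ?Q"
    using measurable_compose[OF measurable_compose[OF measurable_fst[of "?R \<Otimes>\<^sub>M N" ?R] measurable_fst[of ?R N]] id]
    by simp
  have 2: "(\<lambda>x. snd x) \<in> borel_measurable ?Q"
    using measurable_compose[OF measurable_snd[of "?R \<Otimes>\<^sub>M N" ?R] id] by simp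
  have "(\<lambda>x. (snd x, snd (fst x))) \<in> ?Q \<rightarrow>\<^sub>M ?R \<Otimes>\<^sub>M N"
    by measurable
  from measurable_compose[OF this h]
  have 3: "(\<lambda>x. h (snd x) (snd (fst x))) \<in> borel_measurable ?Q"
    by simp
  have "(\<lambda>x. indicator {0..fst (fst x)} (snd x) *\<^sub>R h (snd x) (snd (fst x))) \<in> borel_measurable ?Q"
  proof -
    have "Measurable.pred ?Q (\<lambda>x. snd x \<in> {0..fst (fst x)})"
      using 1 2 by simp
    then have "(\<lambda>x. indicator {0..fst (fst x)} (snd x) :: real) \<in> borel_measurable ?Q"
      unfolding indicator_def by measurable
    then show ?thesis using 3 by (rule borel_measurable_scaleR)
  qed
  moreover have "sets ((?R \<Otimes>\<^sub>M N) \<Otimes>\<^sub>M restrict_space lborel {0..u}) = sets ?Q"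
    by (intro sets_pair_measure_cong sets_restrict_space_cong) auto
  ultimately have "(\<lambda>x. indicator {0..fst (fst x)} (snd x) *\<^sub>R h (snd x) (snd (fst x)))
      \<in> borel_measurable ((?R \<Otimes>\<^sub>M N) \<Otimes>\<^sub>M restrict_space lborel {0..u})"
    by (simp cong: measurable_cong_sets)
  then have "(\<lambda>x. \<integral>r. indicator {0..fst x} r *\<^sub>R h r (snd x) \<partial>restrict_space lborel {0..u}) \<in> borel_measurable (?R \<Otimes>\<^sub>M N)"
    by (intro L.borel_measurable_lebesgue_integral) (simp add: split_beta')
  moreover have "(LINT r:{0..s}|lborel. h r w) = (\<integral>r. indicator {0..s} r *\<^sub>R h r w \<partial>restrict_space lborel {0..u})"
    if "s \<in> {0..u}" for s w
    unfolding set_lebesgue_integral_def using that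
    by (subst integral_restrict_space) (auto simp: indicator_def intro!: Bochner_Integration.integral_cong)
  ultimately show ?thesis
    by (subst measurable_cong[where g = "\<lambda>x. \<integral>r. indicator {0..fst x} r *\<^sub>R h r (snd x) \<partial>restrict_space lborel {0..u}"])
      (auto simp: space_pair_measure space_restrict_space)
qed

text \<open>The iterates of Picard are progressively measurable, and in the weight \<open>exp (- 2 K s)\<close> each
  step halves the distance to the solution.\<close>

lemma
  fixes P a :: "real \<Rightarrow> 'w \<Rightarrow> real ^ 'n ^ 'n"
  assumes a: "(\<lambda>(s, w). a s w) \<in> borel_measurable (restrict_space borel {0..u} \<Otimes>\<^sub>M N)"
    and K: "\<And>s w. s \<in> {0..u} \<Longrightarrow> w \<in> space N \<Longrightarrow> norm (a s w) \<le> K"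
    and ode: "\<And>w. w \<in> space N \<Longrightarrow> ode_solution T (\<lambda>s P. P ** a s w) (\<lambda>s. P s w)"
    and init: "\<And>w. w \<in> space N \<Longrightarrow> P 0 w = mat 1" and u: "u \<le> T"
  shows linear_ode_measurable: "(\<lambda>(s, w). P s w) \<in> borel_measurable (restrict_space borel {0..u} \<Otimes>\<^sub>M N)"
    and linear_ode_bound: "\<And>s w. s \<in> {0..u} \<Longrightarrow> w \<in> space N \<Longrightarrow>
      norm (P s w) \<le> norm (mat 1 :: real ^ 'n ^ 'n) * exp (2 * K * s)"
proof -
  define c where "c = norm (mat 1 :: real ^ 'n ^ 'n)"
  define Q where "Q = rec_nat (\<lambda>s w. mat 1 :: real ^ 'n ^ 'n) (\<lambda>_ q s w. mat 1 + (LINT r:{0..s}|lborel. q r w ** a r w))"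
  have Q0: "Q 0 = (\<lambda>s w. mat 1)" and QS: "Q (Suc n) = (\<lambda>s w. mat 1 + (LINT r:{0..s}|lborel. Q n r w ** a r w))" for n
    by (auto simp: Q_def)
  let ?R = "restrict_space borel {0..u} \<Otimes>\<^sub>M N"
  have Qm: "(\<lambda>(s, w). Q n s w) \<in> borel_measurable ?R" for n
  proof (induction n)
    case (Suc n)
    have "(\<lambda>(s, w). Q n s w ** a s w) \<in> borel_measurable ?R"
      using borel_measurable_matrix_matrix_mult[OF Suc a] by (simp add: split_beta')
    from set_integral_parametric_measurable[OF this] show ?case
      by (simp add: QS split_beta')
  qed (simp add: Q0)
  \<comment> \<open>Being uniform in \<open>n\<close>, this bound survives the limit and becomes
    \<open>linear_ode_bound\<close>.\<close>
  have Qb: "norm (Q n s w) \<le> c * exp (2 * K * s)" if "s \<in> {0..u}" "w \<in> space N" for n s w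
    using that(1)
  proof (induction n arbitrary: s)
    case 0
    have "0 \<le> K" using order.trans[OF norm_ge_zero K[OF 0 that(2)]] .
    then have "c * 1 \<le> c * exp (2 * K * s)"
      using 0 by (intro mult_left_mono) (auto simp: c_def)
    then show ?case by (simp add: Q0 c_def)
  next
    case (Suc n)
    have K0: "0 \<le> K" using order.trans[OF norm_ge_zero K[OF Suc(2) that(2)]] .
    have "norm (Q n r w ** a r w) \<le> K * (c * exp (2 * K * r))" if r: "r \<in> {0..s}" for r
    proof -
      have r': "r \<in> {0..u}" using r Suc(2) by auto
      have "norm (Q n r w ** a r w) \<le> norm (Q n r w) * norm (a r w)"
        by (rule norm_matrix_matrix_mult_le)
      also have "\<dots> \<le> (c * exp (2 * K * r)) * K"
        by (intro mult_mono Suc.IH[OF r'] K[OF r' \<open>w \<in> space N\<close>]) (auto simp: c_def)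
      finally show ?thesis by (simp add: mult_ac)
    qed
    then have "norm (Q (Suc n) s w) \<le> c + c / 2 * (exp (2 * K * s) - 1)"
      using norm_set_integral_exp_le[of s "\<lambda>r. Q n r w ** a r w" K c] Suc(2)
      by (auto simp: QS c_def intro!: order.trans[OF norm_triangle_ineq])
    also have "\<dots> \<le> c * exp (2 * K * s)"
    proof -
      have "c * 1 \<le> c * exp (2 * K * s)"
        using K0 Suc(2) by (intro mult_left_mono) (auto simp: c_def)
      then show ?thesis by (simp add: field_simps)
    qed
    finally show ?case .
  qed
  have lim: "(\<lambda>n. Q n s w) \<longlonglongrightarrow> P s w" if s: "s \<in> {0..u}" and w: "w \<in> space N" for s w
  proof -
    note sol = ode[OF w]
    obtain D where D: "0 \<le> D" "\<And>t. t \<in> {0..T} \<Longrightarrow> norm (P t w) \<le> D"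
      using ode_solution_bounded[OF sol] by blast
    have K0: "0 \<le> K" using order.trans[OF norm_ge_zero K[OF s w]] .
    have am: "(\<lambda>r. a r w) \<in> borel_measurable (restrict_space borel {0..u})"
      using measurable_Pair1[OF a w] by simp
    have Qam: "(\<lambda>r. Q n r w ** a r w) \<in> borel_measurable (restrict_space borel {0..u})" for n
      using measurable_Pair1[OF Qm w, of n] am by simp
    have Qai: "set_integrable lborel {0..t} (\<lambda>r. Q n r w ** a r w)" if t: "t \<in> {0..u}" for n t
    proof -
      have "set_integrable lborel {0..u} (\<lambda>r. Q n r w ** a r w)"
        unfolding set_integrable_def
      proof (rule integrableI_bounded_set[of "{0..u}" _ _ "c * exp (2 * K * u) * K"])
        show "(\<lambda>r. indicator {0..u} r *\<^sub>R (Q n r w ** a r w)) \<in> borel_measurable lborel"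
          using Qam[of n] by (simp add: borel_measurable_restrict_space_iff)
        have "norm (Q n r w ** a r w) \<le> c * exp (2 * K * u) * K" if r: "r \<in> {0..u}" for r
        proof -
          have "norm (Q n r w) \<le> c * exp (2 * K * r)" by (rule Qb[OF r w])
          also have "\<dots> \<le> c * exp (2 * K * u)"
            using r K0 by (intro mult_left_mono) (auto simp: c_def mult_left_mono)
          finally show ?thesis
            using K[OF r w] by (intro order.trans[OF norm_matrix_matrix_mult_le] mult_mono) (auto simp: c_def)
        qed
        then show "AE r in lborel. r \<in> {0..u} \<longrightarrow> norm (indicator {0..u} r *\<^sub>R (Q n r w ** a r w)) \<le> c * exp (2 * K * u) * K"
          by auto
      qed (auto simp: emeasure_lborel_Icc_eq)
      then show ?thesis
        by (rule set_integrable_subset) (use t in auto)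
    qed
    \<comment> \<open>The initial distance is at most \<open>c + D\<close>, from the norm of
      \<open>mat 1\<close> and the pathwise bound \<open>D\<close> of the solution. As
      \<open>D\<close> depends on the outcome, it may enter the convergence but not the final
      bound.\<close>
    have "norm (Q n t w - P t w) \<le> (c + D) / 2 ^ n * exp (2 * K * t)" if "t \<in> {0..u}" for n t
      using that
    proof (induction n arbitrary: t)
      case 0
      have "norm (Q 0 t w - P t w) \<le> (c + D) * 1"
        using D(2)[of t] 0 u by (auto simp: Q0 c_def intro!: order.trans[OF norm_triangle_ineq4])
      also have "\<dots> \<le> (c + D) * exp (2 * K * t)"
        using 0 K0 D(1) by (intro mult_left_mono) (auto simp: c_def)
      finally show ?case by simp
    next
      case (Suc n)
      have t: "t \<in> {0..u}" by fact
      have Pi: "set_integrable lborel {0..t} (\<lambda>r. P r w ** a r w)" and Pe: "P t w - P 0 w = (LINT r:{0..t}|lborel. P r w ** a r w)"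
        using ode_solution_increment[OF sol, of 0 t] t u by auto
      have "Q (Suc n) t w - P t w = (LINT r:{0..t}|lborel. Q n r w ** a r w) - (LINT r:{0..t}|lborel. P r w ** a r w)"
        using Pe init[OF w] by (simp add: QS algebra_simps)
      also have "\<dots> = (LINT r:{0..t}|lborel. (Q n r w - P r w) ** a r w)"
        by (subst set_integral_diff(2)[symmetric, OF Qai[OF t] Pi])
          (simp add: bounded_bilinear.diff_left[OF bounded_bilinear_matrix_matrix_mult])
      also have "norm \<dots> \<le> (c + D) / 2 ^ n / 2 * (exp (2 * K * t) - 1)"
      proof (rule norm_set_integral_exp_le)
        fix r assume "r \<in> {0..t}"
        then have r: "r \<in> {0..u}" using t by auto
        have "norm ((Q n r w - P r w) ** a r w) \<le> ((c + D) / 2 ^ n * exp (2 * K * r)) * K"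
          using D(1)
          by (intro order.trans[OF norm_matrix_matrix_mult_le] mult_mono Suc.IH[OF r] K[OF r w]) (auto simp: c_def)
        then show "norm ((Q n r w - P r w) ** a r w) \<le> K * ((c + D) / 2 ^ n * exp (2 * K * r))"
          by (simp add: mult_ac)
      qed (use t in auto)
      also have "\<dots> \<le> (c + D) / 2 ^ Suc n * exp (2 * K * t)"
        using D(1) by (simp add: c_def field_simps)
      finally show ?case .
    qed
    note close = this[OF s]
    have vanish: "(\<lambda>n. (c + D) / 2 ^ n * exp (2 * K * s)) \<longlonglongrightarrow> 0"
    proof -
      have "(\<lambda>n. (c + D) * (1 / 2) ^ n * exp (2 * K * s)) \<longlonglongrightarrow> (c + D) * 0 * exp (2 * K * s)"
        by (intro tendsto_intros LIMSEQ_realpow_zero) auto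
      then show ?thesis by (simp add: power_divide)
    qed
    have "(\<lambda>n. Q n s w - P s w) \<longlonglongrightarrow> 0"
      by (rule Lim_null_comparison[OF always_eventually[OF allI[OF close]] vanish])
    then show ?thesis by (rule LIM_zero_cancel)
  qed
  show "(\<lambda>(s, w). P s w) \<in> borel_measurable ?R"
  proof (rule borel_measurable_LIMSEQ_metric[OF Qm])
    fix x assume "x \<in> space ?R"
    then have "fst x \<in> {0..u}" "snd x \<in> space N"
      by (auto simp: space_pair_measure space_restrict_space)
    from lim[OF this] show "(\<lambda>n. case x of (s, w) \<Rightarrow> Q n s w) \<longlonglongrightarrow> (case x of (s, w) \<Rightarrow> P s w)"
      by (simp add: case_prod_beta)
  qed
  show "norm (P s w) \<le> norm (mat 1 :: real ^ 'n ^ 'n) * exp (2 * K * s)" if "s \<in> {0..u}" "w \<in> space N" for s w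
    unfolding c_def[symmetric]
    by (rule LIMSEQ_le_const2[OF tendsto_norm[OF lim[OF that]]], rule exI, rule allI, rule impI, rule Qb[OF that])
qed


section \<open>Stability of the backward equation under time discretization\<close>

lemma measurable_pair_coarser:
  assumes V: "(\<lambda>(s, w). V s w) \<in> measurable (A \<Otimes>\<^sub>M B) L"
    and f: "(\<lambda>x. x) \<in> measurable A' A" and g: "(\<lambda>x. x) \<in> measurable B' B"
  shows "(\<lambda>(s, w). V s w) \<in> measurable (A' \<Otimes>\<^sub>M B') L"
proof -
  have "(\<lambda>x. (fst x, snd x)) \<in> measurable (A' \<Otimes>\<^sub>M B') (A \<Otimes>\<^sub>M B)"
    by (intro measurable_Pair measurable_compose[OF measurable_fst f] measurable_compose[OF measurable_snd g])
  from measurable_compose[OF this V] show ?thesis by (simp add: split_beta')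
qed

lemma measurable_restrict_interval:
  assumes "a \<le> a'" "b' \<le> (b :: real)"
  shows "(\<lambda>x. x) \<in> measurable (restrict_space borel {a'..b'}) (restrict_space borel {a..b})"
  by (rule measurable_restrict_space2) (use assms in \<open>auto simp: space_restrict_space intro: measurable_restrict_space1\<close>)

lemma measurable_restrict_interval_mono:
  assumes "(\<lambda>(s, w). V s w) \<in> measurable (restrict_space borel {a..b :: real} \<Otimes>\<^sub>M N) L" "a \<le> a'" "b' \<le> b"
  shows "(\<lambda>(s, w). V s w) \<in> measurable (restrict_space borel {a'..b'} \<Otimes>\<^sub>M N) L"
  by (rule measurable_pair_coarser[OF assms(1) measurable_restrict_interval[OF assms(2,3)]]) simp

lemma energy_inner_measurable:
  fixes V :: "real \<Rightarrow> 'w \<Rightarrow> 'b::real_normed_vector"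
  assumes "(\<lambda>(s, w). V s w) \<in> borel_measurable (restrict_space borel {a..b} \<Otimes>\<^sub>M M)"
  shows "(\<lambda>w. \<integral>\<^sup>+s\<in>{a..b}. ennreal ((norm (V s w))\<^sup>2) \<partial>lborel) \<in> borel_measurable M"
proof -
  interpret L: sigma_finite_measure "restrict_space lborel {a..b}" by (rule sigma_finite_restrict_lborel)
  have 1: "(\<lambda>x. V (snd x) (fst x)) \<in> borel_measurable (M \<Otimes>\<^sub>M restrict_space borel {a..b})"
    using measurable_compose[OF measurable_pair_swap' assms] by (simp add: split_beta')
  have "sets (M \<Otimes>\<^sub>M restrict_space lborel {a..b}) = sets (M \<Otimes>\<^sub>M restrict_space borel {a..b})"
    by (intro sets_pair_measure_cong sets_restrict_space_cong) auto
  then have [measurable]: "(\<lambda>x. V (snd x) (fst x)) \<in> borel_measurable (M \<Otimes>\<^sub>M restrict_space lborel {a..b})"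
    using 1 by (simp cong: measurable_cong_sets)
  have "(\<lambda>w. \<integral>\<^sup>+s. ennreal ((norm (V s w))\<^sup>2) \<partial>restrict_space lborel {a..b}) \<in> borel_measurable M"
    by (intro L.borel_measurable_nn_integral) (simp add: split_beta')
  then show ?thesis by (simp add: nn_integral_restrict_space)
qed

lemma energy_section_measurable:
  fixes V :: "real \<Rightarrow> 'w \<Rightarrow> 'b::real_normed_vector"
  assumes "(\<lambda>(s, w). V s w) \<in> borel_measurable (restrict_space borel {a..b} \<Otimes>\<^sub>M M)" "w \<in> space M"
  shows "(\<lambda>s. indicator {a..b} s *\<^sub>R V s w) \<in> borel_measurable borel"
  using measurable_Pair1[OF assms] by (simp add: borel_measurable_restrict_space_iff)

lemma mean_square_energy_split:
  fixes V :: "real \<Rightarrow> 'w \<Rightarrow> 'b::real_normed_vector"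
  assumes V: "(\<lambda>(s, w). V s w) \<in> borel_measurable (restrict_space borel {a..c} \<Otimes>\<^sub>M M)"
    and ab: "a \<le> b" "b \<le> c"
  shows "mean_square_energy M a b V + mean_square_energy M b c V = mean_square_energy M a c V"
proof -
  have V1: "(\<lambda>(s, w). V s w) \<in> borel_measurable (restrict_space borel {a..b} \<Otimes>\<^sub>M M)"
    and V2: "(\<lambda>(s, w). V s w) \<in> borel_measurable (restrict_space borel {b..c} \<Otimes>\<^sub>M M)"
    using measurable_restrict_interval_mono[OF V] ab by auto
  have "(\<integral>\<^sup>+s\<in>{a..b}. ennreal ((norm (V s w))\<^sup>2) \<partial>lborel) + (\<integral>\<^sup>+s\<in>{b..c}. ennreal ((norm (V s w))\<^sup>2) \<partial>lborel) =
      (\<integral>\<^sup>+s\<in>{a..c}. ennreal ((norm (V s w))\<^sup>2) \<partial>lborel)" if w: "w \<in> space M" for w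
  proof -
    have m: "(\<lambda>s. ennreal ((norm (V s w))\<^sup>2) * indicator {p..q} s) \<in> borel_measurable lborel"
      if "(\<lambda>(s, w). V s w) \<in> borel_measurable (restrict_space borel {p..q} \<Otimes>\<^sub>M M)" for p q
    proof -
      have [measurable]: "(\<lambda>s. indicator {p..q} s *\<^sub>R V s w) \<in> borel_measurable borel"
        by (rule energy_section_measurable[OF that w])
      have "(\<lambda>s. ennreal ((norm (indicator {p..q} s *\<^sub>R V s w))\<^sup>2)) \<in> borel_measurable lborel"
        by measurable
      also have "(\<lambda>s. ennreal ((norm (indicator {p..q} s *\<^sub>R V s w))\<^sup>2)) = (\<lambda>s. ennreal ((norm (V s w))\<^sup>2) * indicator {p..q} s)"
        by (auto simp: indicator_def)
      finally show ?thesis .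
    qed
    show ?thesis
      unfolding nn_integral_add[OF m[OF V1] m[OF V2], symmetric]
    proof (rule nn_integral_cong_AE)
      show "AE s in lborel. ennreal ((norm (V s w))\<^sup>2) * indicator {a..b} s + ennreal ((norm (V s w))\<^sup>2) * indicator {b..c} s =
          ennreal ((norm (V s w))\<^sup>2) * indicator {a..c} s"
        using AE_lborel_singleton[of b] by eventually_elim (use ab in \<open>auto simp: indicator_def\<close>)
    qed
  qed
  then show ?thesis
    unfolding mean_square_energy_def
    by (subst nn_integral_add[OF energy_inner_measurable[OF V1] energy_inner_measurable[OF V2], symmetric])
      (auto intro: nn_integral_cong)
qed

text \<open>Cauchy-Schwarz against the indicator of the interval, whose square integrates to
  \<open>b - a\<close>. For a non-integrable \<open>h\<close> the left side is zero by
  convention.\<close>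

lemma ennreal_set_integral_sq_le:
  fixes h :: "real \<Rightarrow> 'b::{banach, second_countable_topology}"
  assumes "a \<le> b"
  shows "ennreal ((norm (LINT r:{a..b}|lborel. h r))\<^sup>2) \<le> ennreal (b - a) * (\<integral>\<^sup>+r\<in>{a..b}. ennreal ((norm (h r))\<^sup>2) \<partial>lborel)"
proof (cases "set_integrable lborel {a..b} h")
  case True
  then have i: "integrable lborel (\<lambda>r. indicator {a..b} r *\<^sub>R h r)"
    by (simp add: set_integrable_def)
  have [measurable]: "(\<lambda>r. indicator {a..b} r *\<^sub>R h r) \<in> borel_measurable lborel"
    using i by (rule borel_measurable_integrable)
  let ?f = "\<lambda>r. ennreal (norm (indicator {a..b} r *\<^sub>R h r))"
  have "ennreal (norm (LINT r:{a..b}|lborel. h r)) \<le> (\<integral>\<^sup>+r. ?f r \<partial>lborel)"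
    using integral_norm_bound_ennreal[OF i] by (simp add: set_lebesgue_integral_def)
  also have "\<dots> = (\<integral>\<^sup>+r. ?f r * indicator {a..b} r \<partial>lborel)"
    by (intro nn_integral_cong) (auto simp: indicator_def)
  finally have "(ennreal (norm (LINT r:{a..b}|lborel. h r)))\<^sup>2 \<le> (\<integral>\<^sup>+r. ?f r * indicator {a..b} r \<partial>lborel)\<^sup>2"
    by (rule power_mono) simp
  also have "\<dots> \<le> (\<integral>\<^sup>+r. (?f r)\<^sup>2 \<partial>lborel) * (\<integral>\<^sup>+r. (indicator {a..b} r)\<^sup>2 \<partial>lborel)"
    by (rule Cauchy_Schwarz_nn_integral) measurable
  also have "(\<integral>\<^sup>+r. (?f r)\<^sup>2 \<partial>lborel) = (\<integral>\<^sup>+r\<in>{a..b}. ennreal ((norm (h r))\<^sup>2) \<partial>lborel)"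
    by (intro nn_integral_cong) (auto simp: indicator_def ennreal_power)
  also have "(\<integral>\<^sup>+r. (indicator {a..b} r)\<^sup>2 \<partial>lborel) = (\<integral>\<^sup>+r. indicator {a..b} r \<partial>lborel)"
    by (intro nn_integral_cong) (auto simp: indicator_def)
  also have "\<dots> = ennreal (b - a)"
    using assms by simp
  finally show ?thesis
    by (simp add: ennreal_power mult.commute)
next
  case False
  then show ?thesis
    by (simp add: set_integrable_def set_lebesgue_integral_def not_integrable_integral_eq)
qed

text \<open>Cauchy-Schwarz in the number of summands. The factor \<open>n\<close> is affordable: the
  summands will be cell errors, whose bounds contain the square of the mesh.\<close>

lemma msq_sum_le:
  fixes V :: "nat \<Rightarrow> 'a \<Rightarrow> 'b::real_normed_vector"
  assumes "\<And>i. i < n \<Longrightarrow> (\<lambda>x. norm (V i x)) \<in> borel_measurable N"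
  shows "msq N (\<lambda>x. \<Sum>i<n. V i x) \<le> of_nat n * (\<Sum>i<n. msq N (V i))"
proof -
  have "ennreal ((norm (\<Sum>i<n. V i x))\<^sup>2) \<le> of_nat n * (\<Sum>i<n. ennreal ((norm (V i x))\<^sup>2))" for x
  proof -
    have "(norm (\<Sum>i<n. V i x))\<^sup>2 \<le> (\<Sum>i<n. norm (V i x))\<^sup>2"
      by (intro power_mono norm_sum) auto
    also have "\<dots> \<le> (\<Sum>i<n. (norm (V i x))\<^sup>2) * real n"
      using sum_squared_le_sum_of_squares[of "\<lambda>i. norm (V i x)" "{..<n}"] by simp
    finally have "ennreal ((norm (\<Sum>i<n. V i x))\<^sup>2) \<le> ennreal (real n * (\<Sum>i<n. (norm (V i x))\<^sup>2))"
      by (intro ennreal_leI) (simp add: mult.commute)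
    then show ?thesis
      by (simp add: ennreal_mult sum_nonneg ennreal_of_nat_eq_real_of_nat)
  qed
  then have "msq N (\<lambda>x. \<Sum>i<n. V i x) \<le> (\<integral>\<^sup>+x. of_nat n * (\<Sum>i<n. ennreal ((norm (V i x))\<^sup>2)) \<partial>N)"
    unfolding msq_def by (rule nn_integral_mono)
  also have "\<dots> = of_nat n * (\<Sum>i<n. msq N (V i))"
    unfolding msq_def using assms
    by (subst nn_integral_cmult, measurable) (subst nn_integral_sum, auto)
  finally show ?thesis .
qed

text \<open>The setting once the control problem has been eliminated: \<open>a\<close> stands for
  the transposed Jacobian along the state, \<open>K\<close> for a bound on it, and the backward
  equation has become linear in \<open>Y\<close>, with one integral relation on
  \<open>{t..T}\<close> for each \<open>t\<close>.\<close>

locale linear_backward_equation = wiener_filtration M F T W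
  for M :: "'w measure" and F T and W :: "real \<Rightarrow> 'w \<Rightarrow> real ^ 'n" +
  fixes K :: real and a Z \<Phi> \<Psi> :: "real \<Rightarrow> 'w \<Rightarrow> real ^ 'n ^ 'n" and Y Ya :: "real \<Rightarrow> 'w \<Rightarrow> real ^ 'n"
  assumes T0: "0 \<le> T"
    and a_prog: "\<And>t. t \<in> {0..T} \<Longrightarrow> progressive t a"
    and a_bound: "\<And>s w. s \<in> {0..T} \<Longrightarrow> w \<in> space M \<Longrightarrow> norm (a s w) \<le> K"
    and Y_prog: "\<And>t. t \<in> {0..T} \<Longrightarrow> progressive t Y"
    and Y_energy: "energy 0 T Y < \<infinity>"
    and Z_measurable: "jointly_measurable 0 T Z"
    and Z_energy: "energy 0 T Z < \<infinity>"
    and bsde: "\<And>t. t \<in> {0..T} \<Longrightarrow> has_ito_integral M F W t T Z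
      (\<lambda>w. Y T w - Y t w + (LINT s:{t..T}|lborel. a s w *v Y s w))"
    and Ya_T: "AE w in M. Y T w = Ya T w" "Ya T \<in> borel_measurable M" "msq M (Ya T) < \<infinity>"
    and Ya_ode: "\<And>w. w \<in> space M \<Longrightarrow> ode_solution T (\<lambda>s y. - (a s w *v y)) (\<lambda>s. Ya s w)"
    and \<Phi>_0: "\<And>w. w \<in> space M \<Longrightarrow> \<Phi> 0 w = mat 1"
    and \<Phi>_ode: "\<And>w. w \<in> space M \<Longrightarrow> ode_solution T (\<lambda>s P. - (a s w ** P)) (\<lambda>s. \<Phi> s w)"
    and \<Psi>_0: "\<And>w. w \<in> space M \<Longrightarrow> \<Psi> 0 w = mat 1"
    and \<Psi>_ode: "\<And>w. w \<in> space M \<Longrightarrow> ode_solution T (\<lambda>s P. P ** a s w) (\<lambda>s. \<Psi> s w)"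
begin

section \<open>Bounds and measurability of the fundamental matrices\<close>

lemma K_nonneg: "0 \<le> K"
proof -
  obtain w where "w \<in> space M" using not_empty by blast
  then show ?thesis using order.trans[OF norm_ge_zero a_bound[of 0 w]] T0 by simp
qed

text \<open>The exponential bound of \<open>linear_ode_bound\<close> at the final time: one
  deterministic constant that dominates both \<open>\<Phi>\<close> and \<open>\<Psi>\<close> on the
  whole horizon.\<close>

definition B :: real where "B = norm (mat 1 :: real ^ 'n ^ 'n) * exp (2 * K * T)"

lemma B_nonneg: "0 \<le> B"
  by (simp add: B_def)

lemma bound_le_B: "s \<in> {0..T} \<Longrightarrow> norm (mat 1 :: real ^ 'n ^ 'n) * exp (2 * K * s) \<le> B"
  unfolding B_def using K_nonneg by (intro mult_left_mono) (auto intro: mult_left_mono)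

lemma prog_measurable_M:
  assumes "progressive T V"
  shows "jointly_measurable 0 T V"
proof (rule measurable_pair_coarser[OF assms])
  show "(\<lambda>x. x) \<in> measurable M (F T)"
    by (rule measurable_F_M[of T]) (use T0 in auto)
qed simp

lemma prog_section:
  assumes "progressive t V" "t \<in> {0..T}"
  shows "V t \<in> borel_measurable (F t)"
  using measurable_Pair2[OF assms(1), of t] assms(2) by (simp add: space_restrict_space)

lemma \<Psi>_prog: "t \<in> {0..T} \<Longrightarrow> progressive t \<Psi>"
  by (rule linear_ode_measurable[OF a_prog, where K = K and T = T]) (auto simp: space_F a_bound \<Psi>_ode \<Psi>_0)

lemma \<Psi>_bound: "s \<in> {0..T} \<Longrightarrow> w \<in> space M \<Longrightarrow> norm (\<Psi> s w) \<le> B"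
  by (rule order.trans[OF linear_ode_bound[OF a_prog[of T], where K = K and T = T] bound_le_B])
    (use T0 in \<open>auto simp: space_F a_bound \<Psi>_ode \<Psi>_0\<close>)

text \<open>In the equation of \<open>\<Phi>\<close> the coefficient acts from the left.
  Transposition moves it to the right, the form treated by the measurability and bound lemmas, with
  coefficient \<open>- transpose (a s w)\<close>, again bounded by \<open>K\<close>.\<close>

lemma transpose_\<Phi>_ode:
  assumes "w \<in> space M"
  shows "ode_solution T (\<lambda>s P. P ** (- transpose (a s w))) (\<lambda>s. transpose (\<Phi> s w))"
proof -
  note sol = \<Phi>_ode[OF assms]
  have eq: "transpose (- (a s w ** \<Phi> s w)) = transpose (\<Phi> s w) ** (- transpose (a s w))" for s
    using matrix_transpose_mul[of "a s w" "\<Phi> s w"]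
    by (simp add: linear_neg[OF bounded_linear.linear[OF bounded_linear_transpose]]
        bounded_bilinear.minus_right[OF bounded_bilinear_matrix_matrix_mult])
  have "transpose (\<Phi> t w) = transpose (\<Phi> 0 w) + (LINT s:{0..t}|lborel. transpose (\<Phi> s w) ** (- transpose (a s w)))"
    if t: "t \<in> {0..T}" for t
  proof -
    have i: "set_integrable lborel {0..t} (\<lambda>s. - (a s w ** \<Phi> s w))" "\<Phi> t w - \<Phi> 0 w = (LINT s:{0..t}|lborel. - (a s w ** \<Phi> s w))"
      using ode_solution_increment[OF sol, of 0 t] t by auto
    have "(LINT s:{0..t}|lborel. transpose (\<Phi> s w) ** (- transpose (a s w))) = transpose (\<Phi> t w - \<Phi> 0 w)"
      using set_integral_bounded_linear[OF bounded_linear_transpose i(1)] unfolding i(2) eq .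
    also have "\<dots> = transpose (\<Phi> t w) - transpose (\<Phi> 0 w)"
      by (rule linear_diff[OF bounded_linear.linear[OF bounded_linear_transpose]])
    finally show ?thesis by simp
  qed
  moreover have "set_integrable lborel {0..T} (\<lambda>s. transpose (\<Phi> s w) ** (- transpose (a s w)))"
    using set_integrable_bounded_linear[OF bounded_linear_transpose ode_solution_increment(1)[OF sol, of 0 T]] T0
    unfolding eq by simp
  ultimately show ?thesis unfolding ode_solution_def by blast
qed

lemma minus_transpose_a_prog:
  "t \<in> {0..T} \<Longrightarrow> progressive t (\<lambda>s w. - transpose (a s w))"
  using borel_measurable_uminus[OF borel_measurable_transpose[OF a_prog]] by (simp add: split_beta')

lemma \<Phi>_prog:
  assumes "t \<in> {0..T}"
  shows "progressive t \<Phi>"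
proof -
  have "progressive t (\<lambda>s w. transpose (\<Phi> s w))"
    by (rule linear_ode_measurable[OF minus_transpose_a_prog[OF assms], where K = K and T = T])
      (use assms in \<open>auto simp: space_F a_bound transpose_\<Phi>_ode \<Phi>_0 norm_transpose\<close>)
  from borel_measurable_transpose[OF this] show ?thesis
    by (simp add: split_beta')
qed

lemma \<Phi>_bound: "s \<in> {0..T} \<Longrightarrow> w \<in> space M \<Longrightarrow> norm (\<Phi> s w) \<le> B"
  by (subst norm_transpose[symmetric],
      rule order.trans[OF linear_ode_bound[OF minus_transpose_a_prog[of T], where K = K and T = T] bound_le_B])
    (use T0 in \<open>auto simp: space_F a_bound transpose_\<Phi>_ode \<Phi>_0 norm_transpose\<close>)

text \<open>The constancy argument yields the product in the order \<open>\<Psi> ** \<Phi>\<close>;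
  for square matrices a one-sided inverse is two-sided.\<close>

lemma \<Phi>_\<Psi>_inverse:
  assumes "t \<in> {0..T}" "w \<in> space M"
  shows "\<Phi> t w ** \<Psi> t w = mat 1"
proof -
  have "\<Psi> t w ** \<Phi> t w = \<Psi> 0 w ** \<Phi> 0 w"
    by (rule adjoint_product_constant[OF bounded_bilinear_matrix_matrix_mult norm_matrix_matrix_mult_le _
          \<Psi>_ode[OF assms(2)] \<Phi>_ode[OF assms(2)] _ assms(1)])
      (use a_bound assms(2) in \<open>auto simp: matrix_mul_assoc\<close>)
  then show ?thesis
    using \<Phi>_0 \<Psi>_0 assms(2) by (simp add: matrix_left_right_inverse)
qed

text \<open>Being solved outcome by outcome, \<open>Ya t\<close> carries no measurability by itself;
  measurability and integrability are read off from this formula.\<close>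

lemma Ya_eq:
  assumes t: "t \<in> {0..T}" and w: "w \<in> space M"
  shows "Ya t w = \<Phi> t w *v (\<Psi> T w *v Ya T w)"
proof -
  have c: "\<Psi> s w *v Ya s w = \<Psi> 0 w *v Ya 0 w" if "s \<in> {0..T}" for s
    by (rule adjoint_product_constant[OF bounded_bilinear_matrix_vector_mult norm_matrix_vector_mult_le _
          \<Psi>_ode[OF w] Ya_ode[OF w] _ that])
      (use a_bound w in \<open>auto simp: matrix_vector_mul_assoc\<close>)
  have "\<Psi> T w *v Ya T w = \<Psi> t w *v Ya t w"
    using c[OF t] c[of T] T0 by simp
  then show ?thesis
    using \<Phi>_\<Psi>_inverse[OF t w] by (simp add: matrix_vector_mul_assoc)
qed

lemma measurable_section_M:
  assumes "t \<in> {0..T}"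
  shows "\<Psi> t \<in> borel_measurable M" "\<Phi> t \<in> borel_measurable M" "Y t \<in> borel_measurable M"
  using prog_section[OF \<Psi>_prog] prog_section[OF \<Phi>_prog] prog_section[OF Y_prog] measurable_F_M assms
  by blast+

lemma Ya_measurable:
  assumes t: "t \<in> {0..T}"
  shows "Ya t \<in> borel_measurable M"
proof -
  have [measurable]: "\<Psi> T \<in> borel_measurable M" "\<Phi> t \<in> borel_measurable M" "Ya T \<in> borel_measurable M"
    using measurable_section_M T0 t Ya_T by auto
  have "(\<lambda>w. \<Phi> t w *v (\<Psi> T w *v Ya T w)) \<in> borel_measurable M"
    by measurable
  then show ?thesis
    by (subst measurable_cong[OF Ya_eq[OF t]])
qed

lemma Ya_integrable:
  assumes t: "t \<in> {0..T}"
  shows "integrable M (Ya t)"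
proof (rule Bochner_Integration.integrable_bound)
  show "integrable M (\<lambda>w. (B * B) *\<^sub>R Ya T w)"
    using msq_finite_integrable(2)[OF Ya_T(2,3)] by simp
  show "AE w in M. norm (Ya t w) \<le> norm ((B * B) *\<^sub>R Ya T w)"
  proof (rule AE_I2)
    fix w assume w: "w \<in> space M"
    have "norm (Ya t w) \<le> B * (B * norm (Ya T w))"
      unfolding Ya_eq[OF t w] using B_nonneg T0
      by (intro order.trans[OF norm_matrix_vector_mult_le] mult_mono \<Phi>_bound[OF t w] \<Psi>_bound[OF _ w]
          mult_nonneg_nonneg) auto
    then show "norm (Ya t w) \<le> norm ((B * B) *\<^sub>R Ya T w)"
      using B_nonneg by (simp add: mult.assoc)
  qed
qed (rule Ya_measurable[OF t])

text \<open>The concrete representative of the integral of \<open>Z\<close> over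
  \<open>{t..T}\<close> that the backward equation supplies. Integrals are determined up to null
  events only; with one choice fixed for every \<open>t\<close>, differences
  \<open>J c w - J d w\<close> can be computed along a path.\<close>

definition J :: "real \<Rightarrow> 'w \<Rightarrow> real ^ 'n" where
  "J t w = Y T w - Y t w + (LINT s:{t..T}|lborel. a s w *v Y s w)"

lemma J_ito: "t \<in> {0..T} \<Longrightarrow> has_ito_integral M F W t T Z (J t)"
  using bsde unfolding J_def[abs_def] .

lemma J_measurable: "t \<in> {0..T} \<Longrightarrow> J t \<in> borel_measurable M"
  by (rule has_ito_integralD(2)[OF J_ito])

lemma Y_measurable_M: "jointly_measurable 0 T Y"
  by (rule prog_measurable_M[OF Y_prog]) (use T0 in auto)

lemma a_measurable_M: "jointly_measurable 0 T a"
  by (rule prog_measurable_M[OF a_prog]) (use T0 in auto)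

text \<open>Almost every path of \<open>Y\<close> is square integrable on the bounded horizon, hence
  integrable by x \<le> 1 + x^2. This permits splitting the drift integrals at intermediate
  times.\<close>

lemma aY_integrable: "AE w in M. set_integrable lborel {0..T} (\<lambda>s. a s w *v Y s w)"
proof -
  have "AE w in M. (\<integral>\<^sup>+s\<in>{0..T}. ennreal ((norm (Y s w))\<^sup>2) \<partial>lborel) \<noteq> \<infinity>"
    using Y_energy unfolding mean_square_energy_def
    by (intro nn_integral_noteq_infinite[OF energy_inner_measurable[OF Y_measurable_M]]) auto
  with AE_space show ?thesis
  proof eventually_elim
    fix w assume w: "w \<in> space M" and fin: "(\<integral>\<^sup>+s\<in>{0..T}. ennreal ((norm (Y s w))\<^sup>2) \<partial>lborel) \<noteq> \<infinity>"
    have [measurable]: "(\<lambda>s. indicator {0..T} s *\<^sub>R Y s w) \<in> borel_measurable borel"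
      "(\<lambda>s. indicator {0..T} s *\<^sub>R a s w) \<in> borel_measurable borel"
      by (rule energy_section_measurable[OF Y_measurable_M w] energy_section_measurable[OF a_measurable_M w])+
    have "integrable lborel (\<lambda>s. (norm (indicator {0..T} s *\<^sub>R Y s w))\<^sup>2)"
    proof (rule integrableI_bounded)
      have "(\<integral>\<^sup>+s. ennreal (norm ((norm (indicator {0..T} s *\<^sub>R Y s w))\<^sup>2)) \<partial>lborel) =
          (\<integral>\<^sup>+s\<in>{0..T}. ennreal ((norm (Y s w))\<^sup>2) \<partial>lborel)"
        by (intro nn_integral_cong) (auto simp: indicator_def)
      then show "(\<integral>\<^sup>+s. ennreal (norm ((norm (indicator {0..T} s *\<^sub>R Y s w))\<^sup>2)) \<partial>lborel) < \<infinity>"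
        using fin by (simp add: top.not_eq_extremum)
    qed measurable
    moreover have "integrable lborel (\<lambda>s. indicator {0..T} s :: real)"
      by (simp add: emeasure_lborel_Icc_eq)
    ultimately have dom: "integrable lborel (\<lambda>s. K * (indicator {0..T} s + (norm (indicator {0..T} s *\<^sub>R Y s w))\<^sup>2))"
      by (intro integrable_mult_right Bochner_Integration.integrable_add)
    show "set_integrable lborel {0..T} (\<lambda>s. a s w *v Y s w)"
      unfolding set_integrable_def
    proof (rule Bochner_Integration.integrable_bound[OF dom])
      have "(\<lambda>s. (indicator {0..T} s *\<^sub>R a s w) *v (indicator {0..T} s *\<^sub>R Y s w)) \<in> borel_measurable lborel"
        by measurable
      also have "(\<lambda>s. (indicator {0..T} s *\<^sub>R a s w) *v (indicator {0..T} s *\<^sub>R Y s w)) = (\<lambda>s. indicator {0..T} s *\<^sub>R (a s w *v Y s w))"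
        by (auto simp: indicator_def)
      finally show "(\<lambda>s. indicator {0..T} s *\<^sub>R (a s w *v Y s w)) \<in> borel_measurable lborel" .
      have "norm (a s w *v Y s w) \<le> K * (1 + (norm (Y s w))\<^sup>2)" if s: "s \<in> {0..T}" for s
      proof -
        have "norm (Y s w) \<le> 1 + (norm (Y s w))\<^sup>2"
          using sum_squares_bound[of 1 "norm (Y s w)"] norm_ge_zero[of "Y s w"] by (simp del: norm_ge_zero)
        then show ?thesis
          using K_nonneg by (intro order.trans[OF norm_matrix_vector_mult_le] mult_mono a_bound[OF s w]) auto
      qed
      then show "AE s in lborel. norm (indicator {0..T} s *\<^sub>R (a s w *v Y s w)) \<le>
          norm (K * (indicator {0..T} s + (norm (indicator {0..T} s *\<^sub>R Y s w))\<^sup>2))"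
        using K_nonneg by (intro AE_I2) (auto simp: indicator_def)
    qed
  qed
qed

lemma J_diff:
  assumes cd: "0 \<le> c" "c \<le> d" "d \<le> T"
  shows "AE w in M. J c w - J d w = Y d w - Y c w + (LINT s:{c..d}|lborel. a s w *v Y s w)"
  using aY_integrable
proof eventually_elim
  fix w assume i: "set_integrable lborel {0..T} (\<lambda>s. a s w *v Y s w)"
  have "set_integrable lborel {c..T} (\<lambda>s. a s w *v Y s w)"
    by (rule set_integrable_subset[OF i]) (use cd in auto)
  from set_integral_Icc_split[OF this cd(2,3)]
  show "J c w - J d w = Y d w - Y c w + (LINT s:{c..d}|lborel. a s w *v Y s w)"
    by (simp add: J_def)
qed

lemma indicator_Z_measurable:
  assumes C: "C \<in> borel_measurable M" and t: "0 \<le> t"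
  shows "jointly_measurable t T (\<lambda>s w. indicator {c<..d} s *\<^sub>R (C w ** Z s w))"
proof -
  let ?R = "restrict_space borel {t..T} \<Otimes>\<^sub>M M"
  have Z: "(\<lambda>x. Z (fst x) (snd x)) \<in> borel_measurable ?R"
    using measurable_restrict_interval_mono[OF Z_measurable t order_refl] by (simp add: split_beta')
  have C': "(\<lambda>x. C (snd x)) \<in> borel_measurable ?R"
    using measurable_compose[OF measurable_snd C] .
  have "(\<lambda>x. x) \<in> borel_measurable (restrict_space borel {t..T})"
    by (rule measurable_restrict_space1) simp
  from measurable_compose[OF measurable_fst[of _ M] this]
  have [measurable]: "fst \<in> borel_measurable ?R" by simp
  have "(\<lambda>x. indicator {c<..d} (fst x) :: real) \<in> borel_measurable ?R"
    by measurable
  from borel_measurable_scaleR[OF this borel_measurable_matrix_matrix_mult[OF C' Z]]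
  show ?thesis by (simp add: split_beta')
qed

text \<open>The integral over \<open>{c..d}\<close> is the one from \<open>c\<close> minus the one
  from \<open>d\<close>. The latter is first extended by zero down to \<open>c\<close>, where the
  factor \<open>C\<close> is known; after multiplication the result is extended by zero down to
  \<open>t\<close>.\<close>

lemma ito_piece:
  assumes cd: "0 \<le> t" "t \<le> c" "c \<le> d" "d \<le> T"
    and C: "C \<in> borel_measurable (F c)" "bounded (C ` space M)"
  shows "has_ito_integral M F W t T (\<lambda>s w. indicator {c<..d} s *\<^sub>R (C w ** Z s w)) (\<lambda>w. C w *v (J c w - J d w))"
proof -
  have c: "c \<in> {0..T}" and d: "d \<in> {0..T}" and c0: "0 \<le> c" using cd by auto
  have CM: "C \<in> borel_measurable M" by (rule measurable_F_M[OF c C(1)])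
  have one: "(\<lambda>_. mat 1 :: real ^ 'n ^ 'n) \<in> borel_measurable M" by simp
  have Jd: "has_ito_integral M F W c T (\<lambda>s w. indicator {d<..T} s *\<^sub>R (mat 1 ** Z s w)) (J d)"
    by (rule has_ito_integral_extend[OF J_ito[OF d] _ _ _ indicator_Z_measurable[OF one]]) (use cd in auto)
  \<comment> \<open>Subtraction is addition after left multiplication by
    \<open>- mat 1\<close>.\<close>
  have "has_ito_integral M F W c T (\<lambda>s w. (- mat 1) ** (indicator {d<..T} s *\<^sub>R (mat 1 ** Z s w))) (\<lambda>w. (- mat 1) *v J d w)"
    by (rule has_ito_integral_left_mult[OF Jd]) (use cd in \<open>auto simp: image_constant_conv\<close>)
  from has_ito_integral_add[OF J_ito[OF c] this]
  have "has_ito_integral M F W c T (\<lambda>s w. Z s w + (- mat 1) ** (indicator {d<..T} s *\<^sub>R (mat 1 ** Z s w))) (\<lambda>w. J c w + (- mat 1) *v J d w)"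
    using c by auto
  from has_ito_integral_left_mult[OF this c0 order_refl C]
  have "has_ito_integral M F W c T (\<lambda>s w. C w ** (Z s w + (- mat 1) ** (indicator {d<..T} s *\<^sub>R (mat 1 ** Z s w)))) (\<lambda>w. C w *v (J c w + (- mat 1) *v J d w))" .
  moreover have "(- mat 1) *v x = - x" for x :: "real ^ 'n"
    using bounded_bilinear.minus_left[OF bounded_bilinear_matrix_vector_mult, of "mat 1" x] by simp
  moreover have "(- mat 1) ** A = - A" for A :: "real ^ 'n ^ 'n"
    using bounded_bilinear.minus_left[OF bounded_bilinear_matrix_matrix_mult, of "mat 1" A] by simp
  ultimately have "has_ito_integral M F W c T (\<lambda>s w. C w ** (Z s w - indicator {d<..T} s *\<^sub>R Z s w)) (\<lambda>w. C w *v (J c w - J d w))"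
    by simp
  then show ?thesis
    by (rule has_ito_integral_extend[OF _ _ _ _ indicator_Z_measurable[OF CM]])
      (use cd in \<open>auto simp: indicator_def bounded_bilinear.zero_right[OF bounded_bilinear_matrix_matrix_mult]\<close>)
qed

lemma J_diff_msq:
  assumes cd: "0 \<le> c" "c \<le> d" "d \<le> T"
  shows "msq M (\<lambda>w. J c w - J d w) \<le> 4 * energy c d Z"
proof -
  have "has_ito_integral M F W c T (\<lambda>s w. indicator {c<..d} s *\<^sub>R (mat 1 ** Z s w)) (\<lambda>w. mat 1 *v (J c w - J d w))"
    by (rule ito_piece) (use cd in \<open>auto simp: image_constant_conv\<close>)
  from has_ito_integral_msq_le[OF this]
  have "msq M (\<lambda>w. J c w - J d w) \<le> 4 * energy c T (\<lambda>s w. indicator {c<..d} s *\<^sub>R Z s w)"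
    using cd by simp
  also have "energy c T (\<lambda>s w. indicator {c<..d} s *\<^sub>R Z s w) \<le> energy c d Z"
    unfolding mean_square_energy_def by (intro nn_integral_mono) (auto simp: indicator_def)
  finally show ?thesis by (simp add: mult_left_mono)
qed

text \<open>An increment of \<open>Y\<close> is the stochastic part \<open>J s w - J b w\<close>
  minus the drift. The constant 8 is twice the 4 of \<open>has_ito_integral_msq_le\<close>; the
  factor \<open>b - s\<close> comes from Cauchy-Schwarz in time, with the drift estimated by the
  total energy of \<open>Y\<close>.\<close>

lemma Y_increment_msq:
  assumes sb: "0 \<le> s" "s \<le> b" "b \<le> T"
  shows "msq M (\<lambda>w. Y b w - Y s w) \<le>
    8 * energy s b Z + ennreal (2 * K\<^sup>2 * (b - s)) * energy 0 T Y"
proof -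
  have s: "s \<in> {0..T}" and b: "b \<in> {0..T}" using sb by auto
  define V where "V w = (J s w - J b w) - (Y b w - Y s w)" for w
  have Jm: "(\<lambda>w. J s w - J b w) \<in> borel_measurable M"
    using J_measurable[OF s] J_measurable[OF b] by simp
  have Vm: "V \<in> borel_measurable M"
    using Jm measurable_section_M(3)[OF s] measurable_section_M(3)[OF b] unfolding V_def by simp
  have "AE w in M. V w = (LINT r:{s..b}|lborel. a r w *v Y r w)"
    using J_diff[OF sb] by eventually_elim (simp add: V_def)
  then have "msq M V = msq M (\<lambda>w. LINT r:{s..b}|lborel. a r w *v Y r w)"
    by (rule msq_cong_AE)
  also have "\<dots> \<le> (\<integral>\<^sup>+w. ennreal (K\<^sup>2 * (b - s)) * (\<integral>\<^sup>+r\<in>{0..T}. ennreal ((norm (Y r w))\<^sup>2) \<partial>lborel) \<partial>M)"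
    unfolding msq_def
  proof (rule nn_integral_mono)
    fix w assume w: "w \<in> space M"
    have [measurable]: "(\<lambda>s. indicator {0..T} s *\<^sub>R Y s w) \<in> borel_measurable borel"
      by (rule energy_section_measurable[OF Y_measurable_M w])
    have "(\<integral>\<^sup>+r\<in>{s..b}. ennreal ((norm (a r w *v Y r w))\<^sup>2) \<partial>lborel) \<le>
        (\<integral>\<^sup>+r. ennreal (K\<^sup>2) * ennreal ((norm (indicator {0..T} r *\<^sub>R Y r w))\<^sup>2) \<partial>lborel)"
    proof (rule nn_integral_mono)
      fix r
      have "(norm (a r w *v Y r w))\<^sup>2 \<le> K\<^sup>2 * (norm (Y r w))\<^sup>2" if r: "r \<in> {s..b}"
        unfolding power_mult_distrib[symmetric] using r sb
        by (intro power_mono order.trans[OF norm_matrix_vector_mult_le] mult_right_mono a_bound[OF _ w]) auto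
      then show "ennreal ((norm (a r w *v Y r w))\<^sup>2) * indicator {s..b} r \<le> ennreal (K\<^sup>2) * ennreal ((norm (indicator {0..T} r *\<^sub>R Y r w))\<^sup>2)"
        using sb by (auto simp: indicator_def ennreal_mult[symmetric] intro!: ennreal_leI)
    qed
    also have "\<dots> = ennreal (K\<^sup>2) * (\<integral>\<^sup>+r. ennreal ((norm (indicator {0..T} r *\<^sub>R Y r w))\<^sup>2) \<partial>lborel)"
      by (rule nn_integral_cmult) measurable
    also have "(\<integral>\<^sup>+r. ennreal ((norm (indicator {0..T} r *\<^sub>R Y r w))\<^sup>2) \<partial>lborel) = (\<integral>\<^sup>+r\<in>{0..T}. ennreal ((norm (Y r w))\<^sup>2) \<partial>lborel)"
      by (intro nn_integral_cong) (auto simp: indicator_def)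
    finally have "ennreal (b - s) * (\<integral>\<^sup>+r\<in>{s..b}. ennreal ((norm (a r w *v Y r w))\<^sup>2) \<partial>lborel) \<le>
        ennreal (b - s) * (ennreal (K\<^sup>2) * (\<integral>\<^sup>+r\<in>{0..T}. ennreal ((norm (Y r w))\<^sup>2) \<partial>lborel))"
      by (rule mult_left_mono) simp
    also have "\<dots> = ennreal (K\<^sup>2 * (b - s)) * (\<integral>\<^sup>+r\<in>{0..T}. ennreal ((norm (Y r w))\<^sup>2) \<partial>lborel)"
      using sb by (simp add: ennreal_mult mult_ac)
    finally show "ennreal ((norm (LINT r:{s..b}|lborel. a r w *v Y r w))\<^sup>2) \<le>
        ennreal (K\<^sup>2 * (b - s)) * (\<integral>\<^sup>+r\<in>{0..T}. ennreal ((norm (Y r w))\<^sup>2) \<partial>lborel)"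
      by (rule order.trans[OF ennreal_set_integral_sq_le[OF sb(2)]])
  qed
  also have "\<dots> = ennreal (K\<^sup>2 * (b - s)) * energy 0 T Y"
    unfolding mean_square_energy_def by (rule nn_integral_cmult[OF energy_inner_measurable[OF Y_measurable_M]])
  finally have V: "msq M V \<le> ennreal (K\<^sup>2 * (b - s)) * energy 0 T Y" .
  have "msq M (\<lambda>w. Y b w - Y s w) = msq M (\<lambda>w. (J s w - J b w) - V w)"
    by (simp add: V_def)
  also have "\<dots> \<le> 2 * msq M (\<lambda>w. J s w - J b w) + 2 * msq M V"
    by (rule msq_diff_le[OF Jm Vm])
  also have "\<dots> \<le> 2 * (4 * energy s b Z) + 2 * (ennreal (K\<^sup>2 * (b - s)) * energy 0 T Y)"
    by (intro add_mono mult_left_mono J_diff_msq[OF sb] V) auto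
  also have "\<dots> = 8 * energy s b Z + ennreal (2 * K\<^sup>2 * (b - s)) * energy 0 T Y"
    using sb by (simp add: mult.assoc[symmetric] ennreal_mult)
  finally show ?thesis .
qed

end


section \<open>Mean-square error of one time step, and passage to the limit\<close>

context wiener_filtration
begin

text \<open>Time is outermost here, so that mean-square bounds at fixed times can be
  integrated.\<close>

lemma energy_fubini:
  assumes "jointly_measurable a b V"
  shows "energy a b V = (\<integral>\<^sup>+s\<in>{a..b}. msq M (V s) \<partial>lborel)"
proof -
  have [measurable]: "(\<lambda>(s, w). V s w) \<in> borel_measurable (restrict_space lborel {a..b} \<Otimes>\<^sub>M M)"
    using assms by (simp cong: measurable_cong_sets)
  show ?thesis
    unfolding energy_eq[OF assms] msq_def
    by (subst nn_integral_fst[symmetric]) (auto simp: nn_integral_restrict_space)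
qed

end

context linear_backward_equation
begin

lemma finite_energies:
  obtains y z where "0 \<le> y" "energy 0 T Y = ennreal y"
    "0 \<le> z" "energy 0 T Z = ennreal z"
  using Y_energy Z_energy by (metis ennreal_cases less_irrefl infinity_ennreal_def)

lemma \<Psi>_lipschitz:
  assumes "0 \<le> c" "c \<le> d" "d \<le> T" "w \<in> space M"
  shows "norm (\<Psi> d w - \<Psi> c w) \<le> B * K * (d - c)"
  by (rule ode_solution_increment_le[OF \<Psi>_ode[OF assms(4)] assms(1-3)])
    (use assms B_nonneg in \<open>auto intro!: order.trans[OF norm_matrix_matrix_mult_le] mult_mono \<Psi>_bound a_bound\<close>)

text \<open>The compensated increment of \<open>\<Psi> Y\<close> over \<open>{c..d}\<close> is the integral of
  \<open>\<Psi>\<^sub>s a\<^sub>s (Y\<^sub>d - Y\<^sub>s) + (\<Psi>\<^sub>s - \<Psi>\<^sub>c) a\<^sub>s Y\<^sub>s\<close>, whose two terms are small in mean square.\<close>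

lemma discretization_step:
  assumes cd: "0 \<le> c" "c \<le> d" "d \<le> T"
  shows "msq M (\<lambda>w. \<Psi> d w *v Y d w - \<Psi> c w *v Y c w - \<Psi> c w *v (J c w - J d w)) \<le>
    ennreal ((B * K)\<^sup>2 * (d - c)\<^sup>2) * (16 * energy c d Z + ennreal (6 * K\<^sup>2 * (d - c)) * energy 0 T Y)"
proof -
  have c: "c \<in> {0..T}" and d: "d \<in> {0..T}" using cd by auto
  let ?R = "restrict_space borel {c..d} \<Otimes>\<^sub>M M"
  define G where "G s w = (\<Psi> s w ** a s w) *v Y d w - \<Psi> c w *v (a s w *v Y s w)" for s w
  \<comment> \<open>\<open>V1\<close> is the increment of \<open>Y\<close> in the first term; the
    scaling of \<open>V2\<close> absorbs the Lipschitz bound of \<open>\<Psi>\<close>, so that both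
    terms share the factor \<open>B * K\<close>.\<close>
  define V1 where "V1 s w = Y d w - Y s w" for s w
  define V2 where "V2 s w = (K * (d - c)) *\<^sub>R Y s w" for s w
  have [measurable]: "(\<lambda>x. \<Psi> (fst x) (snd x)) \<in> borel_measurable ?R" "(\<lambda>x. a (fst x) (snd x)) \<in> borel_measurable ?R"
    "(\<lambda>x. Y (fst x) (snd x)) \<in> borel_measurable ?R"
    using measurable_restrict_interval_mono[OF prog_measurable_M[OF \<Psi>_prog[of T]], of c d]
      measurable_restrict_interval_mono[OF a_measurable_M, of c d]
      measurable_restrict_interval_mono[OF Y_measurable_M, of c d] cd
    by (simp_all add: split_beta')
  have [measurable]: "(\<lambda>x. Y d (snd x)) \<in> borel_measurable ?R" "(\<lambda>x. \<Psi> c (snd x)) \<in> borel_measurable ?R"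
    by (rule measurable_compose[OF measurable_snd measurable_section_M(3)[OF d]]
      measurable_compose[OF measurable_snd measurable_section_M(1)[OF c]])+
  have Gm: "(\<lambda>(s, w). G s w) \<in> borel_measurable ?R"
    and V1m: "(\<lambda>(s, w). V1 s w) \<in> borel_measurable ?R"
    and V2m: "(\<lambda>(s, w). V2 s w) \<in> borel_measurable ?R"
    and Ym: "(\<lambda>(s, w). Y s w) \<in> borel_measurable ?R"
    unfolding G_def V1_def V2_def split_beta' by measurable
  have N1: "(\<lambda>(s, w). norm (V1 s w)) \<in> borel_measurable ?R" and N2: "(\<lambda>(s, w). norm (V2 s w)) \<in> borel_measurable ?R"
    using measurable_compose[OF V1m borel_measurable_norm] measurable_compose[OF V2m borel_measurable_norm]
    by (simp_all add: split_beta')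
  have N12: "(\<lambda>(s, w). norm (V1 s w) + norm (V2 s w)) \<in> borel_measurable ?R"
    using borel_measurable_add[OF N1 N2] by (simp add: split_beta')
  have "AE w in M. \<Psi> d w *v Y d w - \<Psi> c w *v Y c w - \<Psi> c w *v (J c w - J d w) = (LINT s:{c..d}|lborel. G s w)"
    using AE_space aY_integrable J_diff[OF cd]
  proof eventually_elim
    fix w assume w: "w \<in> space M" and i: "set_integrable lborel {0..T} (\<lambda>s. a s w *v Y s w)"
      and Jd: "J c w - J d w = Y d w - Y c w + (LINT s:{c..d}|lborel. a s w *v Y s w)"
    have i': "set_integrable lborel {c..d} (\<lambda>s. a s w *v Y s w)"
      by (rule set_integrable_subset[OF i]) (use cd in auto)
    note \<Psi>i = ode_solution_increment[OF \<Psi>_ode[OF w] cd]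
    interpret mv: bounded_bilinear "(*v) :: real ^ 'n ^ 'n \<Rightarrow> _" by (rule bounded_bilinear_matrix_vector_mult)
    have "\<Psi> d w *v Y d w - \<Psi> c w *v Y c w - \<Psi> c w *v (J c w - J d w) =
        (\<Psi> d w - \<Psi> c w) *v Y d w - \<Psi> c w *v (LINT s:{c..d}|lborel. a s w *v Y s w)"
      unfolding Jd by (simp add: mv.diff_left mv.diff_right mv.add_right)
    also have "\<dots> = (LINT s:{c..d}|lborel. (\<Psi> s w ** a s w) *v Y d w) - (LINT s:{c..d}|lborel. \<Psi> c w *v (a s w *v Y s w))"
      unfolding \<Psi>i(2) set_integral_bounded_linear[OF mv.bounded_linear_left \<Psi>i(1)]
        set_integral_bounded_linear[OF mv.bounded_linear_right i'] ..
    also have "\<dots> = (LINT s:{c..d}|lborel. G s w)"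
      unfolding G_def
      by (rule set_integral_diff(2)[OF set_integrable_bounded_linear[OF mv.bounded_linear_left \<Psi>i(1)]
          set_integrable_bounded_linear[OF mv.bounded_linear_right i'], symmetric])
    finally show "\<Psi> d w *v Y d w - \<Psi> c w *v Y c w - \<Psi> c w *v (J c w - J d w) = (LINT s:{c..d}|lborel. G s w)" .
  qed
  then have "msq M (\<lambda>w. \<Psi> d w *v Y d w - \<Psi> c w *v Y c w - \<Psi> c w *v (J c w - J d w)) = msq M (\<lambda>w. LINT s:{c..d}|lborel. G s w)"
    by (rule msq_cong_AE)
  also have "\<dots> \<le> (\<integral>\<^sup>+w. ennreal (d - c) * (\<integral>\<^sup>+s\<in>{c..d}. ennreal ((norm (G s w))\<^sup>2) \<partial>lborel) \<partial>M)"
    unfolding msq_def by (intro nn_integral_mono ennreal_set_integral_sq_le cd)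
  also have "\<dots> = ennreal (d - c) * energy c d G"
    unfolding mean_square_energy_def by (rule nn_integral_cmult[OF energy_inner_measurable[OF Gm]])
  also have "energy c d G \<le> ennreal ((B * K)\<^sup>2) * energy c d (\<lambda>s w. norm (V1 s w) + norm (V2 s w))"
  proof (rule energy_mono_scaled[OF Gm N12])
    show "0 \<le> B * K" using B_nonneg K_nonneg by simp
    fix s w assume s: "s \<in> {c..d}" and w: "w \<in> space M"
    have sT: "s \<in> {0..T}" using s cd by auto
    have "G s w = (\<Psi> s w ** a s w) *v V1 s w + (\<Psi> s w - \<Psi> c w) *v (a s w *v Y s w)"
      unfolding G_def V1_def
      by (simp add: bounded_bilinear.diff_right[OF bounded_bilinear_matrix_vector_mult]
          bounded_bilinear.diff_left[OF bounded_bilinear_matrix_vector_mult]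
          bounded_bilinear.diff_left[OF bounded_bilinear_matrix_matrix_mult] matrix_vector_mul_assoc)
    also have "norm \<dots> \<le> norm ((\<Psi> s w ** a s w) *v V1 s w) + norm ((\<Psi> s w - \<Psi> c w) *v (a s w *v Y s w))"
      by (rule norm_triangle_ineq)
    also have "norm ((\<Psi> s w ** a s w) *v V1 s w) \<le> (B * K) * norm (V1 s w)"
      using B_nonneg
      by (intro order.trans[OF norm_matrix_vector_mult_le] order.trans[OF norm_matrix_matrix_mult_le]
          mult_mono order_refl \<Psi>_bound[OF sT w] a_bound[OF sT w]) (auto simp: K_nonneg)
    also have "norm ((\<Psi> s w - \<Psi> c w) *v (a s w *v Y s w)) \<le> (B * K * (d - c)) * (K * norm (Y s w))"
    proof (rule order.trans[OF norm_matrix_vector_mult_le], rule mult_mono)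
      have "norm (\<Psi> s w - \<Psi> c w) \<le> B * K * (s - c)"
        by (rule \<Psi>_lipschitz) (use s cd w in auto)
      also have "\<dots> \<le> B * K * (d - c)"
        using s B_nonneg K_nonneg by (intro mult_left_mono) auto
      finally show "norm (\<Psi> s w - \<Psi> c w) \<le> B * K * (d - c)" .
      show "norm (a s w *v Y s w) \<le> K * norm (Y s w)"
        by (rule order.trans[OF norm_matrix_vector_mult_le mult_right_mono[OF a_bound[OF sT w]]]) simp
    qed (use B_nonneg K_nonneg cd in auto)
    also have "(B * K) * norm (V1 s w) + (B * K * (d - c)) * (K * norm (Y s w)) = B * K * norm (norm (V1 s w) + norm (V2 s w))"
    proof -
      have "norm (V2 s w) = K * (d - c) * norm (Y s w)"
        using K_nonneg cd by (simp add: V2_def)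
      moreover have "norm (norm (V1 s w) + norm (V2 s w)) = norm (V1 s w) + norm (V2 s w)"
        by simp
      ultimately show ?thesis by (simp only:) (simp add: algebra_simps)
    qed
    finally show "norm (G s w) \<le> B * K * norm (norm (V1 s w) + norm (V2 s w))" by simp
  qed
  also have "energy c d (\<lambda>s w. norm (V1 s w) + norm (V2 s w)) \<le> 2 * energy c d V1 + 2 * energy c d V2"
    using energy_add_le[OF N1 N2] by (simp add: mean_square_energy_def)
  also have "energy c d V2 \<le> ennreal ((K * (d - c))\<^sup>2) * energy c d Y"
    using K_nonneg cd by (intro energy_mono_scaled[OF V2m Ym]) (auto simp: V2_def)
  also have "energy c d Y \<le> energy 0 T Y"
    by (rule mean_square_energy_mono) (use cd in auto)
  \<comment> \<open>Integrating the estimate of \<open>Y_increment_msq\<close> over the cell gains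
    another length \<open>d - c\<close>.\<close>
  also have "energy c d V1 \<le> (8 * energy c d Z + ennreal (2 * K\<^sup>2 * (d - c)) * energy 0 T Y) * ennreal (d - c)"
  proof -
    have "msq M (V1 s) \<le> 8 * energy c d Z + ennreal (2 * K\<^sup>2 * (d - c)) * energy 0 T Y"
      if s: "s \<in> {c..d}" for s
    proof -
      have "msq M (V1 s) \<le> 8 * energy s d Z + ennreal (2 * K\<^sup>2 * (d - s)) * energy 0 T Y"
        unfolding V1_def by (rule Y_increment_msq) (use s cd in auto)
      also have "\<dots> \<le> 8 * energy c d Z + ennreal (2 * K\<^sup>2 * (d - c)) * energy 0 T Y"
        using s by (intro add_mono mult_left_mono mult_right_mono mean_square_energy_mono ennreal_leI) auto
      finally show ?thesis .
    qed
    then have "energy c d V1 \<le>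
      (\<integral>\<^sup>+s. (8 * energy c d Z + ennreal (2 * K\<^sup>2 * (d - c)) * energy 0 T Y) * indicator {c..d} s \<partial>lborel)"
      unfolding energy_fubini[OF V1m] by (intro nn_integral_mono) (auto simp: indicator_def)
    then show ?thesis
      using cd by (simp add: nn_integral_cmult_indicator)
  qed
  finally have le: "msq M (\<lambda>w. \<Psi> d w *v Y d w - \<Psi> c w *v Y c w - \<Psi> c w *v (J c w - J d w)) \<le>
    ennreal (d - c) * (ennreal ((B * K)\<^sup>2) *
      (2 * ((8 * energy c d Z + ennreal (2 * K\<^sup>2 * (d - c)) * energy 0 T Y) * ennreal (d - c)) +
       2 * (ennreal ((K * (d - c))\<^sup>2) * energy 0 T Y)))"
    by (simp add: mult_left_mono add_mono)
  \<comment> \<open>Both energies are finite, so the coefficients can be collected in the reals: 16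
    is 2 * 8, and 6 is 2 * 2 + 2.\<close>
  obtain y where y: "0 \<le> y" "energy 0 T Y = ennreal y"
    using finite_energies by metis
  have "energy c d Z \<le> energy 0 T Z"
    by (rule mean_square_energy_mono) (use cd in auto)
  then have "energy c d Z < \<infinity>"
    using Z_energy by (rule le_less_trans)
  then obtain z where z: "0 \<le> z" "energy c d Z = ennreal z"
    by (metis ennreal_cases less_irrefl infinity_ennreal_def)
  have "ennreal (d - c) * (ennreal ((B * K)\<^sup>2) *
      (2 * ((8 * ennreal z + ennreal (2 * K\<^sup>2 * (d - c)) * ennreal y) * ennreal (d - c)) +
       2 * (ennreal ((K * (d - c))\<^sup>2) * ennreal y))) =
    ennreal ((d - c) * ((B * K)\<^sup>2 * (2 * ((8 * z + 2 * K\<^sup>2 * (d - c) * y) * (d - c)) + 2 * ((K * (d - c))\<^sup>2 * y))))"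
    using y z cd by (simp add: ennreal_mult ennreal_plus)
  also have "(d - c) * ((B * K)\<^sup>2 * (2 * ((8 * z + 2 * K\<^sup>2 * (d - c) * y) * (d - c)) + 2 * ((K * (d - c))\<^sup>2 * y))) =
      (B * K)\<^sup>2 * (d - c)\<^sup>2 * (16 * z + 6 * K\<^sup>2 * (d - c) * y)"
    by algebra
  also have "ennreal \<dots> = ennreal ((B * K)\<^sup>2 * (d - c)\<^sup>2) * (16 * ennreal z + ennreal (6 * K\<^sup>2 * (d - c)) * ennreal y)"
    using y z cd by (simp add: ennreal_mult ennreal_plus)
  finally show ?thesis
    using le unfolding y z by simp
qed

lemma ito_sum:
  fixes n :: nat
  assumes t: "t \<in> {0..T}"
    and H: "\<And>i. i < n \<Longrightarrow> has_ito_integral M F W t T (H i) (V i)"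
  shows "has_ito_integral M F W t T (\<lambda>s w. \<Sum>i<n. H i s w) (\<lambda>w. \<Sum>i<n. V i w :: real ^ 'n)"
  using H
proof (induction n)
  case 0
  \<comment> \<open>The empty sum is obtained as the integral of \<open>Z\<close> multiplied by the
    zero matrix.\<close>
  have "has_ito_integral M F W t T (\<lambda>s w. 0 ** Z s w) (\<lambda>w. 0 *v J t w)"
    by (rule has_ito_integral_left_mult[OF J_ito[OF t]]) (use t in \<open>auto simp: image_constant_conv\<close>)
  then show ?case
    by (simp add: bounded_bilinear.zero_left[OF bounded_bilinear_matrix_matrix_mult])
next
  case (Suc n)
  have "has_ito_integral M F W t T (\<lambda>s w. (\<Sum>i<n. H i s w) + H n s w) (\<lambda>w. (\<Sum>i<n. V i w) + V n w)"
    by (rule has_ito_integral_add) (use Suc t in auto)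
  then show ?case by simp
qed

text \<open>The left end of each cell is the right place to freeze \<open>\<Psi>\<close>: the
  coefficient is then known when the cell begins. By closedness of the relation it remains to show
  convergence of the integrands, from the Lipschitz bound of \<open>\<Psi>\<close>, and of the
  values, from \<open>discretization_step\<close>.\<close>

theorem adjoint_difference_ito:
  assumes t: "t \<in> {0..T}"
  shows "has_ito_integral M F W t T (\<lambda>s w. \<Phi> t w ** \<Psi> s w ** Z s w) (\<lambda>w. Ya t w - Y t w)"
proof -
  obtain y z where yz: "0 \<le> y" "energy 0 T Y = ennreal y"
    "0 \<le> z" "energy 0 T Z = ennreal z"
    by (rule finite_energies)
  interpret mv: bounded_bilinear "(*v) :: real ^ 'n ^ 'n \<Rightarrow> _" by (rule bounded_bilinear_matrix_vector_mult)
  interpret mm: bounded_bilinear "(**) :: real ^ 'n ^ 'n \<Rightarrow> real ^ 'n ^ 'n \<Rightarrow> _" by (rule bounded_bilinear_matrix_matrix_mult)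
  define L where "L = T - t"
  \<comment> \<open>Using \<open>Suc N\<close> cells keeps the mesh meaningful for every
    \<open>N\<close>, with \<open>real (Suc N) * h N = L\<close> exactly; for \<open>t = T\<close>
    all cells are degenerate.\<close>
  define h where "h N = L / real (Suc N)" for N
  define r where "r N i = t + real i * h N" for N i
  have L: "0 \<le> L" using t by (simp add: L_def)
  have h0: "0 \<le> h N" for N using L by (simp add: h_def)
  have nh: "real (Suc N) * h N = L" for N by (simp add: h_def)
  have r0: "r N 0 = t" and rN: "r N (Suc N) = T" for N
    using nh[of N] by (simp_all add: r_def L_def)
  have rS: "r N (Suc i) - r N i = h N" for N i
    by (simp add: r_def algebra_simps)
  have r_mono: "r N i \<le> r N (Suc i)" for N i using rS[of N i] h0[of N] by linarith
  have r_ge: "t \<le> r N i" for N i using h0[of N] by (simp add: r_def)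
  have r_le: "r N i \<le> T" if "i \<le> Suc N" for N i
    using partition_mono[of "Suc N" "r N" i "Suc N"] r_mono that by (simp add: rN)
  have r_in: "r N i \<in> {0..T}" if "i \<le> Suc N" for N i
    using r_ge[of N i] r_le[OF that] t by auto
  define H where "H N s w = (\<Sum>i<Suc N. indicator {r N i<..r N (Suc i)} s *\<^sub>R ((\<Phi> t w ** \<Psi> (r N i) w) ** Z s w))" for N s w
  define V where "V N w = (\<Sum>i<Suc N. (\<Phi> t w ** \<Psi> (r N i) w) *v (J (r N i) w - J (r N (Suc i)) w))" for N w
  have \<Phi>\<Psi>: "norm (\<Phi> t w ** \<Psi> s w) \<le> B * B" if "s \<in> {0..T}" "w \<in> space M" for s w
    using B_nonneg
    by (intro order.trans[OF norm_matrix_matrix_mult_le] mult_mono \<Phi>_bound[OF t that(2)] \<Psi>_bound[OF that]) auto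
  have ito: "has_ito_integral M F W t T (H N) (V N)" for N
    unfolding H_def[abs_def] V_def[abs_def]
  proof (rule ito_sum[OF t], rule ito_piece)
    fix i assume "i < Suc N"
    then have i: "i \<le> Suc N" "Suc i \<le> Suc N" by auto
    show "0 \<le> t" "t \<le> r N i" "r N i \<le> r N (Suc i)" "r N (Suc i) \<le> T"
      using t r_ge r_mono r_le[OF i(2)] by auto
    have [measurable]: "\<Phi> t \<in> borel_measurable (F (r N i))" "\<Psi> (r N i) \<in> borel_measurable (F (r N i))"
      using measurable_F_mono[OF _ r_ge r_le[OF i(1)] prog_section[OF \<Phi>_prog[OF t] t]] t
        prog_section[OF \<Psi>_prog[OF r_in[OF i(1)]] r_in[OF i(1)]] by auto
    show "(\<lambda>w. \<Phi> t w ** \<Psi> (r N i) w) \<in> borel_measurable (F (r N i))"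
      by measurable
    show "bounded ((\<lambda>w. \<Phi> t w ** \<Psi> (r N i) w) ` space M)"
      using \<Phi>\<Psi>[OF r_in[OF i(1)]] by (auto simp: bounded_iff)
  qed
  let ?R = "restrict_space borel {t..T} \<Otimes>\<^sub>M M"
  have [measurable]: "(\<lambda>x. \<Psi> (fst x) (snd x)) \<in> borel_measurable ?R" "(\<lambda>x. Z (fst x) (snd x)) \<in> borel_measurable ?R"
    using measurable_restrict_interval_mono[OF prog_measurable_M[OF \<Psi>_prog[of T]], of t T]
      measurable_restrict_interval_mono[OF Z_measurable, of t T] t
    by (simp_all add: split_beta')
  have [measurable]: "(\<lambda>x. \<Phi> t (snd x)) \<in> borel_measurable ?R"
    using measurable_compose[OF measurable_snd measurable_section_M(2)[OF t]] .
  have Zm: "(\<lambda>(s, w). Z s w) \<in> borel_measurable ?R"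
    and Lm: "(\<lambda>(s, w). \<Phi> t w ** \<Psi> s w ** Z s w) \<in> borel_measurable ?R"
    unfolding split_beta' by measurable
  have Dm: "(\<lambda>w. Ya t w - Y t w) \<in> borel_measurable M"
    using Ya_measurable[OF t] measurable_section_M(3)[OF t] by simp
  have hlim: "h \<longlonglongrightarrow> 0"
    unfolding h_def[abs_def] using LIMSEQ_inverse_real_of_nat[THEN tendsto_mult_right_zero, of L]
    by (simp add: divide_inverse)
  show ?thesis
  proof (rule has_ito_integral_limit[OF ito _ order_refl Lm Dm])
    show "0 \<le> t" using t by simp
    show "(\<lambda>N. energy t T (\<lambda>s w. H N s w - \<Phi> t w ** \<Psi> s w ** Z s w)) \<longlonglongrightarrow> 0"
    proof (rule tendsto_ennreal_sandwich)
      fix N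
      \<comment> \<open>The left-open cells miss the initial time \<open>t\<close>, where
        \<open>H N\<close> is zero and the difference need not be small. Setting it to zero at this
        single time leaves the energy unchanged and makes the pointwise bound valid
        throughout.\<close>
      define E where "E s w = (if s = t then 0 else H N s w - \<Phi> t w ** \<Psi> s w ** Z s w)" for s w
      have Hm: "(\<lambda>x. H N (fst x) (snd x)) \<in> borel_measurable ?R"
        using has_ito_integralD(1)[OF ito] by (simp add: split_beta')
      have "(\<lambda>x. x) \<in> borel_measurable (restrict_space borel {t..T})"
        by (rule measurable_restrict_space1) simp
      from measurable_compose[OF measurable_fst[of _ M] this]
      have [measurable]: "fst \<in> borel_measurable ?R" by simp
      have Em: "(\<lambda>(s, w). E s w) \<in> borel_measurable ?R"
        unfolding E_def split_beta' using Hm by measurable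
      have "energy t T (\<lambda>s w. H N s w - \<Phi> t w ** \<Psi> s w ** Z s w) = energy t T E"
        by (rule mean_square_energy_cong) (simp add: E_def)
      also have "\<dots> \<le> ennreal ((B * (B * K * h N))\<^sup>2) * energy t T Z"
      proof (rule energy_mono_scaled[OF Em Zm])
        show "0 \<le> B * (B * K * h N)" using B_nonneg K_nonneg h0 by simp
        fix s w assume s: "s \<in> {t..T}" and w: "w \<in> space M"
        show "norm (E s w) \<le> B * (B * K * h N) * norm (Z s w)"
        proof (cases "s = t")
          case True
          then show ?thesis using B_nonneg K_nonneg h0 by (simp add: E_def)
        next
          case False
          \<comment> \<open>Exactly one cell contains \<open>s\<close>; multiplying by this 1 brings
            both integrands under the same sum.\<close>
          have one: "(\<Sum>i<Suc N. indicator {r N i<..r N (Suc i)} s) = (1 :: real)"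
            using partition_indicator_sum[of "Suc N" "r N" s, OF r_mono] False s
            by (simp only: r0 rN) (simp add: indicator_def)
          have "E s w = H N s w - (\<Sum>i<Suc N. indicator {r N i<..r N (Suc i)} s) *\<^sub>R (\<Phi> t w ** \<Psi> s w ** Z s w)"
            unfolding one using False by (simp add: E_def)
          also have "\<dots> = (\<Sum>i<Suc N. indicator {r N i<..r N (Suc i)} s *\<^sub>R ((\<Phi> t w ** (\<Psi> (r N i) w - \<Psi> s w)) ** Z s w))"
            unfolding H_def by (simp only: scaleR_sum_left sum_subtractf[symmetric] scaleR_diff_right[symmetric]
                mm.diff_left[symmetric] mm.diff_right[symmetric])
          finally have "norm (E s w) \<le> (\<Sum>i<Suc N. norm (indicator {r N i<..r N (Suc i)} s *\<^sub>R ((\<Phi> t w ** (\<Psi> (r N i) w - \<Psi> s w)) ** Z s w)))"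
            by (simp only: norm_sum)
          also have "\<dots> \<le> (\<Sum>i<Suc N. indicator {r N i<..r N (Suc i)} s * (B * (B * K * h N) * norm (Z s w)))"
          proof (rule sum_mono)
            fix i assume "i \<in> {..<Suc N}"
            then have i: "i \<le> Suc N" by simp
            show "norm (indicator {r N i<..r N (Suc i)} s *\<^sub>R ((\<Phi> t w ** (\<Psi> (r N i) w - \<Psi> s w)) ** Z s w)) \<le>
                indicator {r N i<..r N (Suc i)} s * (B * (B * K * h N) * norm (Z s w))"
            proof (cases "s \<in> {r N i<..r N (Suc i)}")
              case True
              have "norm (\<Psi> s w - \<Psi> (r N i) w) \<le> B * K * (s - r N i)"
                by (rule \<Psi>_lipschitz) (use True s r_in[OF i] w in auto)
              also have "\<dots> \<le> B * K * h N"
                using True rS[of N i] B_nonneg K_nonneg by (intro mult_left_mono) auto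
              finally have "norm (\<Psi> (r N i) w - \<Psi> s w) \<le> B * K * h N"
                by (simp add: norm_minus_commute)
              then have "norm (\<Phi> t w ** (\<Psi> (r N i) w - \<Psi> s w)) \<le> B * (B * K * h N)"
                using B_nonneg by (intro order.trans[OF norm_matrix_matrix_mult_le] mult_mono \<Phi>_bound[OF t w]) auto
              then show ?thesis
                using True by (simp add: order.trans[OF norm_matrix_matrix_mult_le mult_right_mono])
            qed simp
          qed
          also have "\<dots> = B * (B * K * h N) * norm (Z s w)"
            unfolding sum_distrib_right[symmetric] one by simp
          finally show ?thesis .
        qed
      qed
      also have "\<dots> \<le> ennreal ((B * (B * K * h N))\<^sup>2) * ennreal z"
        using mean_square_energy_mono[of 0 t T T M Z] t yz by (intro mult_left_mono) auto
      also have "\<dots> = ennreal ((B * (B * K * h N))\<^sup>2 * z)"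
        using yz by (simp add: ennreal_mult)
      finally show "energy t T (\<lambda>s w. H N s w - \<Phi> t w ** \<Psi> s w ** Z s w) \<le> ennreal ((B * (B * K * h N))\<^sup>2 * z)" .
    next
      have "(\<lambda>N. (B * (B * K * h N))\<^sup>2 * z) \<longlonglongrightarrow> (B * (B * K * 0))\<^sup>2 * z"
        by (intro tendsto_intros hlim)
      from tendsto_ennrealI[OF this] show "(\<lambda>N. ennreal ((B * (B * K * h N))\<^sup>2 * z)) \<longlonglongrightarrow> 0"
        by simp
    qed
    show "(\<lambda>N. msq M (\<lambda>w. V N w - (Ya t w - Y t w))) \<longlonglongrightarrow> 0"
    proof (rule tendsto_ennreal_sandwich)
      fix N
      define D where "D i w = \<Psi> (r N (Suc i)) w *v Y (r N (Suc i)) w - \<Psi> (r N i) w *v Y (r N i) w -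
        \<Psi> (r N i) w *v (J (r N i) w - J (r N (Suc i)) w)" for i w
      have D_meas: "D i \<in> borel_measurable M" if "i < Suc N" for i
      proof -
        have [measurable]: "\<Psi> (r N (Suc i)) \<in> borel_measurable M" "Y (r N (Suc i)) \<in> borel_measurable M"
          "\<Psi> (r N i) \<in> borel_measurable M" "Y (r N i) \<in> borel_measurable M"
          "J (r N i) \<in> borel_measurable M" "J (r N (Suc i)) \<in> borel_measurable M"
          using measurable_section_M r_in[of i N] r_in[of "Suc i" N] J_measurable that by auto
        show ?thesis unfolding D_def[abs_def] by measurable
      qed
      \<comment> \<open>The increments of \<open>\<Psi> Y\<close> telescope over the cells.
        Multiplication by \<open>\<Phi> t\<close> turns the terminal value into \<open>Ya t\<close>
        and the initial one into \<open>Y t\<close>, so only the cell errors \<open>D i\<close>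
        separate \<open>V N\<close> from the claimed value.\<close>
      have "AE w in M. V N w - (Ya t w - Y t w) = - (\<Phi> t w *v (\<Sum>i<Suc N. D i w))"
        using AE_space Ya_T(1)
      proof eventually_elim
        fix w assume w: "w \<in> space M" and YT: "Y T w = Ya T w"
        have "(\<Sum>i<Suc N. D i w) = (\<Psi> T w *v Y T w - \<Psi> t w *v Y t w) -
          (\<Sum>i<Suc N. \<Psi> (r N i) w *v (J (r N i) w - J (r N (Suc i)) w))"
          unfolding D_def sum_subtractf[of _ _ "{..<Suc N}"]
          using sum_lessThan_telescope[of "\<lambda>i. \<Psi> (r N i) w *v Y (r N i) w" "Suc N"]
          by (simp only: r0 rN sum_subtractf)
        then have "\<Phi> t w *v (\<Sum>i<Suc N. D i w) = \<Phi> t w *v (\<Psi> T w *v Y T w) - \<Phi> t w *v (\<Psi> t w *v Y t w) - V N w"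
          unfolding V_def by (simp only: mv.diff_right mv.sum_right matrix_vector_mul_assoc)
        also have "\<Phi> t w *v (\<Psi> T w *v Y T w) = Ya t w"
          unfolding YT by (rule Ya_eq[OF t w, symmetric])
        also have "\<Phi> t w *v (\<Psi> t w *v Y t w) = Y t w"
          by (simp add: matrix_vector_mul_assoc \<Phi>_\<Psi>_inverse[OF t w])
        finally show "V N w - (Ya t w - Y t w) = - (\<Phi> t w *v (\<Sum>i<Suc N. D i w))" by simp
      qed
      then have "AE w in M. norm (V N w - (Ya t w - Y t w)) \<le> B * norm (\<Sum>i<Suc N. D i w)"
        using AE_space
      proof eventually_elim
        fix w assume "V N w - (Ya t w - Y t w) = - (\<Phi> t w *v (\<Sum>i<Suc N. D i w))" "w \<in> space M"
        then show "norm (V N w - (Ya t w - Y t w)) \<le> B * norm (\<Sum>i<Suc N. D i w)"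
          using order.trans[OF norm_matrix_vector_mult_le mult_right_mono[OF \<Phi>_bound[OF t]]] by (simp only: norm_minus_cancel norm_ge_zero)
      qed
      then have "msq M (\<lambda>w. V N w - (Ya t w - Y t w)) \<le> ennreal (B\<^sup>2) * msq M (\<lambda>w. \<Sum>i<Suc N. D i w)"
        by (intro msq_mono_scaled B_nonneg borel_measurable_sum D_meas) auto
      also have "msq M (\<lambda>w. \<Sum>i<Suc N. D i w) \<le> of_nat (Suc N) * (\<Sum>i<Suc N. msq M (D i))"
        by (rule msq_sum_le) (rule measurable_compose[OF D_meas borel_measurable_norm])
      also have "(\<Sum>i<Suc N. msq M (D i)) \<le>
          (\<Sum>i<Suc N. ennreal ((B * K)\<^sup>2 * (h N)\<^sup>2) * (16 * energy (r N i) (r N (Suc i)) Z + ennreal (6 * K\<^sup>2 * h N) * ennreal y))"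
      proof (rule sum_mono)
        fix i assume "i \<in> {..<Suc N}"
        then have i: "i \<le> Suc N" "Suc i \<le> Suc N" by auto
        show "msq M (D i) \<le> ennreal ((B * K)\<^sup>2 * (h N)\<^sup>2) * (16 * energy (r N i) (r N (Suc i)) Z + ennreal (6 * K\<^sup>2 * h N) * ennreal y)"
          using discretization_step[of "r N i" "r N (Suc i)"] r_in[OF i(1)] r_mono r_le[OF i(2)]
          unfolding rS yz(2) D_def[abs_def] by auto
      qed
      also have "\<dots> = ennreal ((B * K)\<^sup>2 * (h N)\<^sup>2) * (16 * (\<Sum>i<Suc N. energy (r N i) (r N (Suc i)) Z) + of_nat (Suc N) * (ennreal (6 * K\<^sup>2 * h N) * ennreal y))"
        by (simp only: sum_distrib_left[symmetric] sum.distrib sum_constant card_lessThan) (simp only: mult_ac)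
      \<comment> \<open>Energies over adjacent cells are additive, so their sum does not grow with
        the number of cells.\<close>
      also have "(\<Sum>i<Suc N. energy (r N i) (r N (Suc i)) Z) \<le> ennreal z"
      proof -
        have "(\<Sum>i<k. energy (r N i) (r N (Suc i)) Z) \<le> energy t (r N k) Z" if "k \<le> Suc N" for k
          using that
        proof (induction k)
          case (Suc k)
          have "(\<Sum>i<Suc k. energy (r N i) (r N (Suc i)) Z) \<le> energy t (r N k) Z + energy (r N k) (r N (Suc k)) Z"
            using Suc by (simp add: add_right_mono)
          also have "\<dots> = energy t (r N (Suc k)) Z"
            by (rule mean_square_energy_split[OF measurable_restrict_interval_mono[OF Z_measurable]])
              (use t r_ge r_mono r_le[OF Suc.prems] in auto)
          finally show ?case .
        qed simp
        from this[of "Suc N"] show ?thesis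
          using mean_square_energy_mono[of 0 t T T M Z] t yz by (auto simp del: sum.lessThan_Suc simp: rN)
      qed
      finally have "msq M (\<lambda>w. V N w - (Ya t w - Y t w)) \<le> ennreal (B\<^sup>2) * (of_nat (Suc N) * (ennreal ((B * K)\<^sup>2 * (h N)\<^sup>2) *
          (16 * ennreal z + of_nat (Suc N) * (ennreal (6 * K\<^sup>2 * h N) * ennreal y))))"
        by (simp add: mult_left_mono add_mono)
      also have "\<dots> = ennreal (B\<^sup>2 * (real (Suc N) * ((B * K)\<^sup>2 * (h N)\<^sup>2 * (16 * z + real (Suc N) * (6 * K\<^sup>2 * h N * y)))))"
        using yz h0[of N] by (simp add: ennreal_mult ennreal_plus ennreal_of_nat_eq_real_of_nat del: of_nat_Suc)
      \<comment> \<open>Each factor \<open>real (Suc N)\<close> pairs with one \<open>h N\<close> to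
        give \<open>L\<close>; the \<open>h N\<close> left over drives the limit.\<close>
      also have "B\<^sup>2 * (real (Suc N) * ((B * K)\<^sup>2 * (h N)\<^sup>2 * (16 * z + real (Suc N) * (6 * K\<^sup>2 * h N * y)))) =
          B\<^sup>2 * (B * K)\<^sup>2 * (real (Suc N) * h N) * h N * (16 * z + 6 * K\<^sup>2 * (real (Suc N) * h N) * y)"
        by algebra
      finally show "msq M (\<lambda>w. V N w - (Ya t w - Y t w)) \<le> ennreal (B\<^sup>2 * (B * K)\<^sup>2 * L * h N * (16 * z + 6 * K\<^sup>2 * L * y))"
        unfolding nh .
    next
      have "(\<lambda>N. B\<^sup>2 * (B * K)\<^sup>2 * L * h N * (16 * z + 6 * K\<^sup>2 * L * y)) \<longlonglongrightarrow> B\<^sup>2 * (B * K)\<^sup>2 * L * 0 * (16 * z + 6 * K\<^sup>2 * L * y)"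
        by (intro tendsto_intros hlim)
      from tendsto_ennrealI[OF this]
      show "(\<lambda>N. ennreal (B\<^sup>2 * (B * K)\<^sup>2 * L * h N * (16 * z + 6 * K\<^sup>2 * L * y))) \<longlonglongrightarrow> 0"
        by simp
    qed
  qed
qed

text \<open>Centring applies once \<open>Ya t - Y t\<close> has finite mean square, which follows
  from the isometry estimate, the bounds on \<open>\<Phi>\<close> and \<open>\<Psi>\<close>, and the
  energy of \<open>Z\<close>.\<close>

theorem adapted_adjoint_eq_cond_exp:
  assumes t: "t \<in> {0..T}"
  shows "AE w in M. Y t w = vec_cond_exp M (F t) (Ya t) w"
proof (rule vec_cond_exp_eqI[OF t prog_section[OF Y_prog[OF t] t] Ya_integrable[OF t] adjoint_difference_ito[OF t]])
  note ito = adjoint_difference_ito[OF t]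
  have Zm: "jointly_measurable t T Z"
    by (rule measurable_restrict_interval_mono[OF Z_measurable]) (use t in auto)
  have "msq M (\<lambda>w. Ya t w - Y t w) \<le> 4 * energy t T (\<lambda>s w. \<Phi> t w ** \<Psi> s w ** Z s w)"
    by (rule has_ito_integral_msq_le[OF ito]) (use t in auto)
  also have "energy t T (\<lambda>s w. \<Phi> t w ** \<Psi> s w ** Z s w) \<le> ennreal ((B * B)\<^sup>2) * energy t T Z"
    using B_nonneg t
    by (intro energy_mono_scaled[OF has_ito_integralD(1)[OF ito] Zm])
      (auto intro!: order.trans[OF norm_matrix_matrix_mult_le] mult_mono \<Phi>_bound \<Psi>_bound)
  also have "energy t T Z \<le> energy 0 T Z"
    by (rule mean_square_energy_mono) (use t in auto)
  finally have "msq M (\<lambda>w. Ya t w - Y t w) \<le> 4 * (ennreal ((B * B)\<^sup>2) * energy 0 T Z)"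
    by (simp add: mult_left_mono)
  also have "\<dots> < \<infinity>"
    using Z_energy by (auto simp: ennreal_mult_less_top)
  finally show "msq M (\<lambda>w. Ya t w - Y t w) < \<infinity>" .
qed

end


section \<open>Gradients and Jacobians\<close>

text \<open>The description operator is resolved by uniqueness of the derivative: a vector is
  determined by its inner products.\<close>

lemma gradient_eqI:
  assumes "GDERIV \<phi> x :> D"
  shows "gradient \<phi> x = D"
  unfolding gradient_def
proof (rule the_equality[where P = "\<lambda>D. GDERIV \<phi> x :> D", OF assms])
  fix D' assume "GDERIV \<phi> x :> D'"
  then have "(\<lambda>h. inner h D') = (\<lambda>h. inner h D)"
    using assms has_derivative_unique unfolding gderiv_def by blast
  then have "\<forall>h. inner h D' = inner h D" by meson
  then show "D' = D" by (rule vector_eq_ldot[THEN iffD1])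
qed

text \<open>Components become directional derivatives, which the difference quotients below
  approximate.\<close>

lemma gradient_eq_frechet_derivative:
  fixes \<phi> :: "real ^ 'n \<Rightarrow> real"
  assumes "\<phi> differentiable (at x)"
  shows "gradient \<phi> x $ i = frechet_derivative \<phi> (at x) (axis i 1)"
proof -
  let ?D = "frechet_derivative \<phi> (at x)"
  have D: "(\<phi> has_derivative ?D) (at x)"
    using assms by (simp add: frechet_derivative_works)
  interpret D: bounded_linear ?D by (rule has_derivative_bounded_linear[OF D])
  have "?D h = inner h (\<chi> i. ?D (axis i 1))" for h
  proof -
    have "h = (\<Sum>i\<in>UNIV. h $ i *\<^sub>R axis i 1)"
      using basis_expansion[of h] by (simp add: scalar_mult_eq_scaleR)
    then have "?D h = ?D (\<Sum>i\<in>UNIV. h $ i *\<^sub>R axis i 1)" by simp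
    then show ?thesis
      by (simp add: D.sum D.scaleR inner_vec_def)
  qed
  then have "?D = (\<lambda>h. inner h (\<chi> i. ?D (axis i 1)))" by (rule ext)
  then have "GDERIV \<phi> x :> (\<chi> i. ?D (axis i 1))"
    using D unfolding gderiv_def by simp
  from gradient_eqI[OF this] show ?thesis by simp
qed

text \<open>Since \<open>g\<close> does not depend on the state, the control cost, the control term
  and the trace are constant in \<open>x\<close>; only \<open>y \<bullet> f s x\<close> is
  differentiated. This makes the driver of the backward equation linear in \<open>Y\<close> and free
  of \<open>Z\<close>.\<close>

lemma gradient_hamiltonian:
  fixes f :: "real \<Rightarrow> real ^ 'n \<Rightarrow> real ^ 'n"
  assumes "f s differentiable (at x)"
  shows "gradient (\<lambda>x. hamiltonian f (\<lambda>r _. g r) s x y z u) x = transpose (jacobian (f s) (at x)) *v y"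
proof (rule gradient_eqI)
  let ?A = "jacobian (f s) (at x)"
  have D: "(f s has_derivative (\<lambda>h. ?A *v h)) (at x)"
    using assms jacobian_works by blast
  have "((\<lambda>x. hamiltonian f (\<lambda>r _. g r) s x y z u) has_derivative (\<lambda>h. y \<bullet> (?A *v h))) (at x)"
    unfolding hamiltonian_def by (auto intro!: derivative_eq_intros D)
  moreover have "y \<bullet> (?A *v h) = h \<bullet> (transpose ?A *v y)" for h
    using dot_lmul_matrix[of y ?A h] by (simp add: inner_commute)
  ultimately show "GDERIV (\<lambda>x. hamiltonian f (\<lambda>r _. g r) s x y z u) x :> transpose ?A *v y"
    unfolding gderiv_def by simp
qed

lemma difference_quotient_tendsto:
  fixes \<phi> :: "'a::real_normed_vector \<Rightarrow> 'b::real_normed_vector"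
  assumes D: "(\<phi> has_derivative D) (at x)"
  shows "(\<lambda>k. real (Suc k) *\<^sub>R (\<phi> (x + inverse (real (Suc k)) *\<^sub>R v) - \<phi> x)) \<longlonglongrightarrow> D v"
proof (cases "v = 0")
  case True
  then show ?thesis
    using bounded_linear.linear[OF has_derivative_bounded_linear[OF D]] by (simp add: linear_0)
next
  case False
  interpret D: bounded_linear D by (rule has_derivative_bounded_linear[OF D])
  \<comment> \<open>For a nonzero direction the steps \<open>e k\<close> are nonzero, as the
    punctured limit demands; the zero direction is the trivial case above.\<close>
  define e where "e k = inverse (real (Suc k)) *\<^sub>R v" for k
  have "e \<longlonglongrightarrow> 0 *\<^sub>R v"
    unfolding e_def[abs_def] by (intro tendsto_intros LIMSEQ_inverse_real_of_nat)
  then have "filterlim e (at 0) sequentially"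
    using False by (intro filterlim_atI) (auto simp: e_def)
  from filterlim_compose[OF conjunct2[OF D[unfolded has_derivative_at]] this]
  have "(\<lambda>k. norm (\<phi> (x + e k) - \<phi> x - D (e k)) / norm (e k)) \<longlonglongrightarrow> 0" .
  then have "(\<lambda>k. norm (\<phi> (x + e k) - \<phi> x - D (e k)) / norm (e k) * norm v) \<longlonglongrightarrow> 0"
    by (rule tendsto_mult_left_zero)
  moreover have "norm (\<phi> (x + e k) - \<phi> x - D (e k)) / norm (e k) * norm v = norm (real (Suc k) *\<^sub>R (\<phi> (x + e k) - \<phi> x) - D v)" for k
  proof -
    have eq: "real (Suc k) *\<^sub>R (\<phi> (x + e k) - \<phi> x) - D v = real (Suc k) *\<^sub>R (\<phi> (x + e k) - \<phi> x - D (e k))"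
      by (simp add: e_def D.scaleR scaleR_diff_right del: of_nat_Suc)
    have "norm (e k) = norm v / real (Suc k)"
      by (simp add: e_def divide_inverse del: of_nat_Suc)
    then show ?thesis
      unfolding eq norm_scaleR using False by (simp del: of_nat_Suc)
  qed
  ultimately have "(\<lambda>k. norm (real (Suc k) *\<^sub>R (\<phi> (x + e k) - \<phi> x) - D v)) \<longlonglongrightarrow> 0"
    by simp
  then show ?thesis
    unfolding e_def by (subst LIM_zero_iff[symmetric]) (rule tendsto_norm_zero_cancel)
qed

text \<open>The gradient of a merely differentiable function need not be continuous, but its
  components are pointwise limits of difference quotients of the continuous function
  \<open>\<phi>\<close>.\<close>

lemma gradient_measurable:
  fixes \<phi> :: "real ^ 'n \<Rightarrow> real"
  assumes "\<And>x. \<phi> differentiable (at x)"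
  shows "gradient \<phi> \<in> borel_measurable borel"
proof (rule borel_measurable_vecI)
  fix i
  have "continuous_on UNIV \<phi>"
    using assms by (auto intro!: differentiable_imp_continuous_on simp: differentiable_on_def intro: differentiable_at_withinI)
  then have [measurable]: "\<phi> \<in> borel_measurable borel"
    by (rule borel_measurable_continuous_onI)
  show "(\<lambda>x. gradient \<phi> x $ i) \<in> borel_measurable borel"
  proof (rule borel_measurable_LIMSEQ_metric)
    show "(\<lambda>x. real (Suc k) *\<^sub>R (\<phi> (x + inverse (real (Suc k)) *\<^sub>R axis i 1) - \<phi> x)) \<in> borel_measurable borel" for k
      by measurable
    show "(\<lambda>k. real (Suc k) *\<^sub>R (\<phi> (x + inverse (real (Suc k)) *\<^sub>R axis i 1) - \<phi> x)) \<longlonglongrightarrow> gradient \<phi> x $ i" for x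
      unfolding gradient_eq_frechet_derivative[OF assms]
      by (rule difference_quotient_tendsto) (use assms frechet_derivative_works in blast)
  qed
qed

section \<open>Bound and measurability of the Jacobian along the state\<close>

lemma jacobian_quotient_tendsto:
  fixes f :: "real ^ 'n \<Rightarrow> real ^ 'm"
  assumes "f differentiable (at x)"
  shows "(\<lambda>k. real (Suc k) *\<^sub>R (f (x + inverse (real (Suc k)) *\<^sub>R axis j 1) - f x)) \<longlonglongrightarrow> jacobian f (at x) *v axis j 1"
  by (rule difference_quotient_tendsto) (use assms jacobian_works in blast)

lemma matrix_entry_eq: "(A :: real ^ 'n ^ 'm) $ i $ j = (A *v axis j 1) $ i"
  by (simp add: matrix_vector_mult_basis column_def)

text \<open>Difference quotients of an \<open>L\<close>-Lipschitz function along unit vectors have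
  norm at most \<open>L\<close>, and hence so have the columns of the Jacobian. The dimension
  factors come from summing absolute values, first over a row and then over the rows; any constant
  serves as a bound for \<open>A\<close>.\<close>

lemma norm_jacobian_le:
  fixes f :: "real ^ 'n \<Rightarrow> real ^ 'm"
  assumes lip: "L-lipschitz_on UNIV f" and d: "f differentiable (at x)"
  shows "norm (jacobian f (at x)) \<le> real CARD('m) * (real CARD('n) * L)"
proof -
  let ?A = "jacobian f (at x)"
  have entry: "\<bar>?A $ i $ j\<bar> \<le> L" for i j
  proof -
    have "norm (?A *v axis j 1) \<le> L"
    proof (rule LIMSEQ_le_const2[OF tendsto_norm[OF jacobian_quotient_tendsto[OF d]]], rule exI, rule allI, rule impI)
      fix k :: nat
      have "norm (f (x + inverse (real (Suc k)) *\<^sub>R axis j 1) - f x) \<le> L * norm (inverse (real (Suc k)) *\<^sub>R (axis j 1 :: real ^ 'n))"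
        using lipschitz_onD[OF lip, of "x + inverse (real (Suc k)) *\<^sub>R axis j 1" x] by (simp add: dist_norm)
      also have "\<dots> = L / real (Suc k)"
        by (simp add: norm_axis_1 divide_inverse del: of_nat_Suc)
      finally show "norm (real (Suc k) *\<^sub>R (f (x + inverse (real (Suc k)) *\<^sub>R axis j 1) - f x)) \<le> L"
        unfolding norm_scaleR by (simp add: pos_le_divide_eq mult.commute del: of_nat_Suc)
    qed
    then show ?thesis
      unfolding matrix_entry_eq by (rule order.trans[OF component_le_norm_cart])
  qed
  have row: "norm (?A $ i) \<le> real CARD('n) * L" for i
  proof -
    have "norm (?A $ i) \<le> (\<Sum>j\<in>UNIV. \<bar>?A $ i $ j\<bar>)"
      by (rule norm_le_l1_cart)
    also have "\<dots> \<le> (\<Sum>j\<in>(UNIV :: 'n set). L)"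
      by (intro sum_mono entry)
    finally show ?thesis by simp
  qed
  have "norm ?A \<le> (\<Sum>i\<in>UNIV. norm (?A $ i))"
    unfolding norm_vec_def[of ?A] by (rule L2_set_le_sum) simp
  also have "\<dots> \<le> (\<Sum>i\<in>(UNIV :: 'm set). real CARD('n) * L)"
    by (intro sum_mono row)
  finally show ?thesis by simp
qed

text \<open>Along the state, the columns of the Jacobian are limits of difference quotients of
  \<open>f\<close>, which is jointly measurable in time and state. With \<open>N = F t\<close> this
  gives progressive measurability of \<open>A\<close>.\<close>

lemma jacobian_process_measurable:
  fixes f :: "real \<Rightarrow> real ^ 'n \<Rightarrow> real ^ 'm" and X :: "real \<Rightarrow> 'w \<Rightarrow> real ^ 'n"
  assumes f: "(\<lambda>(s, x). f s x) \<in> borel_measurable (restrict_space borel {0..T} \<Otimes>\<^sub>M borel)"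
    and d: "\<And>s x. s \<in> {0..T} \<Longrightarrow> f s differentiable (at x)"
    and X: "(\<lambda>(s, w). X s w) \<in> borel_measurable (restrict_space borel {0..t} \<Otimes>\<^sub>M N)"
    and t: "t \<le> T"
  shows "(\<lambda>(s, w). jacobian (f s) (at (X s w))) \<in> borel_measurable (restrict_space borel {0..t} \<Otimes>\<^sub>M N)"
proof -
  let ?R = "restrict_space borel {0..t} \<Otimes>\<^sub>M N"
  have Xm: "(\<lambda>w. X (fst w) (snd w)) \<in> borel_measurable ?R"
    using X by (simp add: split_beta')
  have fm: "(\<lambda>w. f (fst w) (X (fst w) (snd w) + v)) \<in> borel_measurable ?R" for v
  proof -
    have "(\<lambda>w. (fst w, X (fst w) (snd w) + v)) \<in> measurable ?R (restrict_space borel {0..T} \<Otimes>\<^sub>M borel)"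
      using Xm t
      by (intro measurable_Pair measurable_compose[OF measurable_fst measurable_restrict_interval]) auto
    from measurable_compose[OF this f] show ?thesis by simp
  qed
  have "(\<lambda>w. jacobian (f (fst w)) (at (X (fst w) (snd w))) *v axis j 1) \<in> borel_measurable ?R" for j
  proof (rule borel_measurable_LIMSEQ_metric)
    show "(\<lambda>w. real (Suc k) *\<^sub>R (f (fst w) (X (fst w) (snd w) + inverse (real (Suc k)) *\<^sub>R axis j 1) - f (fst w) (X (fst w) (snd w))))
        \<in> borel_measurable ?R" for k
      using fm[of "inverse (real (Suc k)) *\<^sub>R axis j 1"] fm[of 0] by (intro borel_measurable_scaleR borel_measurable_diff) simp_all
    fix w assume "w \<in> space ?R"
    then have "fst w \<in> {0..T}"
      using t by (auto simp: space_pair_measure space_restrict_space)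
    then show "(\<lambda>k. real (Suc k) *\<^sub>R (f (fst w) (X (fst w) (snd w) + inverse (real (Suc k)) *\<^sub>R axis j 1) - f (fst w) (X (fst w) (snd w))))
        \<longlonglongrightarrow> jacobian (f (fst w)) (at (X (fst w) (snd w))) *v axis j 1"
      by (intro jacobian_quotient_tendsto d)
  qed
  from borel_measurable_vec_component[OF this]
  have entries: "(\<lambda>w. jacobian (f (fst w)) (at (X (fst w) (snd w))) $ i $ j) \<in> borel_measurable ?R" for i j
    unfolding matrix_entry_eq .
  have "(\<lambda>w. jacobian (f (fst w)) (at (X (fst w) (snd w)))) \<in> borel_measurable ?R"
    by (intro borel_measurable_vecI entries)
  then show ?thesis
    by (simp add: split_beta')
qed

text \<open>Integrability of \<open>Ya t\<close> belongs to the conclusion, so that the conditional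
  expectation is taken of an integrable variable. The proof interprets the linear equation with
  coefficient \<open>transpose (A s w)\<close>.\<close>

theorem mainTheorem1:
  fixes M :: "'w measure" and F :: "real \<Rightarrow> 'w measure" and T :: real
    and W X U Y Ya :: "real \<Rightarrow> 'w \<Rightarrow> real ^ 'n"
    and Z A \<Phi> \<Psi> :: "real \<Rightarrow> 'w \<Rightarrow> real ^ 'n ^ 'n"
    and f :: "real \<Rightarrow> real ^ 'n \<Rightarrow> real ^ 'n" and g :: "real \<Rightarrow> real ^ 'n ^ 'n"
    and lf :: "real ^ 'n \<Rightarrow> real" and q0 :: "(real ^ 'n) measure"
  assumes T: "0 \<le> T"
    and filtered: "filtered_prob_space M F T"
    and wiener: "wiener_process M F T W"
    and generated: "generated_filtration M F T (X 0) W"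
    and f_measurable: "(\<lambda>(t, x). f t x) \<in> borel_measurable (restrict_space borel {0..T} \<Otimes>\<^sub>M borel)"
    and g_measurable: "g \<in> borel_measurable (restrict_space borel {0..T})"
    and f_differentiable: "\<And>t x. t \<in> {0..T} \<Longrightarrow> f t differentiable (at x)"
    and lipschitz: "\<exists>L. \<forall>t\<in>{0..T}. L-lipschitz_on UNIV (f t)"
    and growth: "\<exists>C. \<forall>t\<in>{0..T}. \<forall>x. norm (f t x) + norm (g t) \<le> C * (1 + norm x)"
    and U_adapted: "adapted_process M F T U"
    and U_energy: "mean_square_energy M 0 T U < \<infinity>"
    and X_process: "continuous_adapted_process M F T X"
    and X_initial: "distr M borel (X 0) = q0"
    and X_sde: "\<And>t. t \<in> {0..T} \<Longrightarrow>
      has_ito_integral M F W 0 t (\<lambda>s \<omega>. g s)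
        (\<lambda>\<omega>. X t \<omega> - X 0 \<omega> - (LINT s:{0..t}|lborel. f s (X s \<omega>) + g s *v U s \<omega>))"
    and lf_differentiable: "\<And>x. lf differentiable (at x)"
    and grad_lf_integrable: "integrable M (\<lambda>\<omega>. (norm (gradient lf (X T \<omega>)))\<^sup>2)"
    and Y_process: "continuous_adapted_process M F T Y"
    and Y_energy: "mean_square_energy M 0 T Y < \<infinity>"
    and Z_adapted: "adapted_process M F T Z"
    and Z_energy: "mean_square_energy M 0 T Z < \<infinity>"
    and Y_terminal: "AE \<omega> in M. Y T \<omega> = gradient lf (X T \<omega>)"
    and Y_bsde: "\<And>t. t \<in> {0..T} \<Longrightarrow>
      has_ito_integral M F W t T Z
        (\<lambda>\<omega>. Y T \<omega> - Y t \<omega> + (LINT s:{t..T}|lborel.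
           gradient (\<lambda>x. hamiltonian f (\<lambda>r _. g r) s x (Y s \<omega>) (Z s \<omega>) (U s \<omega>)) (X s \<omega>)))"
    and A: "\<And>t \<omega>. A t \<omega> = jacobian (f t) (at (X t \<omega>))"
    and Ya_terminal: "\<And>\<omega>. \<omega> \<in> space M \<Longrightarrow> Ya T \<omega> = gradient lf (X T \<omega>)"
    and Ya_ode: "\<And>\<omega>. \<omega> \<in> space M \<Longrightarrow>
      ode_solution T (\<lambda>s y. - (transpose (A s \<omega>) *v y)) (\<lambda>s. Ya s \<omega>)"
    and \<Phi>_initial: "\<And>\<omega>. \<omega> \<in> space M \<Longrightarrow> \<Phi> 0 \<omega> = mat 1"
    and \<Phi>_ode: "\<And>\<omega>. \<omega> \<in> space M \<Longrightarrow>
      ode_solution T (\<lambda>s P. - (transpose (A s \<omega>) ** P)) (\<lambda>s. \<Phi> s \<omega>)"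
    and \<Psi>_initial: "\<And>\<omega>. \<omega> \<in> space M \<Longrightarrow> \<Psi> 0 \<omega> = mat 1"
    and \<Psi>_ode: "\<And>\<omega>. \<omega> \<in> space M \<Longrightarrow>
      ode_solution T (\<lambda>s P. P ** transpose (A s \<omega>)) (\<lambda>s. \<Psi> s \<omega>)"
  shows "\<forall>t\<in>{0..T}.
    integrable M (Ya t) \<and>
    (AE \<omega> in M. Y t \<omega> = vec_cond_exp M (F t) (Ya t) \<omega>) \<and>
    has_ito_integral M F W t T (\<lambda>s \<omega>. \<Phi> t \<omega> ** \<Psi> s \<omega> ** Z s \<omega>) (\<lambda>\<omega>. Ya t \<omega> - Y t \<omega>)"
proof -
  interpret prob_space M
    using filtered by (simp add: filtered_prob_space_def)
  interpret wiener_filtration M F T W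
    by standard (rule filtered, rule wiener)
  obtain L where L: "\<And>t. t \<in> {0..T} \<Longrightarrow> L-lipschitz_on UNIV (f t)"
    using lipschitz by blast
  have X_prog: "(\<lambda>(s, w). X s w) \<in> borel_measurable (restrict_space borel {0..t} \<Otimes>\<^sub>M F t)" if "t \<in> {0..T}" for t
    using X_process that by (simp add: continuous_adapted_process_def)
  have XT: "X T \<in> borel_measurable M"
    using measurable_F_M[OF _ measurable_Pair2[OF X_prog[of T], of T]] T by (simp add: space_restrict_space)
  have grad: "(\<lambda>w. gradient lf (X T w)) \<in> borel_measurable M"
    by (rule measurable_compose[OF XT gradient_measurable[OF lf_differentiable]])
  interpret linear_backward_equation M F T W "real CARD('n) * (real CARD('n) * L)" "\<lambda>s w. transpose (A s w)" Z \<Phi> \<Psi> Y Ya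
  proof
    show "0 \<le> T" by (rule T)
    show "(\<lambda>(s, w). transpose (A s w)) \<in> borel_measurable (restrict_space borel {0..t} \<Otimes>\<^sub>M F t)" if t: "t \<in> {0..T}" for t
      using borel_measurable_transpose[OF jacobian_process_measurable[OF f_measurable f_differentiable X_prog[OF t]]] t
      by (simp add: A split_beta')
    show "norm (transpose (A s w)) \<le> real CARD('n) * (real CARD('n) * L)" if "s \<in> {0..T}" for s w
      unfolding A norm_transpose by (intro norm_jacobian_le L f_differentiable that)
    show "(\<lambda>(s, w). Y s w) \<in> borel_measurable (restrict_space borel {0..t} \<Otimes>\<^sub>M F t)" if "t \<in> {0..T}" for t
      using Y_process that by (simp add: continuous_adapted_process_def)
    show "mean_square_energy M 0 T Y < \<infinity>" "mean_square_energy M 0 T Z < \<infinity>"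
      by (rule Y_energy Z_energy)+
    show "(\<lambda>(s, w). Z s w) \<in> borel_measurable (restrict_space borel {0..T} \<Otimes>\<^sub>M M)"
      using Z_adapted by (simp add: adapted_process_def)
    \<comment> \<open>The Hamiltonian enters at this point: its gradient in the state is
      \<open>transpose (A s w) *v Y s w\<close>, which puts the driver into linear form.\<close>
    show "has_ito_integral M F W t T Z (\<lambda>w. Y T w - Y t w + (LINT s:{t..T}|lborel. transpose (A s w) *v Y s w))"
      if t: "t \<in> {0..T}" for t
    proof -
      have "(LINT s:{t..T}|lborel. gradient (\<lambda>x. hamiltonian f (\<lambda>r _. g r) s x (Y s w) (Z s w) (U s w)) (X s w)) =
          (LINT s:{t..T}|lborel. transpose (A s w) *v Y s w)" for w
        using t by (intro set_lebesgue_integral_cong) (auto simp: A gradient_hamiltonian f_differentiable)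
      then show ?thesis using Y_bsde[OF t] by simp
    qed
    show "AE w in M. Y T w = Ya T w"
      using Y_terminal AE_space by eventually_elim (simp add: Ya_terminal)
    show "Ya T \<in> borel_measurable M"
      using grad by (subst measurable_cong[OF Ya_terminal])
    have "msq M (Ya T) = msq M (\<lambda>w. gradient lf (X T w))"
      by (rule msq_cong_AE) (auto intro!: AE_I2 Ya_terminal)
    also have "\<dots> < \<infinity>"
      using grad_lf_integrable by (simp add: msq_def integrable_iff_bounded)
    finally show "msq M (Ya T) < \<infinity>" .
    show "ode_solution T (\<lambda>s y. - (transpose (A s w) *v y)) (\<lambda>s. Ya s w)"
      "\<Phi> 0 w = mat 1" "\<Psi> 0 w = mat 1"
      "ode_solution T (\<lambda>s P. - (transpose (A s w) ** P)) (\<lambda>s. \<Phi> s w)"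
      "ode_solution T (\<lambda>s P. P ** transpose (A s w)) (\<lambda>s. \<Psi> s w)" if "w \<in> space M" for w
      using that by (rule Ya_ode \<Phi>_initial \<Psi>_initial \<Phi>_ode \<Psi>_ode)+
  qed
  show ?thesis
    using Ya_integrable adapted_adjoint_eq_cond_exp adjoint_difference_ito by blast
qed

end
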